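(* For every state $\rho$ on $\mathbb{C}^d$, the distillable coherence equals the relative entropy of coherence: $$C_d(\rho)=C_r(\rho)=\min_{\sigma\in\Delta}S(\rho\|\sigma).$$
   Context: Fix an orthonormal (incoherent) basis $\{\ket{i}\}$ of $\mathbb{C}^d$; on tensor products the incoherent basis is the product basis. Incoherent states $\Delta$ are density matrices diagonal in this basis; $\Delta(\rho)=\sum_i\bra{i}\rho\ket{i}\ket{i}\!\bra{i}$. An incoherent operation is a CPTP map $T(\rho)=\sum_\ell K_\ell\rho K_\ell^\dagger$ having a Kraus representation with each $K_\ell=\sum_i c_\ell(i)\ket{j_\ell(i)}\!\bra{i}$ for some function $j_\ell$ of basis indices (input and output spaces may differ, each with its incoherent basis). $\Phi_2=\ket{\Phi_2}\!\bra{\Phi_2}$ with $\ket{\Phi_2}=\frac{1}{\sqrt2}(\ket{0}+\ket{1})$. Fidelity: $F(\rho,\sigma)=\operatorname{tr}\sqrt{\rho^{1/2}\sigma\rho^{1/2}}$. The distillable coherence $C_d(\rho)$ is the supremum of rates $R\ge0$ such that there exist incoherent operations $T_n$ with $F\big(T_n(\rho^{\otimes n}),\Phi_2^{\otimes \lfloor nR\rfloor}\big)\ge1-\epsilon_n$ where $\epsilon_n\to0$ as $n\to\infty$. $S(\rho\|\sigma)=\operatorname{tr}\rho(\log\rho-\log\sigma)$ is the quantum relative entropy (logarithms base 2). *)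

theory Defs
  imports "Jordan_Normal_Form.Matrix" "HOL-Library.Extended_Real"
begin

definition adj :: "complex mat \<Rightarrow> complex mat" where
  "adj A = mat (dim_col A) (dim_row A) (\<lambda>(i,j). cnj (A $$ (j,i)))"

definition mtrace :: "complex mat \<Rightarrow> complex" where
  "mtrace A = (\<Sum>i<dim_row A. A $$ (i,i))"

definition hermitian :: "complex mat \<Rightarrow> bool" where
  "hermitian A \<longleftrightarrow> square_mat A \<and> adj A = A"

definition unitary :: "complex mat \<Rightarrow> bool" where
  "unitary U \<longleftrightarrow> square_mat U \<and> adj U * U = 1\<^sub>m (dim_row U) \<and> U * adj U = 1\<^sub>m (dim_row U)"

definition psd :: "complex mat \<Rightarrow> bool" where
  "psd A \<longleftrightarrow> hermitian A \<and>
     (\<forall>v \<in> carrier_vec (dim_row A). 0 \<le> Re (\<Sum>i<dim_row A. cnj (v $ i) * (A *\<^sub>v v) $ i))"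

definition density :: "nat \<Rightarrow> complex mat \<Rightarrow> bool" where
  "density d \<rho> \<longleftrightarrow> \<rho> \<in> carrier_mat d d \<and> psd \<rho> \<and> mtrace \<rho> = 1"

definition mat_fun :: "(real \<Rightarrow> complex) \<Rightarrow> complex mat \<Rightarrow> complex mat" where
  "mat_fun f A = (SOME B. \<exists>U D. U \<in> carrier_mat (dim_row A) (dim_row A) \<and> unitary U \<and>
      D \<in> carrier_mat (dim_row A) (dim_row A) \<and> diagonal_mat D \<and>
      (\<forall>i < dim_row A. D $$ (i,i) \<in> \<real>) \<and>
      A = U * D * adj U \<and>
      B = U * mat (dim_row A) (dim_row A) (\<lambda>(i,j). if i = j then f (Re (D $$ (i,i))) else 0) * adj U)"

definition sqrtm :: "complex mat \<Rightarrow> complex mat" where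
  "sqrtm A = mat_fun (\<lambda>x. complex_of_real (sqrt x)) A"

text \<open>Base-2 logarithm on the support (zero eigenvalues are mapped to 0, i.e. 0 log 0 = 0).\<close>
definition logm :: "complex mat \<Rightarrow> complex mat" where
  "logm A = mat_fun (\<lambda>x. if x > 0 then complex_of_real (log 2 x) else 0) A"

definition fidelity :: "complex mat \<Rightarrow> complex mat \<Rightarrow> real" where
  "fidelity \<rho> \<sigma> = Re (mtrace (sqrtm (sqrtm \<rho> * \<sigma> * sqrtm \<rho>)))"

text \<open>Quantum relative entropy, +\<infinity> unless supp rho \<subseteq> supp sigma (i.e. ker sigma \<subseteq> ker rho).\<close>
definition rel_entropy :: "complex mat \<Rightarrow> complex mat \<Rightarrow> ereal" where
  "rel_entropy \<rho> \<sigma> =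
     (if (\<forall>v \<in> carrier_vec (dim_col \<sigma>). \<sigma> *\<^sub>v v = 0\<^sub>v (dim_row \<sigma>) \<longrightarrow> \<rho> *\<^sub>v v = 0\<^sub>v (dim_row \<rho>))
      then ereal (Re (mtrace (\<rho> * (logm \<rho> - logm \<sigma>))))
      else \<infinity>)"

definition kron :: "complex mat \<Rightarrow> complex mat \<Rightarrow> complex mat" where
  "kron A B = mat (dim_row A * dim_row B) (dim_col A * dim_col B)
     (\<lambda>(i,j). A $$ (i div dim_row B, j div dim_col B) * B $$ (i mod dim_row B, j mod dim_col B))"

fun tpow :: "nat \<Rightarrow> complex mat \<Rightarrow> complex mat" where
  "tpow 0 A = 1\<^sub>m 1"
| "tpow (Suc n) A = kron (tpow n A) A"

definition Phi2 :: "complex mat" where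
  "Phi2 = mat 2 2 (\<lambda>_. 1/2)"

definition incoherent_state :: "nat \<Rightarrow> complex mat \<Rightarrow> bool" where
  "incoherent_state d \<sigma> \<longleftrightarrow> density d \<sigma> \<and> diagonal_mat \<sigma>"

text \<open>Incoherent operation from C^din to C^dout: a CPTP map with a (finite) Kraus representation
  whose Kraus operators each have at most one nonzero entry in every column,
  i.e. K = sum_i c(i) |j(i)><i|.\<close>
definition incoherent_op :: "nat \<Rightarrow> nat \<Rightarrow> (complex mat \<Rightarrow> complex mat) \<Rightarrow> bool" where
  "incoherent_op din dout T \<longleftrightarrow>
     (\<exists>Ks :: complex mat list.
        (\<forall>K \<in> set Ks. K \<in> carrier_mat dout din \<and>
           (\<forall>i < din. \<forall>j < dout. \<forall>j' < dout. K $$ (j,i) \<noteq> 0 \<and> K $$ (j',i) \<noteq> 0 \<longrightarrow> j = j')) \<and>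
        foldr (\<lambda>K acc. adj K * K + acc) Ks (0\<^sub>m din din) = 1\<^sub>m din \<and>
        (\<forall>\<rho> \<in> carrier_mat din din. T \<rho> = foldr (\<lambda>K acc. K * \<rho> * adj K + acc) Ks (0\<^sub>m dout dout)))"

definition distillable_coherence :: "nat \<Rightarrow> complex mat \<Rightarrow> ereal" where
  "distillable_coherence d \<rho> = Sup {ereal R | R. R \<ge> 0 \<and>
     (\<exists>(T :: nat \<Rightarrow> complex mat \<Rightarrow> complex mat) (\<epsilon> :: nat \<Rightarrow> real).
        (\<forall>n. incoherent_op (d ^ n) (2 ^ nat \<lfloor>real n * R\<rfloor>) (T n)) \<and>
        \<epsilon> \<longlonglongrightarrow> 0 \<and>
        (\<forall>n. fidelity (T n (tpow n \<rho>)) (tpow (nat \<lfloor>real n * R\<rfloor>) Phi2) \<ge> 1 - \<epsilon> n))}"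

definition rel_entropy_coherence :: "nat \<Rightarrow> complex mat \<Rightarrow> ereal" where
  "rel_entropy_coherence d \<rho> = (INF \<sigma> \<in> {\<sigma>. incoherent_state d \<sigma>}. rel_entropy \<rho> \<sigma>)"

end

theory Submission
  imports Defs "Jordan_Normal_Form.Spectral_Radius" "HOL-Analysis.Convex" "HOL-Library.Indicator_Function"
begin

text \<open>
  By Gibbs' inequality the minimum defining \<open>C\<^sub>r(\<rho>)\<close> is attained at the diagonal part \<open>\<Delta>(\<rho>)\<close> and equals
  \<open>H - S\<close>, the entropy of the diagonal of \<open>\<rho>\<close> minus the entropy of its spectrum.

  Converse: pulling the maximally coherent state of dimension \<open>M\<close> back through an incoherent operation gives an effect
  \<open>0 \<le> E \<le> 1\<close> whose diagonal entries all equal \<open>1/M\<close>. On typical eigenvectors the state \<open>\<rho>\<^sup>\<otimes>\<^sup>n\<close> is at most \<open>2\<^sup>-\<^sup>n\<^sup>S\<close>,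
  and compressing \<open>E\<close> to the at most \<open>2\<^sup>n\<^sup>H\<close> typical basis vectors gives trace at most \<open>2\<^sup>n\<^sup>H / M\<close>,
  so the squared fidelity is at most about \<open>2 \<cdot> 2\<^sup>n\<^sup>(\<^sup>H\<^sup>-\<^sup>S\<^sup>) / M\<close>.

  Achievability: let \<open>\<Pi>\<close> project onto the typical eigenvectors and \<open>Q\<close> onto the typical basis vectors, hash the
  basis vectors into \<open>M\<close> bins and let \<open>T\<close> be \<open>M Q \<Pi> Q\<close> with all entries between different bins deleted. For
  random bins and \<open>M\<close> below \<open>2\<^sup>n\<^sup>(\<^sup>H\<^sup>-\<^sup>S\<^sup>)\<close>, \<open>T\<close> acts on average like the identity on typical eigenvectors. The incoherent
  operation sending the bin number to the output, with Kraus rows taken from \<open>2 sqrt M \<Pi> Q (1 + T)\<^sup>-\<^sup>1\<close> and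
  completed by \<open>(1 - T) (1 + T)\<^sup>-\<^sup>1\<close>, has fidelity at least the average of \<open>2 Q (1 + T)\<^sup>-\<^sup>1 \<ge> Q (3 - T) Q / 2\<close>, so only
  the first moment of \<open>T\<close> over the hash functions is needed.
\<close>

subsection \<open>Spectral theorem\<close>

text \<open>Square matrices of size \<open>N\<close> are represented by functions on indices of which only the values below
  \<open>N\<close> matter. Multiplication is then associative without carrier conditions, at the price of
  \<open>eqm\<close> in place of equality. \<open>fc N u g\<close> is \<open>u diag(g) u\<^sup>*\<close>; a Hermitian matrix has the form \<open>fc N u l\<close>, and
  applying \<open>f\<close> to it gives \<open>fc N u (f \<circ> l)\<close>.\<close>

definition mm :: "nat \<Rightarrow> (nat \<Rightarrow> nat \<Rightarrow> complex) \<Rightarrow> (nat \<Rightarrow> nat \<Rightarrow> complex) \<Rightarrow> nat \<Rightarrow> nat \<Rightarrow> complex" where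
  "mm N A B = (\<lambda>i j. \<Sum>k<N. A i k * B k j)"

definition ct :: "(nat \<Rightarrow> nat \<Rightarrow> complex) \<Rightarrow> nat \<Rightarrow> nat \<Rightarrow> complex" where
  "ct A = (\<lambda>i j. cnj (A j i))"

definition eqm :: "nat \<Rightarrow> (nat \<Rightarrow> nat \<Rightarrow> complex) \<Rightarrow> (nat \<Rightarrow> nat \<Rightarrow> complex) \<Rightarrow> bool" where
  "eqm N A B \<longleftrightarrow> (\<forall>i<N. \<forall>j<N. A i j = B i j)"

definition idm :: "nat \<Rightarrow> nat \<Rightarrow> complex" where
  "idm = (\<lambda>i j. if i = j then 1 else 0)"

definition onb :: "nat \<Rightarrow> (nat \<Rightarrow> nat \<Rightarrow> complex) \<Rightarrow> bool" where
  "onb N u \<longleftrightarrow> eqm N (mm N (ct u) u) idm \<and> eqm N (mm N u (ct u)) idm"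

definition fc :: "nat \<Rightarrow> (nat \<Rightarrow> nat \<Rightarrow> complex) \<Rightarrow> (nat \<Rightarrow> real) \<Rightarrow> nat \<Rightarrow> nat \<Rightarrow> complex" where
  "fc N u g = (\<lambda>i j. \<Sum>k<N. u i k * complex_of_real (g k) * cnj (u j k))"

section \<open>Matrix algebra for index functions\<close>

lemma mm_assoc: "mm N (mm N A B) C = mm N A (mm N B C)"
proof (intro ext)
  fix i j
  have "mm N (mm N A B) C i j = (\<Sum>k<N. \<Sum>l<N. A i l * B l k * C k j)"
    by (simp add: mm_def sum_distrib_right)
  also have "\<dots> = (\<Sum>l<N. \<Sum>k<N. A i l * B l k * C k j)" by (rule sum.swap)
  also have "\<dots> = mm N A (mm N B C) i j"
    by (simp add: mm_def sum_distrib_left mult.assoc)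
  finally show "mm N (mm N A B) C i j = mm N A (mm N B C) i j" .
qed

lemma eqm_refl [simp]: "eqm N A A" by (simp add: eqm_def)
lemma eqm_sym: "eqm N A B \<Longrightarrow> eqm N B A" by (simp add: eqm_def)
lemma eqm_trans [trans]: "eqm N A B \<Longrightarrow> eqm N B C \<Longrightarrow> eqm N A C" by (simp add: eqm_def)
lemma eqm_mm: "eqm N A A' \<Longrightarrow> eqm N B B' \<Longrightarrow> eqm N (mm N A B) (mm N A' B')"
  by (auto simp: eqm_def mm_def intro!: sum.cong)
lemma eqm_ct: "eqm N A B \<Longrightarrow> eqm N (ct A) (ct B)"
  by (simp add: eqm_def ct_def)
lemma mm_id_left: "eqm N (mm N idm A) A"
  by (auto simp: eqm_def mm_def idm_def if_distrib[of "\<lambda>x. x * _"] cong: if_cong)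
lemma mm_id_right: "eqm N (mm N A idm) A"
  by (auto simp: eqm_def mm_def idm_def if_distrib[of "\<lambda>x. _ * x"] cong: if_cong)
lemma ct_mm: "ct (mm N A B) = mm N (ct B) (ct A)"
  by (simp add: fun_eq_iff ct_def mm_def mult.commute)
lemma ct_ct [simp]: "ct (ct A) = A" by (simp add: ct_def)
lemma ct_idm [simp]: "ct idm = idm" by (auto simp: ct_def idm_def fun_eq_iff)

text \<open>Rotating the eigenbasis \<open>b\<close> by \<open>H\<close> conjugates the matrix by
  \<open>H\<close>. The induction for the spectral theorem uses this to undo a change of
  basis.\<close>

lemma fc_mm: "fc N (mm N H b) g = mm N (mm N H (fc N b g)) (ct H)"
proof (intro ext)
  fix i j
  have "fc N (mm N H b) g i j = (\<Sum>k<N. \<Sum>l<N. \<Sum>m<N. H i l * b l k * complex_of_real (g k) * cnj (H j m * b m k))"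
    by (simp add: fc_def mm_def sum_distrib_left sum_distrib_right mult_ac)
  also have "\<dots> = (\<Sum>l<N. \<Sum>k<N. \<Sum>m<N. H i l * b l k * complex_of_real (g k) * cnj (H j m * b m k))"
    by (rule sum.swap)
  also have "\<dots> = (\<Sum>l<N. \<Sum>m<N. \<Sum>k<N. H i l * b l k * complex_of_real (g k) * cnj (H j m * b m k))"
    by (rule sum.cong[OF refl], rule sum.swap)
  also have "\<dots> = (\<Sum>m<N. \<Sum>l<N. \<Sum>k<N. H i l * b l k * complex_of_real (g k) * cnj (H j m * b m k))"
    by (rule sum.swap)
  also have "\<dots> = mm N (mm N H (fc N b g)) (ct H) i j"
    by (simp add: fc_def mm_def ct_def sum_distrib_left sum_distrib_right mult_ac)
  finally show "fc N (mm N H b) g i j = mm N (mm N H (fc N b g)) (ct H) i j" .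
qed

lemma onb_mm:
  assumes "onb N H" "onb N b" shows "onb N (mm N H b)"
proof -
  have H: "eqm N (mm N (ct H) H) idm" "eqm N (mm N H (ct H)) idm"
    and b: "eqm N (mm N (ct b) b) idm" "eqm N (mm N b (ct b)) idm"
    using assms by (auto simp: onb_def)
  have "eqm N (mm N (ct b) (mm N (mm N (ct H) H) b)) (mm N (ct b) (mm N idm b))"
    by (intro eqm_mm eqm_refl H)
  also have "eqm N (mm N (ct b) (mm N idm b)) (mm N (ct b) b)"
    by (intro eqm_mm eqm_refl mm_id_left)
  also note b(1)
  finally have 1: "eqm N (mm N (ct (mm N H b)) (mm N H b)) idm"
    by (simp add: ct_mm mm_assoc)
  have "eqm N (mm N H (mm N (mm N b (ct b)) (ct H))) (mm N H (mm N idm (ct H)))"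
    by (intro eqm_mm eqm_refl b)
  also have "eqm N (mm N H (mm N idm (ct H))) (mm N H (ct H))"
    by (intro eqm_mm eqm_refl mm_id_left)
  also note H(2)
  finally have 2: "eqm N (mm N (mm N H b) (ct (mm N H b))) idm"
    by (simp add: ct_mm mm_assoc)
  from 1 2 show ?thesis by (simp add: onb_def)
qed

section \<open>Eigenvectors and the reflection step\<close>

lemma exists_eigenvector:
  fixes A :: "nat \<Rightarrow> nat \<Rightarrow> complex"
  assumes "N > 0"
  shows "\<exists>v e. (\<exists>i<N. v i \<noteq> 0) \<and> (\<forall>i<N. (\<Sum>j<N. A i j * v j) = e * v i)"
proof -
  let ?A = "mat N N (\<lambda>(i,j). A i j)"
  have "spectrum ?A \<noteq> {}" by (rule spectrum_non_empty[of _ N]) (use assms in auto)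
  then obtain e v where ev: "eigenvector ?A v e"
    by (auto simp: spectrum_def eigenvalue_def)
  then have v: "v \<in> carrier_vec N" "v \<noteq> 0\<^sub>v N" "?A *\<^sub>v v = e \<cdot>\<^sub>v v"
    by (auto simp: eigenvector_def)
  have "(\<Sum>j<N. A i j * v $ j) = e * v $ i" if "i < N" for i
    using arg_cong[OF v(3), of "\<lambda>w. w $ i"] that v(1)
    by (auto simp: scalar_prod_def lessThan_atLeast0)
  moreover have "\<exists>i<N. v $ i \<noteq> 0"
    using v by (metis carrier_vecD eq_vecI index_zero_vec)
  ultimately show ?thesis by (intro exI[of _ "\<lambda>i. v $ i"] exI[of _ e]) auto
qed

text \<open>An eigenvector may be rescaled by any nonzero scalar. Besides normalisation, its phase
  is fixed so that the component at 0 is real and nonpositive; this keeps the denominator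
  \<open>c\<close> of the reflection in \<open>exists_reflection\<close> away from 0.\<close>

lemma exists_unit_eigenvector:
  fixes A :: "nat \<Rightarrow> nat \<Rightarrow> complex"
  assumes "N > 0"
  shows "\<exists>v e r. (\<forall>i<N. (\<Sum>j<N. A i j * v j) = e * (v i :: complex)) \<and>
     (\<Sum>i<N. v i * cnj (v i)) = 1 \<and> r \<ge> 0 \<and> v 0 = - complex_of_real r"
proof -
  obtain v e where v: "\<exists>i<N. v i \<noteq> 0" "\<And>i. i < N \<Longrightarrow> (\<Sum>j<N. A i j * v j) = e * (v i :: complex)"
    using exists_eigenvector[OF assms] by blast
  define s where "s = sqrt (\<Sum>i<N. (cmod (v i))\<^sup>2)"
  obtain i0 where i0: "i0 < N" "v i0 \<noteq> 0" using v by blast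
  have "0 < (cmod (v i0))\<^sup>2" using i0 by simp
  also have "\<dots> \<le> (\<Sum>i<N. (cmod (v i))\<^sup>2)" by (rule member_le_sum) (use i0 in auto)
  finally have s: "s > 0" "s^2 = (\<Sum>i<N. (cmod (v i))\<^sup>2)" unfolding s_def by auto
  \<comment> \<open>The unimodular factor that turns \<open>v 0\<close> into
    \<open>- cmod (v 0)\<close>; if \<open>v 0 = 0\<close> any phase will do and 1 is taken.\<close>
  define z where "z = (if v 0 = 0 then 1 else - cnj (v 0) / complex_of_real (cmod (v 0)))"
  have vv: "v 0 * cnj (v 0) = complex_of_real (cmod (v 0)) ^ 2"
    using complex_norm_square[of "v 0"] by simp
  have z: "z * cnj z = 1"
    using vv by (cases "v 0 = 0") (simp_all add: z_def power2_eq_square mult.commute)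
  have z0: "z * v 0 = - complex_of_real (cmod (v 0))"
    using vv by (cases "v 0 = 0") (simp_all add: z_def power2_eq_square mult.commute)
  define w where "w i = z * v i / complex_of_real s" for i
  have "(\<Sum>j<N. A i j * w j) = e * w i" if "i < N" for i
  proof -
    have "(\<Sum>j<N. A i j * w j) = z / complex_of_real s * (\<Sum>j<N. A i j * v j)"
      unfolding w_def sum_distrib_left by (simp add: mult_ac)
    then show ?thesis using v(2)[OF that] by (simp add: w_def)
  qed
  moreover have "(\<Sum>i<N. w i * cnj (w i)) = 1"
  proof -
    have "(\<Sum>i<N. w i * cnj (w i)) = (\<Sum>i<N. (z * cnj z) * (v i * cnj (v i)) / complex_of_real (s^2))"
      unfolding w_def by (simp add: power2_eq_square mult_ac)
    also have "\<dots> = (\<Sum>i<N. (v i * cnj (v i)) / complex_of_real (s^2))" unfolding z by simp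
    also have "\<dots> = complex_of_real (\<Sum>i<N. (cmod (v i))\<^sup>2) / complex_of_real (s^2)"
      by (simp add: complex_norm_square[symmetric] sum_divide_distrib)
    also have "\<dots> = 1" unfolding s(2)[symmetric] using s(1) by simp
    finally show ?thesis .
  qed
  moreover have "w 0 = - complex_of_real (cmod (v 0) / s)" by (simp add: w_def z0)
  ultimately show ?thesis using s(1)
    by (intro exI[of _ w] exI[of _ e] exI[of _ "cmod (v 0) / s"]) auto
qed

text \<open>Householder reflection along \<open>v - e\<^sub>0\<close>; it maps \<open>e\<^sub>0\<close> to \<open>v\<close>.\<close>
lemma exists_reflection:
  fixes v :: "nat \<Rightarrow> complex"
  assumes N: "N > 0" and v1: "(\<Sum>i<N. v i * cnj (v i)) = 1" and r: "r \<ge> 0" "v 0 = - complex_of_real r"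
  shows "\<exists>H. onb N H \<and> ct H = H \<and> (\<forall>i<N. H i 0 = v i)"
proof -
  \<comment> \<open>\<open>c\<close> is half the squared norm of \<open>w = v - e\<^sub>0\<close>,
    which is \<open>2 - 2 Re (v 0) = 2 * (1 + r)\<close>, so dividing by \<open>c\<close> gives the
    usual normalisation of a reflection along \<open>w\<close>.\<close>
  define c where "c = complex_of_real (1 + r)"
  have "1 + r \<noteq> 0" using r by simp
  then have c0: "c \<noteq> 0" unfolding c_def of_real_eq_0_iff .
  define w where "w i = v i - idm i 0" for i
  define H where "H i j = idm i j - w i * cnj (w j) / c" for i j
  have ww: "(\<Sum>i<N. w i * cnj (w i)) = 2 * c"
  proof -
    have "(\<Sum>i<N. w i * cnj (w i)) = (\<Sum>i<N. v i * cnj (v i) + (if i = 0 then 1 - v i - cnj (v i) else 0))"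
      by (rule sum.cong) (auto simp: w_def idm_def algebra_simps)
    also have "\<dots> = 2 * c" using N r v1 by (simp add: sum.distrib c_def)
    finally show ?thesis .
  qed
  have ctH: "ct H = H"
    by (auto simp: ct_def H_def fun_eq_iff c_def idm_def)
  have "mm N H H i j = idm i j" if ij: "i < N" "j < N" for i j
  proof -
    have "mm N H H i j = (\<Sum>k<N. idm i k * idm k j - idm i k * (w k * cnj (w j) / c) - (w i * cnj (w k) / c) * idm k j
        + (w i * cnj (w j) / c\<^sup>2) * (w k * cnj (w k)))"
      unfolding mm_def H_def using c0 by (intro sum.cong refl) (simp add: algebra_simps power2_eq_square)
    also have "\<dots> = idm i j - w i * cnj (w j) / c - w i * cnj (w j) / c + w i * cnj (w j) / c\<^sup>2 * (2 * c)"
      using ij unfolding sum.distrib sum_subtractf sum_distrib_left[symmetric] ww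
      by (simp add: idm_def if_distrib[of "\<lambda>x. x * _"] if_distrib[of "\<lambda>x. _ * x"] if_distrib[of "\<lambda>x. x / _"] cong: if_cong)
    also have "\<dots> = idm i j" using c0 by (simp add: power2_eq_square)
    finally show ?thesis .
  qed
  then have "onb N H" by (simp add: onb_def ctH eqm_def)
  moreover have "H i 0 = v i" if "i < N" for i
  proof -
    have "cnj (w 0) = - c" using r by (simp add: w_def idm_def c_def)
    then show ?thesis using c0 by (simp add: H_def w_def)
  qed
  ultimately show ?thesis using ctH by blast
qed

text \<open>By induction on the size: a reflection carries the basis vector with index 0 to a unit
  eigenvector, and conjugating by it leaves a real number in the corner and a smaller Hermitian
  matrix, which the induction hypothesis diagonalises.\<close>

theorem spectral_theorem:
  fixes A :: "nat \<Rightarrow> nat \<Rightarrow> complex"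
  assumes "\<And>i j. i < N \<Longrightarrow> j < N \<Longrightarrow> A j i = cnj (A i j)"
  shows "\<exists>u l. onb N u \<and> eqm N A (fc N u l)"
  using assms
proof (induction N arbitrary: A)
  case 0
  then show ?case by (auto simp: onb_def eqm_def)
next
  case (Suc N)
  let ?N = "Suc N"
  obtain v e r where v: "\<And>i. i < ?N \<Longrightarrow> (\<Sum>j<?N. A i j * v j) = e * (v i :: complex)"
     "(\<Sum>i<?N. v i * cnj (v i)) = 1" "r \<ge> 0" "v 0 = - complex_of_real r"
    using exists_unit_eigenvector[of ?N A, OF zero_less_Suc] by metis
  obtain H where H: "onb ?N H" "ct H = H" "\<And>i. i < ?N \<Longrightarrow> H i 0 = v i"
    using exists_reflection[OF zero_less_Suc v(2-4)] by metis
  have HH: "eqm ?N (mm ?N H H) idm" using H(1) unfolding onb_def H(2) by simp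
  have eqA: "eqm ?N (ct A) A" unfolding eqm_def ct_def by (intro allI impI Suc.prems[symmetric])
  define B where "B = mm ?N H (mm ?N A H)"
  have "eqm ?N (ct B) B"
    unfolding B_def ct_mm H(2) mm_assoc by (intro eqm_mm eqm_refl eqA)
  then have Bh: "B j i = cnj (B i j)" if "i < ?N" "j < ?N" for i j
    using that by (metis eqm_def ct_def)
  have B0: "B i 0 = e * idm i 0" if i: "i < ?N" for i
  proof -
    have "mm ?N A H k 0 = e * H k 0" if "k < ?N" for k
      using v(1)[OF that] H(3)  that by (simp add: mm_def del: sum.lessThan_Suc)
    then have "B i 0 = e * mm ?N H H i 0"
      unfolding B_def mm_def[of ?N H] sum_distrib_left by (intro sum.cong) auto
    then show ?thesis using HH i by (simp add: eqm_def)
  qed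
  \<comment> \<open>Hermiticity of the corner entry makes the eigenvalue real.\<close>
  have "cnj e = e" using Bh[of 0 0, symmetric] B0[of 0] by (simp add: idm_def)
  have B0': "B 0 j = cnj e * idm 0 j" if "j < ?N" for j
    using Bh[OF that, of 0] B0[OF that] by (simp add: idm_def)
  from \<open>cnj e = e\<close> obtain er where er: "e = complex_of_real er"
    by (metis Reals_cases Reals_cnj_iff)
  obtain u l where u: "onb N u" "eqm N (\<lambda>i j. B (Suc i) (Suc j)) (fc N u l)"
    using Suc.IH[of "\<lambda>i j. B (Suc i) (Suc j)", OF Bh] by (meson Suc_less_eq)
  \<comment> \<open>The eigenbasis of \<open>B\<close> is the direct sum of the one-dimensional
    identity and the eigenbasis of the lower block; multiplying by \<open>H\<close> returns to the
    original coordinates.\<close>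
  define b where "b = (\<lambda>i k. case (i,k) of (0,0) \<Rightarrow> 1 | (Suc i', Suc k') \<Rightarrow> u i' k' | _ \<Rightarrow> (0::complex))"
  define l' where "l' = (\<lambda>k. case k of 0 \<Rightarrow> er | Suc k' \<Rightarrow> l k')"
  have b: "b 0 0 = 1" "b (Suc i) 0 = 0" "b 0 (Suc i) = 0" "b (Suc i) (Suc j) = u i j" 
    "l' 0 = er" "l' (Suc i) = l i" for i j
    by (simp_all add: b_def l'_def)
  have "onb ?N b"
    using u(1) unfolding onb_def eqm_def
    by (auto simp: mm_def ct_def idm_def All_less_Suc2 sum.lessThan_Suc_shift b simp del: sum.lessThan_Suc)
  moreover have Bb: "eqm ?N (fc ?N b l') B"
    using u(2) B0 B0' unfolding eqm_def
    by (auto simp: fc_def idm_def All_less_Suc2 sum.lessThan_Suc_shift b er simp del: sum.lessThan_Suc)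
  ultimately have "onb ?N (mm ?N H b)" using onb_mm[OF H(1)] by blast
  moreover have "eqm ?N A (fc ?N (mm ?N H b) l')"
  proof -
    have "eqm ?N (mm ?N (mm ?N H (fc ?N b l')) (ct H)) (mm ?N (mm ?N H B) H)"
      unfolding H(2) by (intro eqm_mm eqm_refl Bb)
    also have "mm ?N (mm ?N H B) H = mm ?N (mm ?N H H) (mm ?N A (mm ?N H H))"
      by (simp add: B_def mm_assoc)
    also have "eqm ?N \<dots> (mm ?N idm (mm ?N A idm))" by (intro eqm_mm eqm_refl HH)
    also have "eqm ?N \<dots> (mm ?N A idm)" by (rule mm_id_left)
    also have "eqm ?N \<dots> A" by (rule mm_id_right)
    finally show ?thesis unfolding fc_mm by (rule eqm_sym)
  qed
  ultimately show ?case by blast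
qed

subsection \<open>Functions of Hermitian matrices\<close>

definition dg :: "(nat \<Rightarrow> real) \<Rightarrow> nat \<Rightarrow> nat \<Rightarrow> complex" where
  "dg g = (\<lambda>i j. if i = j then complex_of_real (g i) else 0)"

lemma mm_dg_right: "j < N \<Longrightarrow> mm N A (dg g) i j = A i j * complex_of_real (g j)"
  by (simp add: mm_def dg_def if_distrib[of "\<lambda>x. _ * x"] cong: if_cong)

lemma mm_dg_left: "i < N \<Longrightarrow> mm N (dg g) A i j = complex_of_real (g i) * A i j"
  by (simp add: mm_def dg_def if_distrib[of "\<lambda>x. x * _"] cong: if_cong)

lemma fc_eq: "fc N u g = mm N u (mm N (dg g) (ct u))"
proof (intro ext)
  fix i j
  have "mm N u (mm N (dg g) (ct u)) i j = (\<Sum>k<N. u i k * mm N (dg g) (ct u) k j)"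
    by (simp add: mm_def[of N u])
  also have "\<dots> = fc N u g i j"
    unfolding fc_def by (intro sum.cong) (simp_all add: mm_dg_left ct_def)
  finally show "fc N u g i j = mm N u (mm N (dg g) (ct u)) i j" ..
qed

lemma ct_fc [simp]: "ct (fc N u g) = fc N u g"
  by (simp add: ct_def fc_def fun_eq_iff mult_ac)

lemma fc_mm_basis:
  assumes "onb N u" shows "eqm N (mm N (fc N u g) u) (mm N u (dg g))"
proof -
  have "eqm N (mm N (mm N u (dg g)) (mm N (ct u) u)) (mm N (mm N u (dg g)) idm)"
    using assms by (intro eqm_mm eqm_refl) (simp add: onb_def)
  also have "eqm N \<dots> (mm N u (dg g))" by (rule mm_id_right)
  finally show ?thesis by (simp add: fc_eq mm_assoc)
qed

lemma basis_mm_fc: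
  assumes "onb N u" shows "eqm N (mm N (ct u) (fc N u g)) (mm N (dg g) (ct u))"
proof -
  have "ct (dg g) = dg g" by (auto simp: ct_def dg_def fun_eq_iff)
  then show ?thesis using eqm_ct[OF fc_mm_basis[OF assms, of g]] by (simp add: ct_mm)
qed

lemma fc_mult:
  assumes "onb N u" shows "eqm N (mm N (fc N u f) (fc N u g)) (fc N u (\<lambda>k. f k * g k))"
proof -
  have dg: "eqm N (mm N (dg f) (dg g)) (dg (\<lambda>k. f k * g k))"
    unfolding eqm_def by (intro allI impI, subst mm_dg_left) (auto simp: dg_def)
  have "eqm N (mm N (mm N (fc N u f) u) (mm N (dg g) (ct u))) (mm N (mm N u (dg f)) (mm N (dg g) (ct u)))"
    by (rule eqm_mm[OF fc_mm_basis[OF assms] eqm_refl])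
  also have "mm N (mm N u (dg f)) (mm N (dg g) (ct u)) = mm N u (mm N (mm N (dg f) (dg g)) (ct u))"
    by (simp only: mm_assoc)
  also have "eqm N \<dots> (mm N u (mm N (dg (\<lambda>k. f k * g k)) (ct u)))"
    by (intro eqm_mm eqm_refl dg)
  finally show ?thesis by (simp add: fc_eq mm_assoc)
qed

lemma fc_one:
  assumes "onb N u" shows "eqm N (fc N u (\<lambda>_. 1)) idm"
  using assms by (simp add: onb_def eqm_def fc_def mm_def ct_def)

lemma fc_add: "fc N u f i j + fc N u g i j = fc N u (\<lambda>k. f k + g k) i j"
  by (simp add: fc_def sum.distrib algebra_simps)

lemma fc_scale: "complex_of_real c * fc N u f i j = fc N u (\<lambda>k. c * f k) i j"
  by (simp add: fc_def sum_distrib_left algebra_simps)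

lemma fc_idm_basis: "eqm N (fc N idm g) (dg g)"
  by (auto simp: eqm_def fc_def idm_def dg_def if_distrib[of "\<lambda>x. x * _"] if_distrib[of "\<lambda>x. _ * x"]
     if_distrib[of cnj] cong: if_cong)

lemma onb_idm: "onb N idm"
  by (simp add: onb_def mm_id_left)

text \<open>Written in the two eigenbases, \<open>X\<close> becomes \<open>Y\<close> with
  \<open>Y i j * l j = m i * Y i j\<close>. Hence \<open>Y i j\<close> can be nonzero only where
  \<open>l j = m i\<close>, and there \<open>g (l j) = g (m i)\<close> for an arbitrary function
  \<open>g\<close>.\<close>

lemma intertwine:
  assumes u: "onb N u" and v: "onb N v"
    and X: "eqm N (mm N X (fc N u l)) (mm N (fc N v m) X)"
  shows "eqm N (mm N X (fc N u (\<lambda>k. g (l k)))) (mm N (fc N v (\<lambda>k. g (m k))) X)"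
proof -
  define Y where "Y = mm N (ct v) (mm N X u)"
  have "eqm N (mm N Y (dg l)) (mm N (ct v) (mm N X (mm N (fc N u l) u)))"
    unfolding Y_def mm_assoc by (rule eqm_mm[OF eqm_refl eqm_mm[OF eqm_refl eqm_sym[OF fc_mm_basis[OF u]]]])
  also have "\<dots> = mm N (ct v) (mm N (mm N X (fc N u l)) u)" by (simp add: mm_assoc)
  also have "eqm N \<dots> (mm N (ct v) (mm N (mm N (fc N v m) X) u))" by (intro eqm_mm eqm_refl X)
  also have "\<dots> = mm N (mm N (ct v) (fc N v m)) (mm N X u)" by (simp add: mm_assoc)
  also have "eqm N \<dots> (mm N (mm N (dg m) (ct v)) (mm N X u))"
    by (rule eqm_mm[OF basis_mm_fc[OF v] eqm_refl])
  also have "\<dots> = mm N (dg m) Y" by (simp add: Y_def mm_assoc)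
  finally have Y: "eqm N (mm N Y (dg l)) (mm N (dg m) Y)" .
  have Yg: "eqm N (mm N Y (dg (\<lambda>k. g (l k)))) (mm N (dg (\<lambda>k. g (m k))) Y)"
  proof -
    have "Y i j * complex_of_real (g (l j)) = complex_of_real (g (m i)) * Y i j" if "i < N" "j < N" for i j
    proof (cases "Y i j = 0")
      case False
      have "Y i j * complex_of_real (l j) = complex_of_real (m i) * Y i j"
        using Y that by (simp add: eqm_def mm_dg_left mm_dg_right)
      then have "l j = m i" using False by simp
      then show ?thesis by simp
    qed simp
    then show ?thesis by (simp add: eqm_def mm_dg_left mm_dg_right)
  qed
  have "eqm N (mm N idm (mm N X (fc N u (\<lambda>k. g (l k))))) (mm N (mm N v (ct v)) (mm N X (fc N u (\<lambda>k. g (l k)))))"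
    using v unfolding onb_def by (intro eqm_mm eqm_refl) (blast intro: eqm_sym)
  also have "\<dots> = mm N v (mm N (mm N Y (dg (\<lambda>k. g (l k)))) (ct u))"
    by (simp add: fc_eq Y_def mm_assoc)
  also have "eqm N \<dots> (mm N v (mm N (mm N (dg (\<lambda>k. g (m k))) Y) (ct u)))"
    by (intro eqm_mm eqm_refl Yg)
  also have "\<dots> = mm N (mm N (fc N v (\<lambda>k. g (m k))) X) (mm N u (ct u))"
    by (simp add: fc_eq Y_def mm_assoc)
  also have "eqm N \<dots> (mm N (mm N (fc N v (\<lambda>k. g (m k))) X) idm)"
    using u by (intro eqm_mm eqm_refl) (simp add: onb_def)
  also have "eqm N \<dots> (mm N (fc N v (\<lambda>k. g (m k))) X)" by (rule mm_id_right)
  finally show ?thesis using eqm_trans[OF eqm_sym[OF mm_id_left]] by blast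
qed

text \<open>The case of \<open>intertwine\<close> with \<open>X\<close> the identity: a function of
  a Hermitian matrix does not depend on the chosen diagonalisation.\<close>

lemma fc_unique:
  assumes "onb N u" "onb N v" "eqm N (fc N u l) (fc N v m)"
  shows "eqm N (fc N u (\<lambda>k. g (l k))) (fc N v (\<lambda>k. g (m k)))"
proof -
  have "eqm N (mm N idm (fc N u l)) (mm N (fc N v m) idm)"
    using assms(3) mm_id_left mm_id_right eqm_trans eqm_sym by metis
  from intertwine[OF assms(1,2) this, of g] show ?thesis
    using mm_id_left mm_id_right eqm_trans eqm_sym by metis
qed

text \<open>Block-diagonality of a Hermitian matrix passes to all its functions, because it amounts to
  commuting with the block projections.\<close>
lemma fc_block:
  assumes u: "onb N u" and z: "\<And>i j. i < N \<Longrightarrow> j < N \<Longrightarrow> c i \<noteq> c j \<Longrightarrow> fc N u l i j = 0"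
    and ij: "i < N" "j < N" "c i \<noteq> c j"
  shows "fc N u (\<lambda>k. g (l k)) i j = 0"
proof -
  define X where "X = dg (\<lambda>k. if c k = c i then 1 else 0)"
  have "eqm N (mm N X (fc N u l)) (mm N (fc N u l) X)"
    using z by (auto simp: eqm_def X_def mm_dg_left mm_dg_right)
  from intertwine[OF u u this, of g] have "mm N X (fc N u (\<lambda>k. g (l k))) i j = mm N (fc N u (\<lambda>k. g (l k))) X i j"
    using ij by (simp add: eqm_def)
  then show ?thesis using ij by (auto simp: X_def mm_dg_left mm_dg_right)
qed

section \<open>Quadratic forms, Parseval and traces\<close>

lemma fc_quadratic_form:
  "(\<Sum>i<N. \<Sum>j<N. cnj (x i) * fc N u g i j * x j) =
    complex_of_real (\<Sum>k<N. g k * (cmod (\<Sum>i<N. cnj (u i k) * x i))\<^sup>2)"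
proof -
  have "(\<Sum>i<N. \<Sum>j<N. cnj (x i) * fc N u g i j * x j) =
     (\<Sum>i<N. \<Sum>j<N. \<Sum>k<N. complex_of_real (g k) * (cnj (u j k) * x j) * (u i k * cnj (x i)))"
    by (simp add: fc_def sum_distrib_left sum_distrib_right mult_ac)
  also have "\<dots> = (\<Sum>i<N. \<Sum>k<N. \<Sum>j<N. complex_of_real (g k) * (cnj (u j k) * x j) * (u i k * cnj (x i)))"
    by (rule sum.cong[OF refl], rule sum.swap)
  also have "\<dots> = (\<Sum>k<N. \<Sum>i<N. \<Sum>j<N. complex_of_real (g k) * (cnj (u j k) * x j) * (u i k * cnj (x i)))"
    by (rule sum.swap)
  also have "\<dots> = (\<Sum>k<N. complex_of_real (g k) * ((\<Sum>j<N. cnj (u j k) * x j) * cnj (\<Sum>i<N. cnj (u i k) * x i)))"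
    by (simp add: sum_distrib_left sum_distrib_right mult_ac)
  also have "\<dots> = complex_of_real (\<Sum>k<N. g k * (cmod (\<Sum>i<N. cnj (u i k) * x i))\<^sup>2)"
    by (simp only: complex_norm_square[symmetric]) simp
  finally show ?thesis .
qed

lemma parseval:
  assumes "onb N u"
  shows "(\<Sum>k<N. (cmod (\<Sum>i<N. cnj (u i k) * x i))\<^sup>2) = (\<Sum>i<N. (cmod (x i))\<^sup>2)"
proof -
  \<comment> \<open>Parseval is the quadratic form of the identity, written as \<open>fc\<close> of
    the constant function 1.\<close>
  have "complex_of_real (\<Sum>k<N. 1 * (cmod (\<Sum>i<N. cnj (u i k) * x i))\<^sup>2) =
     (\<Sum>i<N. \<Sum>j<N. cnj (x i) * fc N u (\<lambda>_. 1) i j * x j)"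
    by (rule fc_quadratic_form[symmetric])
  also have "\<dots> = (\<Sum>i<N. \<Sum>j<N. cnj (x i) * idm i j * x j)"
    using fc_one[OF assms] by (intro sum.cong) (simp_all add: eqm_def)
  also have "\<dots> = (\<Sum>i<N. x i * cnj (x i))"
    by (simp add: idm_def if_distrib[of "\<lambda>x. x * _"] if_distrib[of "\<lambda>x. _ * x"] mult.commute cong: if_cong)
  also have "\<dots> = complex_of_real (\<Sum>i<N. (cmod (x i))\<^sup>2)"
    by (simp only: complex_norm_square[symmetric]) simp
  finally show ?thesis by (simp only: of_real_eq_iff mult_1)
qed

lemma parseval':
  assumes "onb N u"
  shows "(\<Sum>k<N. (cmod (\<Sum>i<N. c i * u i k))\<^sup>2) = (\<Sum>i<N. (cmod (c i))\<^sup>2)"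
proof -
  have "cmod (\<Sum>i<N. c i * u i k) = cmod (\<Sum>i<N. cnj (u i k) * cnj (c i))" for k
    by (subst complex_mod_cnj[symmetric]) (simp add: mult.commute)
  then show ?thesis using parseval[OF assms, of "\<lambda>i. cnj (c i)"] by simp
qed

lemma onb_col: "onb N u \<Longrightarrow> k < N \<Longrightarrow> l < N \<Longrightarrow> (\<Sum>i<N. cnj (u i k) * u i l) = (if k = l then 1 else 0)"
  by (simp add: onb_def eqm_def mm_def ct_def idm_def)

lemma onb_col_norm:
  assumes "onb N u" "k < N" shows "(\<Sum>i<N. (cmod (u i k))\<^sup>2) = 1"
proof -
  have "complex_of_real (\<Sum>i<N. (cmod (u i k))\<^sup>2) = (\<Sum>i<N. cnj (u i k) * u i k)"
    unfolding of_real_sum complex_norm_square by (simp add: mult.commute)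
  also have "\<dots> = 1" using onb_col[OF assms assms(2)] by simp
  finally show ?thesis by (simp only: of_real_eq_1_iff)
qed

lemma fc_diag: "fc N u g i i = complex_of_real (\<Sum>k<N. g k * (cmod (u i k))\<^sup>2)"
  unfolding fc_def of_real_sum of_real_mult complex_norm_square by (simp add: mult_ac)

lemma fc_trace:
  assumes "onb N u" shows "(\<Sum>i<N. fc N u g i i) = complex_of_real (\<Sum>k<N. g k)"
proof -
  have "(\<Sum>i<N. \<Sum>k<N. g k * (cmod (u i k))\<^sup>2) = (\<Sum>k<N. \<Sum>i<N. g k * (cmod (u i k))\<^sup>2)"
    by (rule sum.swap)
  also have "\<dots> = (\<Sum>k<N. g k)" 
    using onb_col_norm[OF assms] by (simp add: sum_distrib_left[symmetric])
  finally show ?thesis by (simp only: fc_diag of_real_sum[symmetric])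
qed

section \<open>Passage between library matrices and index functions\<close>

lemma adj_carrier [simp]: "A \<in> carrier_mat n m \<Longrightarrow> adj A \<in> carrier_mat m n"
  by (simp add: adj_def)

lemma adj_index [simp]: "i < dim_col A \<Longrightarrow> j < dim_row A \<Longrightarrow> adj A $$ (i,j) = cnj (A $$ (j,i))"
  by (simp add: adj_def)

lemma adj_dim [simp]: "dim_row (adj A) = dim_col A" "dim_col (adj A) = dim_row A"
  by (simp_all add: adj_def)

lemma index_mult_sum:
  "A \<in> carrier_mat n k \<Longrightarrow> B \<in> carrier_mat k m \<Longrightarrow> i < n \<Longrightarrow> j < m \<Longrightarrow>
    (A * B) $$ (i,j) = (\<Sum>l<k. A $$ (i,l) * B $$ (l,j))"
  by (simp add: scalar_prod_def lessThan_atLeast0)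

lemma index_mult_vec_sum:
  "A \<in> carrier_mat n k \<Longrightarrow> v \<in> carrier_vec k \<Longrightarrow> i < n \<Longrightarrow> (A *\<^sub>v v) $ i = (\<Sum>l<k. A $$ (i,l) * v $ l)"
  by (auto simp: scalar_prod_def lessThan_atLeast0)

lemma unitary_iff_onb:
  assumes "U \<in> carrier_mat N N"
  shows "unitary U \<longleftrightarrow> onb N (\<lambda>i k. U $$ (i,k))"
proof -
  have "adj U * U = 1\<^sub>m N \<longleftrightarrow> eqm N (mm N (ct (\<lambda>i k. U $$ (i,k))) (\<lambda>i k. U $$ (i,k))) idm"
    using assms by (auto simp: mat_eq_iff eqm_def mm_def ct_def idm_def scalar_prod_def lessThan_atLeast0)
  moreover have "U * adj U = 1\<^sub>m N \<longleftrightarrow> eqm N (mm N (\<lambda>i k. U $$ (i,k)) (ct (\<lambda>i k. U $$ (i,k)))) idm"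
    using assms by (auto simp: mat_eq_iff eqm_def mm_def ct_def idm_def scalar_prod_def lessThan_atLeast0)
  ultimately show ?thesis using assms by (simp add: unitary_def onb_def)
qed

lemma conj_diag_index:
  assumes U: "U \<in> carrier_mat N N" and D: "D \<in> carrier_mat N N" "diagonal_mat D"
    and r: "\<And>k. k < N \<Longrightarrow> D $$ (k,k) = complex_of_real (g k)" and ij: "i < N" "j < N"
  shows "(U * D * adj U) $$ (i,j) = fc N (\<lambda>i k. U $$ (i,k)) g i j"
proof -
  have "(U * D) $$ (i,k) = U $$ (i,k) * complex_of_real (g k)" if k: "k < N" for k
  proof -
    have "(U * D) $$ (i,k) = (\<Sum>l<N. U $$ (i,l) * D $$ (l,k))"
      by (rule index_mult_sum[OF U D(1) ij(1) k])
    also have "\<dots> = (\<Sum>l<N. if l = k then U $$ (i,k) * complex_of_real (g k) else 0)"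
      using D k r by (intro sum.cong) (auto simp: diagonal_mat_def)
    finally show ?thesis using k by simp
  qed
  then show ?thesis
    using U D ij by (subst index_mult_sum[of _ N N _ N]) (auto simp: fc_def)
qed

text \<open>\<open>mat_fun\<close> picks some value by Hilbert choice. The given diagonalisation
  shows that a candidate exists, and \<open>fc_unique\<close> shows that every candidate has the
  same entries, so whichever was picked is the expected matrix.\<close>

lemma mat_fun_fc:
  assumes A: "A \<in> carrier_mat N N" and u: "onb N u" and Au: "eqm N (\<lambda>i j. A $$ (i,j)) (fc N u l)"
  shows "mat_fun (\<lambda>x. complex_of_real (g x)) A = mat N N (\<lambda>(i,j). fc N u (\<lambda>k. g (l k)) i j)"
proof -
  let ?P = "\<lambda>B. \<exists>U D. U \<in> carrier_mat (dim_row A) (dim_row A) \<and> unitary U \<and>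
      D \<in> carrier_mat (dim_row A) (dim_row A) \<and> diagonal_mat D \<and>
      (\<forall>i < dim_row A. D $$ (i,i) \<in> \<real>) \<and>
      A = U * D * adj U \<and>
      B = U * mat (dim_row A) (dim_row A) (\<lambda>(i,j). if i = j then complex_of_real (g (Re (D $$ (i,i)))) else 0) * adj U"
  have dim: "dim_row A = N" using A by simp
  define U0 where "U0 = mat N N (\<lambda>(i,k). u i k)"
  define D0 where "D0 = mat N N (\<lambda>(i,k). if i = k then complex_of_real (l k) else 0)"
  have U0: "U0 \<in> carrier_mat N N" by (simp add: U0_def)
  have D0: "D0 \<in> carrier_mat N N" "diagonal_mat D0" by (auto simp: D0_def diagonal_mat_def)
  have fcU0: "fc N (\<lambda>i k. U0 $$ (i,k)) h i j = fc N u h i j" if "i < N" "j < N" for h i j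
    using that by (simp add: fc_def U0_def)
  have "onb N (\<lambda>i k. U0 $$ (i,k))"
    using u by (simp add: onb_def eqm_def mm_def ct_def U0_def)
  then have uU0: "unitary U0" using unitary_iff_onb[OF U0] by simp
  have AU: "A = U0 * D0 * adj U0"
  proof (rule eq_matI)
    fix i j assume "i < dim_row (U0 * D0 * adj U0)" "j < dim_col (U0 * D0 * adj U0)"
    then have ij: "i < N" "j < N" using U0 D0 by auto
    have "(U0 * D0 * adj U0) $$ (i,j) = fc N (\<lambda>i k. U0 $$ (i,k)) l i j"
      by (rule conj_diag_index[OF U0 D0 _ ij]) (simp add: D0_def)
    also have "\<dots> = A $$ (i,j)" using Au ij by (simp add: fcU0 eqm_def)
    finally show "A $$ (i,j) = (U0 * D0 * adj U0) $$ (i,j)" ..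
  qed (use A U0 D0 in auto)
  have "?P (U0 * mat (dim_row A) (dim_row A) (\<lambda>(i,j). if i = j then complex_of_real (g (Re (D0 $$ (i,i)))) else 0) * adj U0)"
    using U0 D0 uU0 AU unfolding dim
    by (intro exI[of _ U0] exI[of _ D0]) (auto simp: D0_def)
  then have "?P (mat_fun (\<lambda>x. complex_of_real (g x)) A)"
    unfolding mat_fun_def by (rule someI[of ?P])
  then obtain U D where UD: "U \<in> carrier_mat N N" "unitary U" "D \<in> carrier_mat N N" "diagonal_mat D"
      "\<forall>i<N. D $$ (i,i) \<in> \<real>" "A = U * D * adj U"
    and B: "mat_fun (\<lambda>x. complex_of_real (g x)) A = U * mat N N (\<lambda>(i,j). if i = j then complex_of_real (g (Re (D $$ (i,i)))) else 0) * adj U"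
    unfolding dim by blast
  define m where "m k = Re (D $$ (k,k))" for k
  have Dk: "D $$ (k,k) = complex_of_real (m k)" if "k < N" for k
    using UD(5) that by (simp add: m_def)
  let ?v = "\<lambda>i k. U $$ (i,k)"
  have v: "onb N ?v" using UD unitary_iff_onb by blast
  have "eqm N (fc N ?v m) (fc N u l)"
    unfolding eqm_def
  proof (intro allI impI)
    fix i j assume ij: "i < N" "j < N"
    have "fc N ?v m i j = A $$ (i,j)"
      unfolding UD(6) by (rule conj_diag_index[OF UD(1,3,4) Dk ij, symmetric])
    then show "fc N ?v m i j = fc N u l i j" using Au ij by (simp add: eqm_def)
  qed
  from fc_unique[OF v u this, of g] have eq: "eqm N (fc N ?v (\<lambda>k. g (m k))) (fc N u (\<lambda>k. g (l k)))" .
  have Bc: "mat_fun (\<lambda>x. complex_of_real (g x)) A \<in> carrier_mat N N"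
    unfolding B by (rule mult_carrier_mat[OF mult_carrier_mat[OF UD(1) mat_carrier] adj_carrier[OF UD(1)]])
  show ?thesis
  proof (rule eq_matI)
    fix i j assume "i < dim_row (mat N N (\<lambda>(i,j). fc N u (\<lambda>k. g (l k)) i j))"
      "j < dim_col (mat N N (\<lambda>(i,j). fc N u (\<lambda>k. g (l k)) i j))"
    then have ij: "i < N" "j < N" by auto
    have "mat_fun (\<lambda>x. complex_of_real (g x)) A $$ (i,j) = fc N ?v (\<lambda>k. g (m k)) i j"
      unfolding B by (rule conj_diag_index[OF UD(1) mat_carrier _ _ ij]) (auto simp: diagonal_mat_def m_def)
    then show "mat_fun (\<lambda>x. complex_of_real (g x)) A $$ (i,j) = mat N N (\<lambda>(i,j). fc N u (\<lambda>k. g (l k)) i j) $$ (i,j)"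
      using eq ij by (simp add: eqm_def)
  qed (use Bc in auto)
qed

lemma psd_spectral:
  assumes A: "A \<in> carrier_mat N N" and "psd A"
  shows "\<exists>u l. onb N u \<and> eqm N (\<lambda>i j. A $$ (i,j)) (fc N u l) \<and> (\<forall>k<N. l k \<ge> 0)"
proof -
  have herm: "adj A = A" and pos: "\<And>v. v \<in> carrier_vec N \<Longrightarrow> 0 \<le> Re (\<Sum>i<N. cnj (v $ i) * (A *\<^sub>v v) $ i)"
    using assms by (auto simp: psd_def hermitian_def)
  have "A $$ (j,i) = cnj (A $$ (i,j))" if "i < N" "j < N" for i j
    using arg_cong[OF herm, of "\<lambda>B. B $$ (j,i)"] that A by simp
  from spectral_theorem[of N "\<lambda>i j. A $$ (i,j)", OF this] obtain u l where
    u: "onb N u" and Au: "eqm N (\<lambda>i j. A $$ (i,j)) (fc N u l)" by blast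
  \<comment> \<open>Testing positivity on the \<open>k\<close>-th eigenvector isolates the
    eigenvalue \<open>l k\<close>.\<close>
  have "l k \<ge> 0" if k: "k < N" for k
  proof -
    have "(\<Sum>i<N. cnj (vec N (\<lambda>i. u i k) $ i) * (A *\<^sub>v vec N (\<lambda>i. u i k)) $ i) =
       (\<Sum>i<N. \<Sum>j<N. cnj (u i k) * fc N u l i j * u j k)"
    proof (rule sum.cong[OF refl])
      fix i assume "i \<in> {..<N}"
      then have i: "i < N" by simp
      show "cnj (vec N (\<lambda>i. u i k) $ i) * (A *\<^sub>v vec N (\<lambda>i. u i k)) $ i = (\<Sum>j<N. cnj (u i k) * fc N u l i j * u j k)"
        using i Au unfolding eqm_def
        by (subst index_mult_vec_sum[OF A _ i]) (auto simp: sum_distrib_left mult.assoc intro!: sum.cong)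
    qed
    also have "\<dots> = complex_of_real (\<Sum>k'<N. l k' * (cmod (\<Sum>i<N. cnj (u i k') * u i k))\<^sup>2)"
      by (rule fc_quadratic_form)
    also have "(\<Sum>k'<N. l k' * (cmod (\<Sum>i<N. cnj (u i k') * u i k))\<^sup>2) = (\<Sum>k'<N. if k' = k then l k else 0)"
      using onb_col[OF u _ k] by (intro sum.cong) auto
    finally show ?thesis using pos[of "vec N (\<lambda>i. u i k)"] k by simp
  qed
  then show ?thesis using u Au by blast
qed

lemma density_spectral:
  assumes "density N A"
  shows "\<exists>u l. onb N u \<and> eqm N (\<lambda>i j. A $$ (i,j)) (fc N u l) \<and> (\<forall>k<N. l k \<ge> 0) \<and> (\<Sum>k<N. l k) = 1"
proof -
  have A: "A \<in> carrier_mat N N" "psd A" "mtrace A = 1" using assms by (auto simp: density_def)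
  obtain u l where u: "onb N u" "eqm N (\<lambda>i j. A $$ (i,j)) (fc N u l)" "\<forall>k<N. l k \<ge> 0"
    using psd_spectral[OF A(1,2)] by blast
  have "(\<Sum>i<N. A $$ (i,i)) = (\<Sum>i<N. fc N u l i i)" using u(2) by (intro sum.cong) (auto simp: eqm_def)
  then have "complex_of_real (\<Sum>k<N. l k) = 1" using A fc_trace[OF u(1), of l] by (simp add: mtrace_def)
  then have "(\<Sum>k<N. l k) = 1" by (simp only: of_real_eq_1_iff)
  then show ?thesis using u by blast
qed

lemma psd_fcI:
  assumes A: "A \<in> carrier_mat N N" and Au: "eqm N (\<lambda>i j. A $$ (i,j)) (fc N u l)" and l: "\<And>k. k < N \<Longrightarrow> l k \<ge> 0"
  shows "psd A"
proof -
  have "adj A = A"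
  proof (rule eq_matI)
    fix i j assume "i < dim_row A" "j < dim_col A"
    then have ij: "i < N" "j < N" using A by auto
    have "cnj (fc N u l j i) = fc N u l i j" using ct_fc[of N u l] by (metis ct_def)
    then show "adj A $$ (i,j) = A $$ (i,j)" using ij A Au by (simp add: eqm_def)
  qed (use A in auto)
  moreover have "0 \<le> Re (\<Sum>i<N. cnj (v $ i) * (A *\<^sub>v v) $ i)" if v: "v \<in> carrier_vec N" for v
  proof -
    have "(\<Sum>i<N. cnj (v $ i) * (A *\<^sub>v v) $ i) = (\<Sum>i<N. \<Sum>j<N. cnj (v $ i) * fc N u l i j * v $ j)"
    proof (rule sum.cong[OF refl])
      fix i assume "i \<in> {..<N}"
      then have i: "i < N" by simp
      show "cnj (v $ i) * (A *\<^sub>v v) $ i = (\<Sum>j<N. cnj (v $ i) * fc N u l i j * v $ j)"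
        using i Au v unfolding eqm_def
        by (subst index_mult_vec_sum[OF A _ i]) (auto simp: sum_distrib_left mult.assoc intro!: sum.cong)
    qed
    then show ?thesis unfolding fc_quadratic_form using l by (auto intro!: sum_nonneg)
  qed
  ultimately show ?thesis using A by (simp add: psd_def hermitian_def)
qed

subsection \<open>Relative entropy of coherence\<close>

text \<open>Extending by 0 matches the convention in \<open>logm\<close> and makes
  \<open>p * lg p\<close> vanish at \<open>p = 0\<close>.\<close>

definition lg :: "real \<Rightarrow> real" where
  "lg x = (if x > 0 then log 2 x else 0)"

definition ent :: "nat \<Rightarrow> (nat \<Rightarrow> real) \<Rightarrow> real" where
  "ent N p = - (\<Sum>k<N. p k * lg (p k))"

lemma logm_fc:
  assumes "A \<in> carrier_mat N N" "onb N u" "eqm N (\<lambda>i j. A $$ (i,j)) (fc N u l)"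
  shows "logm A = mat N N (\<lambda>(i,j). fc N u (\<lambda>k. lg (l k)) i j)"
proof -
  have "(\<lambda>x. if x > 0 then complex_of_real (log 2 x) else 0) = (\<lambda>x. complex_of_real (lg x))"
    by (auto simp: lg_def)
  then show ?thesis unfolding logm_def by (simp only: mat_fun_fc[OF assms])
qed

lemma diagonal_density_fc:
  assumes "density N \<sigma>" "diagonal_mat \<sigma>"
  shows "eqm N (\<lambda>i j. \<sigma> $$ (i,j)) (fc N idm (\<lambda>i. Re (\<sigma> $$ (i,i))))"
    and "\<And>i. i < N \<Longrightarrow> Re (\<sigma> $$ (i,i)) \<ge> 0" and "(\<Sum>i<N. Re (\<sigma> $$ (i,i))) = 1"
    and "\<And>i. i < N \<Longrightarrow> \<sigma> $$ (i,i) = complex_of_real (Re (\<sigma> $$ (i,i)))"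
proof -
  have c: "\<sigma> \<in> carrier_mat N N" "mtrace \<sigma> = 1" using assms by (auto simp: density_def)
  obtain u l where u: "onb N u" "eqm N (\<lambda>i j. \<sigma> $$ (i,j)) (fc N u l)" "\<forall>k<N. l k \<ge> 0"
    using density_spectral[OF assms(1)] by blast
  have d: "\<sigma> $$ (i,i) = complex_of_real (\<Sum>k<N. l k * (cmod (u i k))\<^sup>2)" if "i < N" for i
    using u(2) that by (simp only: eqm_def fc_diag)
  show real: "\<sigma> $$ (i,i) = complex_of_real (Re (\<sigma> $$ (i,i)))" if "i < N" for i
    using d[OF that] by (metis Re_complex_of_real)
  show "Re (\<sigma> $$ (i,i)) \<ge> 0" if "i < N" for i
    using d[OF that] u(3) by (auto intro!: sum_nonneg simp del: of_real_sum)
  show "(\<Sum>i<N. Re (\<sigma> $$ (i,i))) = 1"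
    using c(1) arg_cong[OF c(2), of Re] by (simp add: mtrace_def)
  show "eqm N (\<lambda>i j. \<sigma> $$ (i,j)) (fc N idm (\<lambda>i. Re (\<sigma> $$ (i,i))))"
    using fc_idm_basis[of N "\<lambda>i. Re (\<sigma> $$ (i,i))"] assms(2) c real
    by (auto simp: eqm_def dg_def diagonal_mat_def)
qed

lemma fc_mm_dg_trace:
  "(\<Sum>i<N. mm N A (dg g) i i) = (\<Sum>i<N. A i i * complex_of_real (g i))"
  by (intro sum.cong) (simp_all add: mm_dg_right)

text \<open>The first term is the trace of \<open>\<rho> log \<rho>\<close>, computed in the
  eigenbasis. In the second, \<open>logm \<sigma>\<close> is diagonal, so only the diagonal of
  \<open>\<rho>\<close> survives under the trace.\<close>

lemma rel_entropy_trace: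
  assumes \<rho>: "\<rho> \<in> carrier_mat N N" and u: "onb N u" and \<rho>u: "eqm N (\<lambda>i j. \<rho> $$ (i,j)) (fc N u l)"
    and \<sigma>: "density N \<sigma>" "diagonal_mat \<sigma>"
  shows "Re (mtrace (\<rho> * (logm \<rho> - logm \<sigma>))) = 
    - ent N l - (\<Sum>i<N. Re (\<rho> $$ (i,i)) * lg (Re (\<sigma> $$ (i,i))))"
proof -
  have \<sigma>c: "\<sigma> \<in> carrier_mat N N" using \<sigma> by (simp add: density_def)
  let ?f = "fc N u (\<lambda>k. lg (l k))" and ?s = "\<lambda>i. lg (Re (\<sigma> $$ (i,i)))"
  have l\<rho>: "logm \<rho> = mat N N (\<lambda>(i,j). ?f i j)" by (rule logm_fc[OF \<rho> u \<rho>u])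
  have l\<sigma>: "logm \<sigma> = mat N N (\<lambda>(i,j). fc N idm ?s i j)"
    by (rule logm_fc[OF \<sigma>c onb_idm diagonal_density_fc(1)[OF \<sigma>]])
  let ?r = "\<lambda>i j. \<rho> $$ (i,j)"
  have "(\<rho> * (logm \<rho> - logm \<sigma>)) $$ (i,i) = mm N (fc N u l) ?f i i - mm N ?r (dg ?s) i i" if i: "i < N" for i
  proof -
    have "(\<rho> * (logm \<rho> - logm \<sigma>)) $$ (i,i) = (\<Sum>k<N. \<rho> $$ (i,k) * (?f k i - dg ?s k i))"
      using i fc_idm_basis[of N ?s] unfolding l\<rho> l\<sigma>
      by (subst index_mult_sum[OF \<rho> _ i i]) (auto simp: eqm_def intro!: sum.cong)
    also have "\<dots> = (\<Sum>k<N. fc N u l i k * ?f k i) - (\<Sum>k<N. ?r i k * dg ?s k i)"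
      using \<rho>u i by (simp add: eqm_def algebra_simps sum_subtractf)
    finally show ?thesis by (simp add: mm_def)
  qed
  then have "mtrace (\<rho> * (logm \<rho> - logm \<sigma>)) = (\<Sum>i<N. mm N (fc N u l) ?f i i) - (\<Sum>i<N. mm N ?r (dg ?s) i i)"
    using \<rho> by (simp add: mtrace_def sum_subtractf)
  also have "(\<Sum>i<N. mm N (fc N u l) ?f i i) = (\<Sum>i<N. fc N u (\<lambda>k. l k * lg (l k)) i i)"
    using fc_mult[OF u, of l "\<lambda>k. lg (l k)"] by (intro sum.cong) (auto simp: eqm_def)
  also have "\<dots> = complex_of_real (- ent N l)"
    by (simp add: fc_trace[OF u] ent_def)
  also have "(\<Sum>i<N. mm N ?r (dg ?s) i i) = (\<Sum>i<N. \<rho> $$ (i,i) * complex_of_real (?s i))"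
    by (rule fc_mm_dg_trace)
  finally show ?thesis by simp
qed

text \<open>Termwise from \<open>ln x \<le> x - 1\<close> at \<open>x = s i / p i\<close>; the
  linear bounds sum to 0 because both families have total 1. \<open>supp\<close> excludes a zero
  \<open>s i\<close> under a positive \<open>p i\<close>, where the convention in \<open>lg\<close>
  would break the estimate.\<close>

lemma gibbs_inequality:
  assumes p: "\<And>i. i < N \<Longrightarrow> p i \<ge> 0" "(\<Sum>i<N. p i) = 1"
    and s: "\<And>i. i < N \<Longrightarrow> s i \<ge> 0" "(\<Sum>i<N. s i) = 1"
    and supp: "\<And>i. i < N \<Longrightarrow> s i = 0 \<Longrightarrow> p i = 0"
  shows "(\<Sum>i<N. p i * lg (s i)) \<le> (\<Sum>i<N. p i * lg (p i))"
proof -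
  have "p i * lg (s i) - p i * lg (p i) \<le> (s i - p i) / ln 2" if i: "i < N" for i
  proof (cases "p i = 0")
    case True
    then show ?thesis using s(1)[OF i] by simp
  next
    case False
    then have pos: "p i > 0" "s i > 0" using p(1)[OF i] s(1)[OF i] supp[OF i] by force+
    have "ln (s i / p i) \<le> s i / p i - 1" using pos by (intro ln_le_minus_one) simp
    then have "p i * (ln (s i) - ln (p i)) \<le> p i * (s i / p i - 1)"
      using pos by (intro mult_left_mono) (simp_all add: ln_div)
    also have "\<dots> = s i - p i" using pos by (simp add: field_simps)
    finally have "p i * (ln (s i) - ln (p i)) / ln 2 \<le> (s i - p i) / ln 2"
      by (intro divide_right_mono) simp_all
    then show ?thesis using pos by (simp add: lg_def log_def field_simps)
  qed
  then have "(\<Sum>i<N. p i * lg (s i) - p i * lg (p i)) \<le> (\<Sum>i<N. (s i - p i) / ln 2)"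
    by (intro sum_mono) auto
  also have "\<dots> = 0" using p s by (simp add: sum_divide_distrib[symmetric] sum_subtractf)
  finally show ?thesis by (simp add: sum_subtractf)
qed

lemma density_diag:
  assumes "onb N u" "eqm N (\<lambda>i j. \<rho> $$ (i,j)) (fc N u l)" "i < N"
  shows "\<rho> $$ (i,i) = complex_of_real (Re (\<rho> $$ (i,i)))"
    and "Re (\<rho> $$ (i,i)) = (\<Sum>k<N. l k * (cmod (u i k))\<^sup>2)"
proof -
  have "\<rho> $$ (i,i) = complex_of_real (\<Sum>k<N. l k * (cmod (u i k))\<^sup>2)"
    using assms(2,3) by (simp only: eqm_def fc_diag)
  then show "\<rho> $$ (i,i) = complex_of_real (Re (\<rho> $$ (i,i)))"
    and "Re (\<rho> $$ (i,i)) = (\<Sum>k<N. l k * (cmod (u i k))\<^sup>2)"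
    by (metis Re_complex_of_real)+
qed

lemma dephased_incoherent:
  assumes "density N \<rho>"
  shows "incoherent_state N (mat N N (\<lambda>(i,j). if i = j then \<rho> $$ (i,i) else 0))"
proof -
  have c: "\<rho> \<in> carrier_mat N N" "mtrace \<rho> = 1" using assms by (auto simp: density_def)
  obtain u l where u: "onb N u" "eqm N (\<lambda>i j. \<rho> $$ (i,j)) (fc N u l)" "\<forall>k<N. l k \<ge> 0"
    using density_spectral[OF assms] by blast
  let ?\<sigma> = "mat N N (\<lambda>(i,j). if i = j then \<rho> $$ (i,i) else 0)"
  have "psd ?\<sigma>"
  proof (rule psd_fcI[of _ N idm "\<lambda>i. Re (\<rho> $$ (i,i))"])
    show "eqm N (\<lambda>i j. ?\<sigma> $$ (i,j)) (fc N idm (\<lambda>i. Re (\<rho> $$ (i,i))))"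
      using fc_idm_basis[of N "\<lambda>i. Re (\<rho> $$ (i,i))"] density_diag(1)[OF u(1,2)]
      by (auto simp: eqm_def dg_def)
    show "Re (\<rho> $$ (k,k)) \<ge> 0" if "k < N" for k
      unfolding density_diag(2)[OF u(1,2) that] using u(3) by (auto intro!: sum_nonneg)
  qed simp
  moreover have "mtrace ?\<sigma> = 1" using c by (simp add: mtrace_def)
  ultimately show ?thesis by (auto simp: incoherent_state_def density_def diagonal_mat_def)
qed

text \<open>Puts the dephased state within the finite branch of \<open>rel_entropy\<close>. A
  vanishing diagonal entry of a positive matrix forces its whole column to vanish.\<close>

lemma kernel_dephased:
  assumes "density N \<rho>" and v: "v \<in> carrier_vec N"
    and 0: "mat N N (\<lambda>(i,j). if i = j then \<rho> $$ (i,i) else 0) *\<^sub>v v = 0\<^sub>v N"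
  shows "\<rho> *\<^sub>v v = 0\<^sub>v N"
proof -
  have c: "\<rho> \<in> carrier_mat N N" "mtrace \<rho> = 1" using assms by (auto simp: density_def)
  obtain u l where u: "onb N u" "eqm N (\<lambda>i j. \<rho> $$ (i,j)) (fc N u l)" "\<forall>k<N. l k \<ge> 0"
    using density_spectral[OF assms(1)] by blast
  let ?\<sigma> = "mat N N (\<lambda>(i,j). if i = j then \<rho> $$ (i,i) else 0)"
  have z: "\<rho> $$ (j,i) * v $ i = 0" if i: "i < N" and j: "j < N" for i j
  proof (cases "\<rho> $$ (i,i) = 0")
    case True
    \<comment> \<open>The diagonal entry is a sum of nonnegative terms, so each eigenvector with
      nonzero eigenvalue vanishes at \<open>i\<close>.\<close>
    then have "(\<Sum>k<N. l k * (cmod (u i k))\<^sup>2) = 0" using density_diag(2)[OF u(1,2) i] by simp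
    then have "l k * (cmod (u i k))\<^sup>2 = 0" if "k < N" for k
      using u(3) that by (subst (asm) sum_nonneg_eq_0_iff) auto
    then have "l k = 0 \<or> u i k = 0" if "k < N" for k using that by fastforce
    then have "fc N u l j i = 0" unfolding fc_def by (intro sum.neutral) auto
    then show ?thesis using u(2) i j by (simp add: eqm_def)
  next
    case False
    have "(?\<sigma> *\<^sub>v v) $ i = (\<Sum>k<N. ?\<sigma> $$ (i,k) * v $ k)"
      by (rule index_mult_vec_sum[OF _ v i]) simp
    also have "\<dots> = \<rho> $$ (i,i) * v $ i"
      using i by (simp add: if_distrib[of "\<lambda>x. x * _"] cong: if_cong)
    finally show ?thesis using False 0 i by simp
  qed
  show ?thesis
  proof (rule eq_vecI)
    fix j assume "j < dim_vec (0\<^sub>v N :: complex vec)"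
    then have j: "j < N" by simp
    show "(\<rho> *\<^sub>v v) $ j = 0\<^sub>v N $ j"
      using z[OF _ j] j by (subst index_mult_vec_sum[OF c(1) v j]) (simp add: sum.neutral del: mult_eq_0_iff)
  qed (use c in auto)
qed

text \<open>In the finite case \<open>rel_entropy_trace\<close> shows that a diagonal state enters
  only through its pairing with the diagonal of \<open>\<rho>\<close>, and Gibbs' inequality
  identifies the dephased state as the best choice. The first claim supplies the state at which the
  infimum is attained.\<close>

lemma rel_entropy_coherence_eq:
  assumes \<rho>: "density N \<rho>" and u: "onb N u" and \<rho>u: "eqm N (\<lambda>i j. \<rho> $$ (i,j)) (fc N u l)"
  shows "\<exists>\<sigma>. incoherent_state N \<sigma> \<and> rel_entropy \<rho> \<sigma> = ereal (ent N (\<lambda>i. Re (\<rho> $$ (i,i))) - ent N l)"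
    and "rel_entropy_coherence N \<rho> = ereal (ent N (\<lambda>i. Re (\<rho> $$ (i,i))) - ent N l)"
proof -
  have c: "\<rho> \<in> carrier_mat N N" "mtrace \<rho> = 1" using \<rho> by (auto simp: density_def)
  let ?C = "ent N (\<lambda>i. Re (\<rho> $$ (i,i))) - ent N l"
  let ?\<sigma> = "mat N N (\<lambda>(i,j). if i = j then \<rho> $$ (i,i) else 0)"
  have \<sigma>: "incoherent_state N ?\<sigma>" by (rule dephased_incoherent[OF \<rho>])
  then have \<sigma>d: "density N ?\<sigma>" "diagonal_mat ?\<sigma>" by (auto simp: incoherent_state_def)
  have eq: "rel_entropy \<rho> ?\<sigma> = ereal ?C"
    using kernel_dephased[OF \<rho>] c unfolding rel_entropy_def
    by (simp add: rel_entropy_trace[OF c(1) u \<rho>u \<sigma>d] ent_def)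
  have le: "ereal ?C \<le> rel_entropy \<rho> \<tau>" if \<tau>: "incoherent_state N \<tau>" for \<tau>
  proof (cases "\<forall>v \<in> carrier_vec (dim_col \<tau>). \<tau> *\<^sub>v v = 0\<^sub>v (dim_row \<tau>) \<longrightarrow> \<rho> *\<^sub>v v = 0\<^sub>v (dim_row \<rho>)")
    case True
    have \<tau>d: "density N \<tau>" "diagonal_mat \<tau>" "\<tau> \<in> carrier_mat N N" 
      using \<tau> by (auto simp: incoherent_state_def density_def)
    note t = diagonal_density_fc[OF \<tau>d(1,2)]
    \<comment> \<open>The assumptions fix no sign for \<open>l\<close>, so nonnegativity of the
      diagonal is read off a decomposition with nonnegative eigenvalues.\<close>
    obtain u' l' where u': "onb N u'" "eqm N (\<lambda>i j. \<rho> $$ (i,j)) (fc N u' l')" "\<forall>k<N. l' k \<ge> 0"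
      using density_spectral[OF \<rho>] by blast
    have "(\<Sum>i<N. Re (\<rho> $$ (i,i)) * lg (Re (\<tau> $$ (i,i)))) \<le> (\<Sum>i<N. Re (\<rho> $$ (i,i)) * lg (Re (\<rho> $$ (i,i))))"
    proof (rule gibbs_inequality[OF _ _ t(2) t(3)])
      show "Re (\<rho> $$ (i,i)) \<ge> 0" if "i < N" for i
        unfolding density_diag(2)[OF u'(1,2) that] using u'(3) by (auto intro!: sum_nonneg)
      show "(\<Sum>i<N. Re (\<rho> $$ (i,i))) = 1" using c(1) arg_cong[OF c(2), of Re] by (simp add: mtrace_def)
      \<comment> \<open>The kernel condition applied to the \<open>i\<close>-th basis vector gives
        the support hypothesis of \<open>gibbs_inequality\<close>.\<close>
      show "Re (\<rho> $$ (i,i)) = 0" if i: "i < N" and z: "Re (\<tau> $$ (i,i)) = 0" for i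
      proof -
        have "\<tau> $$ (j,i) = 0" if "j < N" for j
          using \<tau>d(2,3) t(4)[OF i] z i that by (cases "j = i") (auto simp: diagonal_mat_def)
        then have "\<tau> *\<^sub>v unit_vec N i = 0\<^sub>v N" using \<tau>d(3) i by (intro eq_vecI) auto
        then have "\<rho> *\<^sub>v unit_vec N i = 0\<^sub>v N" using True \<tau>d(3) c by auto
        then have "(\<rho> *\<^sub>v unit_vec N i) $ i = 0" using i by simp
        then show ?thesis using i c by simp
      qed
    qed
    then have "?C \<le> Re (mtrace (\<rho> * (logm \<rho> - logm \<tau>)))"
      unfolding rel_entropy_trace[OF c(1) u \<rho>u \<tau>d(1,2)] by (simp add: ent_def)
    then show ?thesis using True by (simp add: rel_entropy_def)
  next
    case False
    then show ?thesis unfolding rel_entropy_def by (simp only: if_False) simp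
  qed
  show "\<exists>\<sigma>. incoherent_state N \<sigma> \<and> rel_entropy \<rho> \<sigma> = ereal ?C" using \<sigma> eq by blast
  show "rel_entropy_coherence N \<rho> = ereal ?C"
    unfolding rel_entropy_coherence_def
  proof (rule antisym)
    show "(INF \<sigma>\<in>{\<sigma>. incoherent_state N \<sigma>}. rel_entropy \<rho> \<sigma>) \<le> ereal ?C"
      by (rule INF_lower2[of ?\<sigma>]) (simp_all add: \<sigma> eq)
    show "ereal ?C \<le> (INF \<sigma>\<in>{\<sigma>. incoherent_state N \<sigma>}. rel_entropy \<rho> \<sigma>)"
      by (rule INF_greatest) (simp add: le)
  qed
qed

subsection \<open>Fidelity with the maximally coherent state\<close>

lemma fc_coeff:
  assumes u: "onb N u" and k: "k < N"
  shows "(\<Sum>i<N. \<Sum>j<N. cnj (u i k) * fc N u g i j * u j k) = complex_of_real (g k)"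
proof -
  have "(\<Sum>k'<N. g k' * (cmod (\<Sum>i<N. cnj (u i k') * u i k))\<^sup>2) = (\<Sum>k'<N. if k' = k then g k else 0)"
    using onb_col[OF u _ k] by (intro sum.cong) auto
  then show ?thesis using k by (simp add: fc_quadratic_form)
qed

lemma fc_inj:
  assumes u: "onb N u" and "eqm N (fc N u f) (fc N u g)" and k: "k < N"
  shows "f k = g k"
proof -
  have "complex_of_real (f k) = (\<Sum>i<N. \<Sum>j<N. cnj (u i k) * fc N u f i j * u j k)"
    by (rule fc_coeff[OF u k, symmetric])
  also have "\<dots> = (\<Sum>i<N. \<Sum>j<N. cnj (u i k) * fc N u g i j * u j k)"
    using assms(2) by (intro sum.cong) (simp_all add: eqm_def)
  also have "\<dots> = complex_of_real (g k)" by (rule fc_coeff[OF u k])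
  finally show ?thesis by (simp only: of_real_eq_iff)
qed

text \<open>A matrix \<open>w w\<^sup>*\<close> satisfies \<open>W\<^sup>2 = c W\<close> with \<open>c\<close> the squared norm of \<open>w\<close>, so its
  eigenvalues are \<open>0\<close> and \<open>c\<close> and its square root is \<open>W / sqrt c\<close>.\<close>
lemma trace_sqrtm_rank_one:
  assumes W: "W \<in> carrier_mat N N" and Ww: "\<And>i j. i < N \<Longrightarrow> j < N \<Longrightarrow> W $$ (i,j) = w i * cnj (w j)"
  shows "mtrace (sqrtm W) = complex_of_real (sqrt (\<Sum>i<N. (cmod (w i))\<^sup>2))"
proof -
  define c where "c = (\<Sum>i<N. (cmod (w i))\<^sup>2)"
  have c0: "c \<ge> 0" unfolding c_def by (intro sum_nonneg) simp
  have cc: "(\<Sum>k<N. cnj (w k) * w k) = complex_of_real c"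
    unfolding c_def of_real_sum complex_norm_square by (simp add: mult.commute)
  obtain v m where v: "onb N v" and Wv: "eqm N (\<lambda>i j. W $$ (i,j)) (fc N v m)"
    using spectral_theorem[of N "\<lambda>i j. W $$ (i,j)"] Ww by (auto simp: mult.commute)
  have "eqm N (fc N v (\<lambda>k. m k * m k)) (fc N v (\<lambda>k. c * m k))"
    unfolding eqm_def
  proof (intro allI impI)
    fix i j assume ij: "i < N" "j < N"
    have "fc N v (\<lambda>k. m k * m k) i j = mm N (fc N v m) (fc N v m) i j"
      using fc_mult[OF v, of m m] ij by (simp add: eqm_def)
    also have "\<dots> = (\<Sum>k<N. (w i * cnj (w k)) * (w k * cnj (w j)))"
      unfolding mm_def using Wv Ww ij by (intro sum.cong) (auto simp: eqm_def)
    also have "\<dots> = (\<Sum>k<N. cnj (w k) * w k) * (w i * cnj (w j))"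
      unfolding sum_distrib_right by (intro sum.cong) simp_all
    also have "\<dots> = complex_of_real c * fc N v m i j"
      using Wv Ww ij by (simp add: cc eqm_def)
    finally show "fc N v (\<lambda>k. m k * m k) i j = fc N v (\<lambda>k. c * m k) i j" by (simp add: fc_scale)
  qed
  then have "m k * m k = c * m k" if "k < N" for k using fc_inj[OF v] that by blast
  then have m: "m k = 0 \<or> m k = c" if "k < N" for k using that by fastforce
  have tr: "(\<Sum>k<N. m k) = c"
  proof -
    have "complex_of_real (\<Sum>k<N. m k) = (\<Sum>i<N. fc N v m i i)" by (rule fc_trace[OF v, symmetric])
    also have "\<dots> = (\<Sum>i<N. cnj (w i) * w i)" using Wv Ww by (intro sum.cong) (auto simp: eqm_def mult.commute)
    finally show ?thesis unfolding cc by (simp only: of_real_eq_iff)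
  qed
  \<comment> \<open>Each \<open>m k\<close> is 0 or \<open>c\<close>, and so has root
    \<open>m k / sqrt c\<close>; for \<open>c = 0\<close> both sides are 0, as division by zero
    yields 0.\<close>
  have "(\<Sum>k<N. sqrt (m k)) = (\<Sum>k<N. m k / sqrt c)"
    using c0 by (intro sum.cong refl) (metis lessThan_iff m real_div_sqrt div_0 real_sqrt_zero)
  also have "\<dots> = sqrt c" using tr c0 by (simp add: sum_divide_distrib[symmetric] real_div_sqrt)
  finally have s: "(\<Sum>k<N. sqrt (m k)) = sqrt c" .
  have "sqrtm W = mat N N (\<lambda>(i,j). fc N v (\<lambda>k. sqrt (m k)) i j)"
    unfolding sqrtm_def by (rule mat_fun_fc[OF W v Wv])
  then have "mtrace (sqrtm W) = (\<Sum>i<N. fc N v (\<lambda>k. sqrt (m k)) i i)" by (simp add: mtrace_def)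
  also have "\<dots> = complex_of_real (sqrt c)" unfolding fc_trace[OF v] s ..
  finally show ?thesis by (simp add: c_def)
qed

text \<open>The target is the projection on the uniform unit vector, so the matrix under the outer
  root has rank at most one, given by the vector \<open>w\<close> that the root of
  \<open>\<tau>\<close> makes of the uniform vector. \<open>trace_sqrtm_rank_one\<close> reduces the
  fidelity to the norm of \<open>w\<close>, whose square is the expectation of \<open>\<tau>\<close>
  in the uniform vector.\<close>

lemma fidelity_max_coherent:
  assumes \<tau>: "\<tau> \<in> carrier_mat M M" "psd \<tau>" and M: "M > 0"
  shows "fidelity \<tau> (mat M M (\<lambda>_. 1 / of_nat M)) = sqrt (Re (\<Sum>i<M. \<Sum>j<M. \<tau> $$ (i,j)) / M)"
proof -
  obtain u l where u: "onb M u" and \<tau>u: "eqm M (\<lambda>i j. \<tau> $$ (i,j)) (fc M u l)" and l: "\<forall>k<M. l k \<ge> 0"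
    using psd_spectral[OF \<tau>] by blast
  let ?S = "fc M u (\<lambda>k. sqrt (l k))"
  have S: "sqrtm \<tau> = mat M M (\<lambda>(i,j). ?S i j)"
    unfolding sqrtm_def by (rule mat_fun_fc[OF \<tau>(1) u \<tau>u])
  define w where "w i = (\<Sum>k<M. ?S i k) / complex_of_real (sqrt M)" for i
  let ?F = "mat M M (\<lambda>_. 1 / of_nat M) :: complex mat"
  have cS: "cnj (?S i j) = ?S j i" for i j using ct_fc[of M u "\<lambda>k. sqrt (l k)"] by (metis ct_def)
  have sM: "complex_of_real (sqrt M) * complex_of_real (sqrt M) = of_nat M"
    by (simp flip: of_real_mult)
  have W: "(sqrtm \<tau> * ?F * sqrtm \<tau>) $$ (i,j) = w i * cnj (w j)" if ij: "i < M" "j < M" for i j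
  proof -
    have "(sqrtm \<tau> * ?F) $$ (i,k) = (\<Sum>l<M. ?S i l) / of_nat M" if "k < M" for k
      using ij that unfolding S by (subst index_mult_sum[of _ M M _ M]) (auto simp: sum_divide_distrib)
    then have "(sqrtm \<tau> * ?F * sqrtm \<tau>) $$ (i,j) = (\<Sum>k<M. (\<Sum>l<M. ?S i l) / of_nat M * ?S k j)"
      using ij unfolding S by (subst index_mult_sum[of _ M M _ M]) auto
    also have "\<dots> = (\<Sum>l<M. ?S i l) / of_nat M * (\<Sum>k<M. ?S k j)" unfolding sum_distrib_left ..
    also have "\<dots> = (\<Sum>l<M. ?S i l) * cnj (\<Sum>k<M. ?S j k) / of_nat M" by (simp add: cS)
    also have "\<dots> = w i * cnj (w j)" unfolding w_def sM[symmetric] by simp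
    finally show ?thesis .
  qed
  have "(\<Sum>i<M. (cmod (w i))\<^sup>2) = Re (\<Sum>i<M. \<Sum>j<M. \<tau> $$ (i,j)) / M"
  proof -
    have "complex_of_real (\<Sum>i<M. (cmod (w i))\<^sup>2) = (\<Sum>i<M. w i * cnj (w i))"
      unfolding of_real_sum complex_norm_square ..
    also have "\<dots> = (\<Sum>i<M. \<Sum>k<M. \<Sum>l<M. ?S l i * ?S i k) / of_nat M"
      unfolding w_def sM[symmetric] by (simp add: cS sum_distrib_left sum_distrib_right sum_divide_distrib mult_ac)
    also have "(\<Sum>i<M. \<Sum>k<M. \<Sum>l<M. ?S l i * ?S i k) = (\<Sum>k<M. \<Sum>i<M. \<Sum>l<M. ?S l i * ?S i k)"
      by (rule sum.swap)
    also have "\<dots> = (\<Sum>k<M. \<Sum>l<M. \<Sum>i<M. ?S l i * ?S i k)"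
      by (rule sum.cong[OF refl], rule sum.swap)
    also have "\<dots> = (\<Sum>l<M. \<Sum>k<M. \<Sum>i<M. ?S l i * ?S i k)" by (rule sum.swap)
    also have "\<dots> = (\<Sum>l<M. \<Sum>k<M. \<tau> $$ (l,k))"
    proof (intro sum.cong refl)
      fix i j assume ij: "i \<in> {..<M}" "j \<in> {..<M}"
      have "(\<Sum>k<M. ?S i k * ?S k j) = fc M u (\<lambda>k. sqrt (l k) * sqrt (l k)) i j"
        using fc_mult[OF u, of "\<lambda>k. sqrt (l k)" "\<lambda>k. sqrt (l k)"] ij by (simp add: eqm_def mm_def)
      also have "\<dots> = fc M u l i j" unfolding fc_def using l by (intro sum.cong) auto
      finally show "(\<Sum>k<M. ?S i k * ?S k j) = \<tau> $$ (i,j)" using \<tau>u ij by (simp add: eqm_def)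
    qed
    finally have "complex_of_real (\<Sum>i<M. (cmod (w i))\<^sup>2) = (\<Sum>l<M. \<Sum>k<M. \<tau> $$ (l,k)) / of_nat M" .
    from arg_cong[OF this, of Re] show ?thesis by (simp add: Re_divide_of_nat)
  qed
  moreover have "mtrace (sqrtm (sqrtm \<tau> * ?F * sqrtm \<tau>)) = complex_of_real (sqrt (\<Sum>i<M. (cmod (w i))\<^sup>2))"
    using W by (intro trace_sqrtm_rank_one) (auto simp: S)
  ultimately show ?thesis by (simp add: fidelity_def)
qed

lemma tpow_Phi2: "tpow m Phi2 = mat (2 ^ m) (2 ^ m) (\<lambda>_. 1 / of_nat (2 ^ m))"
proof (induction m)
  case 0
  show ?case by (rule eq_matI) auto
next
  case (Suc m)
  have "i div 2 < 2 ^ m" if "i < 2 ^ m * 2" for i :: nat using that by (simp add: less_mult_imp_div_less)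
  then show ?case unfolding tpow.simps Suc
    by (intro eq_matI) (auto simp: kron_def Phi2_def mult.commute)
qed

section \<open>Maps in Kraus form\<close>

lemma kraus_sum_index:
  assumes "\<forall>K \<in> set Ks. K \<in> carrier_mat M N" "P \<in> carrier_mat N N"
  shows "foldr (\<lambda>K acc. K * P * adj K + acc) Ks (0\<^sub>m M M) \<in> carrier_mat M M"
    and "i < M \<Longrightarrow> j < M \<Longrightarrow> foldr (\<lambda>K acc. K * P * adj K + acc) Ks (0\<^sub>m M M) $$ (i,j) =
      (\<Sum>a<length Ks. \<Sum>k<N. \<Sum>l<N. Ks ! a $$ (i,k) * P $$ (k,l) * cnj (Ks ! a $$ (j,l)))"
  using assms
proof (induction Ks)
  case Nil
  case 1 show ?case by simp
  case 2 then show ?case by simp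
next
  case (Cons K Ks)
  let ?R = "foldr (\<lambda>K acc. K * P * adj K + acc) Ks (0\<^sub>m M M)"
  {
    case 1
    then have "?R \<in> carrier_mat M M" using Cons.IH(1) by simp
    then show ?case using 1 by simp
  next
    case 2
    then have R: "?R \<in> carrier_mat M M" using Cons.IH(1) by simp
    have K: "K \<in> carrier_mat M N" using 2 by simp
    have "(K * P * adj K) $$ (i,j) = (\<Sum>l<N. (K * P) $$ (i,l) * cnj (K $$ (j,l)))"
      using 2 K by (subst index_mult_sum[of _ M N _ M]) auto
    also have "\<dots> = (\<Sum>l<N. (\<Sum>k<N. K $$ (i,k) * P $$ (k,l)) * cnj (K $$ (j,l)))"
      using 2 K by (intro sum.cong refl, subst index_mult_sum[of _ M N _ N]) auto
    also have "\<dots> = (\<Sum>k<N. \<Sum>l<N. K $$ (i,k) * P $$ (k,l) * cnj (K $$ (j,l)))"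
      unfolding sum_distrib_right by (rule sum.swap)
    finally have "(K * P * adj K) $$ (i,j) = (\<Sum>k<N. \<Sum>l<N. K $$ (i,k) * P $$ (k,l) * cnj (K $$ (j,l)))" .
    then show ?case using 2 R K Cons.IH(2) by (simp add: sum.lessThan_Suc_shift del: sum.lessThan_Suc)
  }
qed

text \<open>The form at \<open>x\<close> is the sum over \<open>a\<close> of the form of
  \<open>P\<close> at \<open>y a\<close>, the adjoint of the \<open>a\<close>-th Kraus operator
  applied to \<open>x\<close>. The amplitudes are conjugated in the conclusion so that for
  \<open>x\<close> constantly 1 they involve plain column sums.\<close>

lemma kraus_quadratic_form:
  assumes Ks: "\<forall>K \<in> set Ks. K \<in> carrier_mat M N" and P: "P \<in> carrier_mat N N"
    and Pu: "eqm N (\<lambda>i j. P $$ (i,j)) (fc N u l)"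
  shows "(\<Sum>i<M. \<Sum>j<M. cnj (x i) * foldr (\<lambda>K acc. K * P * adj K + acc) Ks (0\<^sub>m M M) $$ (i,j) * x j) =
    complex_of_real (\<Sum>a<length Ks. \<Sum>b<N. l b * (cmod (\<Sum>k<N. (\<Sum>j<M. Ks ! a $$ (j,k) * cnj (x j)) * u k b))\<^sup>2)"
proof -
  define y where "y a k = (\<Sum>j<M. cnj (Ks ! a $$ (j,k)) * x j)" for a k
  have cm: "cmod (\<Sum>k<N. cnj (u k b) * y a k) = cmod (\<Sum>k<N. (\<Sum>j<M. Ks ! a $$ (j,k) * cnj (x j)) * u k b)" for a b
    by (subst complex_mod_cnj[symmetric]) (simp add: y_def mult.commute)
  let ?t = "\<lambda>a i j k l. cnj (x i) * (Ks ! a $$ (i,k) * P $$ (k,l) * cnj (Ks ! a $$ (j,l))) * x j"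
  have "(\<Sum>i<M. \<Sum>j<M. cnj (x i) * foldr (\<lambda>K acc. K * P * adj K + acc) Ks (0\<^sub>m M M) $$ (i,j) * x j) =
     (\<Sum>i<M. \<Sum>j<M. \<Sum>a<length Ks. \<Sum>k<N. \<Sum>l<N. ?t a i j k l)"
    by (intro sum.cong refl) (simp add: kraus_sum_index(2)[OF Ks P] sum_distrib_left sum_distrib_right)
  also have "\<dots> = (\<Sum>i<M. \<Sum>a<length Ks. \<Sum>j<M. \<Sum>k<N. \<Sum>l<N. ?t a i j k l)"
    by (rule sum.cong[OF refl], rule sum.swap)
  also have "\<dots> = (\<Sum>a<length Ks. \<Sum>i<M. \<Sum>j<M. \<Sum>k<N. \<Sum>l<N. ?t a i j k l)" by (rule sum.swap)
  also have "\<dots> = (\<Sum>a<length Ks. \<Sum>k<N. \<Sum>k'<N. cnj (y a k) * fc N u l k k' * y a k')"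
  proof (rule sum.cong[OF refl])
    fix a
    have "(\<Sum>i<M. \<Sum>j<M. \<Sum>k<N. \<Sum>l<N. ?t a i j k l) = (\<Sum>i<M. \<Sum>k<N. \<Sum>j<M. \<Sum>l<N. ?t a i j k l)"
      by (rule sum.cong[OF refl], rule sum.swap)
    also have "\<dots> = (\<Sum>k<N. \<Sum>i<M. \<Sum>j<M. \<Sum>l<N. ?t a i j k l)" by (rule sum.swap)
    also have "\<dots> = (\<Sum>k<N. \<Sum>i<M. \<Sum>l<N. \<Sum>j<M. ?t a i j k l)"
      by (rule sum.cong[OF refl], rule sum.cong[OF refl], rule sum.swap)
    also have "\<dots> = (\<Sum>k<N. \<Sum>l<N. \<Sum>i<M. \<Sum>j<M. ?t a i j k l)"
      by (rule sum.cong[OF refl], rule sum.swap)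
    also have "\<dots> = (\<Sum>k<N. \<Sum>k'<N. cnj (y a k) * fc N u l k k' * y a k')"
      using Pu by (intro sum.cong refl)
        (simp add: y_def eqm_def sum_distrib_left sum_distrib_right mult_ac)
    finally show "(\<Sum>i<M. \<Sum>j<M. \<Sum>k<N. \<Sum>l<N. ?t a i j k l) = 
      (\<Sum>k<N. \<Sum>k'<N. cnj (y a k) * fc N u l k k' * y a k')" .
  qed
  also have "\<dots> = complex_of_real (\<Sum>a<length Ks. \<Sum>b<N. l b * (cmod (\<Sum>k<N. cnj (u k b) * y a k))\<^sup>2)"
    unfolding fc_quadratic_form of_real_sum ..
  also have "\<dots> = complex_of_real (\<Sum>a<length Ks. \<Sum>b<N. l b * (cmod (\<Sum>k<N. (\<Sum>j<M. Ks ! a $$ (j,k) * cnj (x j)) * u k b))\<^sup>2)"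
    unfolding cm ..
  finally show ?thesis .
qed

lemma kraus_psd:
  assumes Ks: "\<forall>K \<in> set Ks. K \<in> carrier_mat M N" and P: "P \<in> carrier_mat N N"
    and Pu: "eqm N (\<lambda>i j. P $$ (i,j)) (fc N u l)" and l: "\<forall>k<N. l k \<ge> 0"
  shows "psd (foldr (\<lambda>K acc. K * P * adj K + acc) Ks (0\<^sub>m M M))" (is "psd ?\<tau>")
proof -
  have c: "?\<tau> \<in> carrier_mat M M" by (rule kraus_sum_index(1)[OF Ks P])
  have Ph: "cnj (P $$ (i,j)) = P $$ (j,i)" if "i < N" "j < N" for i j
  proof -
    have "cnj (fc N u l i j) = fc N u l j i" using ct_fc[of N u l] by (metis ct_def)
    then show ?thesis using Pu that by (simp add: eqm_def)
  qed
  have "adj ?\<tau> = ?\<tau>"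
  proof (rule eq_matI)
    fix i j assume "i < dim_row ?\<tau>" "j < dim_col ?\<tau>"
    then have ij: "i < M" "j < M" using c by auto
    have "adj ?\<tau> $$ (i,j) = cnj (?\<tau> $$ (j,i))" using c ij by simp
    also have "\<dots> = (\<Sum>a<length Ks. \<Sum>k<N. \<Sum>l<N. cnj (Ks ! a $$ (j,k)) * P $$ (l,k) * Ks ! a $$ (i,l))"
      using Ph by (simp add: kraus_sum_index(2)[OF Ks P ij(2,1)])
    also have "\<dots> = (\<Sum>a<length Ks. \<Sum>l<N. \<Sum>k<N. cnj (Ks ! a $$ (j,k)) * P $$ (l,k) * Ks ! a $$ (i,l))"
      by (rule sum.cong[OF refl], rule sum.swap)
    also have "\<dots> = ?\<tau> $$ (i,j)"
      by (simp add: kraus_sum_index(2)[OF Ks P ij] mult_ac)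
    finally show "adj ?\<tau> $$ (i,j) = ?\<tau> $$ (i,j)" .
  qed (use c in auto)
  moreover have "0 \<le> Re (\<Sum>i<M. cnj (v $ i) * (?\<tau> *\<^sub>v v) $ i)" if v: "v \<in> carrier_vec M" for v
  proof -
    have "(\<Sum>i<M. cnj (v $ i) * (?\<tau> *\<^sub>v v) $ i) = (\<Sum>i<M. \<Sum>j<M. cnj (v $ i) * ?\<tau> $$ (i,j) * v $ j)"
    proof (intro sum.cong refl)
      fix i assume "i \<in> {..<M}"
      then show "cnj (v $ i) * (?\<tau> *\<^sub>v v) $ i = (\<Sum>j<M. cnj (v $ i) * ?\<tau> $$ (i,j) * v $ j)"
        by (subst index_mult_vec_sum[OF c v]) (simp_all add: sum_distrib_left mult.assoc)
    qed
    then show ?thesis unfolding kraus_quadratic_form[OF Ks P Pu] using l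
      by (auto intro!: sum_nonneg mult_nonneg_nonneg simp del: of_real_sum)
  qed
  ultimately show ?thesis using c by (simp add: psd_def hermitian_def)
qed

text \<open>For the all-ones vector only column sums of the Kraus operators enter. Both the converse
  and the achievability bound start from this formula.\<close>

lemma fidelity_kraus:
  assumes Ks: "\<forall>K \<in> set Ks. K \<in> carrier_mat (2 ^ m) N" and P: "P \<in> carrier_mat N N"
    and Pu: "eqm N (\<lambda>i j. P $$ (i,j)) (fc N u l)" and l: "\<forall>k<N. l k \<ge> 0"
  shows "fidelity (foldr (\<lambda>K acc. K * P * adj K + acc) Ks (0\<^sub>m (2 ^ m) (2 ^ m))) (tpow m Phi2) =
    sqrt ((\<Sum>a<length Ks. \<Sum>b<N. l b * (cmod (\<Sum>k<N. (\<Sum>j<2 ^ m. Ks ! a $$ (j,k)) * u k b))\<^sup>2) / 2 ^ m)"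
proof -
  let ?\<tau> = "foldr (\<lambda>K acc. K * P * adj K + acc) Ks (0\<^sub>m (2 ^ m) (2 ^ m))"
  have "fidelity ?\<tau> (tpow m Phi2) = sqrt (Re (\<Sum>i<2 ^ m. \<Sum>j<2 ^ m. ?\<tau> $$ (i,j)) / real (2 ^ m))"
    unfolding tpow_Phi2
    by (rule fidelity_max_coherent[OF kraus_sum_index(1)[OF Ks P] kraus_psd[OF assms]]) simp
  also have "(\<Sum>i<2 ^ m. \<Sum>j<2 ^ m. ?\<tau> $$ (i,j)) = complex_of_real (\<Sum>a<length Ks. \<Sum>b<N. l b * (cmod (\<Sum>k<N. (\<Sum>j<2 ^ m. Ks ! a $$ (j,k)) * u k b))\<^sup>2)"
    using kraus_quadratic_form[OF Ks P Pu, of "\<lambda>_. 1"] by (simp only: complex_cnj_one mult_1 mult_1_right)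
  finally show ?thesis by (simp only: Re_complex_of_real of_nat_power of_nat_numeral)
qed

subsection \<open>Converse\<close>

lemma kraus_tp_index:
  assumes "\<forall>K \<in> set Ks. K \<in> carrier_mat M N"
  shows "foldr (\<lambda>K acc. adj K * K + acc) Ks (0\<^sub>m N N) \<in> carrier_mat N N"
    and "i < N \<Longrightarrow> j < N \<Longrightarrow> foldr (\<lambda>K acc. adj K * K + acc) Ks (0\<^sub>m N N) $$ (i,j) =
      (\<Sum>a<length Ks. \<Sum>k<M. cnj (Ks ! a $$ (k,i)) * Ks ! a $$ (k,j))"
  using assms
proof (induction Ks)
  case Nil
  case 1 show ?case by simp
  case 2 then show ?case by simp
next
  case (Cons K Ks)
  let ?R = "foldr (\<lambda>K acc. adj K * K + acc) Ks (0\<^sub>m N N)"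
  {
    case 1
    then have "?R \<in> carrier_mat N N" using Cons.IH(1) by simp
    then show ?case using 1 by simp
  next
    case 2
    then have R: "?R \<in> carrier_mat N N" using Cons.IH(1) by simp
    have K: "K \<in> carrier_mat M N" using 2 by simp
    have "(adj K * K) $$ (i,j) = (\<Sum>k<M. cnj (K $$ (k,i)) * K $$ (k,j))"
      using 2 K by (subst index_mult_sum[of _ N M _ N]) auto
    then show ?case using 2 R K Cons.IH(2) by (simp add: sum.lessThan_Suc_shift del: sum.lessThan_Suc)
  }
qed

lemma norm_sum_square_le:
  fixes z :: "nat \<Rightarrow> complex"
  shows "(cmod (\<Sum>j<M. z j))\<^sup>2 \<le> M * (\<Sum>j<M. (cmod (z j))\<^sup>2)"
proof -
  have "(cmod (\<Sum>j<M. z j))\<^sup>2 \<le> (\<Sum>j<M. cmod (z j))\<^sup>2"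
    by (intro power_mono norm_sum) simp
  also have "\<dots> \<le> (\<Sum>j<M. (cmod (z j))\<^sup>2) * card {..<M}"
    by (rule sum_squared_le_sum_of_squares)
  finally show ?thesis by (simp add: mult.commute)
qed

lemma sum_single_support:
  fixes f :: "'a \<Rightarrow> complex"
  assumes "finite J" and "\<And>j j'. j \<in> J \<Longrightarrow> j' \<in> J \<Longrightarrow> f j \<noteq> 0 \<Longrightarrow> f j' \<noteq> 0 \<Longrightarrow> j = j'"
  shows "(cmod (\<Sum>j\<in>J. f j))\<^sup>2 = (\<Sum>j\<in>J. (cmod (f j))\<^sup>2)"
proof (cases "\<exists>j0\<in>J. f j0 \<noteq> 0")
  case True
  then obtain j0 where j0: "j0 \<in> J" "f j0 \<noteq> 0" by blast
  have z: "f j = 0" if "j \<in> J - {j0}" for j using assms(2)[OF _ j0(1) _ j0(2)] that by blast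
  then have "(\<Sum>j\<in>J. f j) = f j0" using assms(1) j0(1) by (subst sum.remove[of _ j0]) auto
  moreover have "(\<Sum>j\<in>J. (cmod (f j))\<^sup>2) = (cmod (f j0))\<^sup>2"
    using assms(1) j0(1) z by (subst sum.remove[of _ j0]) auto
  ultimately show ?thesis by simp
qed auto

text \<open>Every eigenvector with small eigenvalue is split into its parts inside and outside \<open>S\<close>. The
  inside parts are controlled because an incoherent operation takes each basis state to an
  incoherent state, whose overlap with the maximally coherent state is exactly \<open>2 ^ -m\<close>.\<close>
lemma converse_one_shot:
  assumes op: "incoherent_op N (2 ^ m) T" and P: "P \<in> carrier_mat N N"
    and u: "onb N u" and Pu: "eqm N (\<lambda>i j. P $$ (i,j)) (fc N u l)" and l: "\<forall>k<N. l k \<ge> 0"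
    and L: "L \<ge> 0" and S: "S \<subseteq> {..<N}"
  shows "(fidelity (T P) (tpow m Phi2))\<^sup>2 \<le> 
    (\<Sum>b\<in>{b. b < N \<and> l b > L}. l b) + 2 * L * card S / 2 ^ m + 2 * (\<Sum>i\<in>{..<N} - S. Re (P $$ (i,i)))"
proof -
  let ?M = "2 ^ m :: nat"
  obtain Ks where K: "\<forall>K \<in> set Ks. K \<in> carrier_mat ?M N \<and>
         (\<forall>i<N. \<forall>j<?M. \<forall>j'<?M. K $$ (j,i) \<noteq> 0 \<and> K $$ (j',i) \<noteq> 0 \<longrightarrow> j = j')"
    and tp: "foldr (\<lambda>K acc. adj K * K + acc) Ks (0\<^sub>m N N) = 1\<^sub>m N"
    and T: "\<forall>\<rho> \<in> carrier_mat N N. T \<rho> = foldr (\<lambda>K acc. K * \<rho> * adj K + acc) Ks (0\<^sub>m ?M ?M)"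
    using op unfolding incoherent_op_def by (elim exE conjE)
  have Ks: "\<forall>K \<in> set Ks. K \<in> carrier_mat ?M N"
    and inc: "\<And>K i j j'. K \<in> set Ks \<Longrightarrow> i < N \<Longrightarrow> j < ?M \<Longrightarrow> j' < ?M \<Longrightarrow> K $$ (j,i) \<noteq> 0 \<Longrightarrow> K $$ (j',i) \<noteq> 0 \<Longrightarrow> j = j'"
    using K by blast+
  let ?n = "length Ks"
  \<comment> \<open>Column sums: the pulled-back effect has entries
    \<open>\<Sum>a<?n. cnj (c a i) * c a i'\<close>, divided by \<open>2 ^ m\<close>.\<close>
  define c where "c a i = (\<Sum>j<?M. Ks ! a $$ (j,i))" for a i
  have tp': "(\<Sum>a<?n. \<Sum>k<?M. cnj (Ks ! a $$ (k,i)) * Ks ! a $$ (k,j)) = (if i = j then 1 else 0)"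
    if "i < N" "j < N" for i j
    using kraus_tp_index(2)[OF Ks that] that unfolding tp by simp
  \<comment> \<open>A column has at most one nonzero entry, so squaring its sum loses nothing; with
    trace preservation every diagonal entry of the effect is exactly
    \<open>1 / 2 ^ m\<close>.\<close>
  have c1: "(\<Sum>a<?n. (cmod (c a i))\<^sup>2) = 1" if i: "i < N" for i
  proof -
    have "(\<Sum>a<?n. (cmod (c a i))\<^sup>2) = (\<Sum>a<?n. \<Sum>j<?M. (cmod (Ks ! a $$ (j,i)))\<^sup>2)"
    proof (rule sum.cong[OF refl])
      fix a assume "a \<in> {..<?n}"
      then have "Ks ! a \<in> set Ks" by simp
      from inc[OF this i] show "(cmod (c a i))\<^sup>2 = (\<Sum>j<?M. (cmod (Ks ! a $$ (j,i)))\<^sup>2)"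
        unfolding c_def by (intro sum_single_support) (simp, blast)
    qed
    moreover have "complex_of_real (\<Sum>a<?n. \<Sum>j<?M. (cmod (Ks ! a $$ (j,i)))\<^sup>2) = 1"
      unfolding of_real_sum complex_norm_square using tp'[OF i i] by (simp add: mult.commute)
    ultimately show ?thesis by (simp only: of_real_eq_1_iff)
  qed
  \<comment> \<open>The effect is at most the identity, by Cauchy-Schwarz over the output index and
    trace preservation.\<close>
  have c2: "(\<Sum>a<?n. (cmod (\<Sum>i<N. c a i * y i))\<^sup>2) / ?M \<le> (\<Sum>i<N. (cmod (y i))\<^sup>2)" for y
  proof -
    define z where "z a j = (\<Sum>i<N. Ks ! a $$ (j,i) * y i)" for a j
    have "(\<Sum>i<N. c a i * y i) = (\<Sum>j<?M. z a j)" for a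
      unfolding c_def z_def sum_distrib_right by (rule sum.swap)
    then have "(\<Sum>a<?n. (cmod (\<Sum>i<N. c a i * y i))\<^sup>2) \<le> (\<Sum>a<?n. ?M * (\<Sum>j<?M. (cmod (z a j))\<^sup>2))"
      by (intro sum_mono) (simp only: norm_sum_square_le)
    also have "\<dots> = ?M * (\<Sum>a<?n. \<Sum>j<?M. (cmod (z a j))\<^sup>2)" by (simp add: sum_distrib_left)
    also have "(\<Sum>a<?n. \<Sum>j<?M. (cmod (z a j))\<^sup>2) = (\<Sum>i<N. (cmod (y i))\<^sup>2)"
    proof -
      let ?s = "\<lambda>a j i i'. (cnj (Ks ! a $$ (j,i)) * Ks ! a $$ (j,i')) * (cnj (y i) * y i')"
      have "complex_of_real (\<Sum>a<?n. \<Sum>j<?M. (cmod (z a j))\<^sup>2) = (\<Sum>a<?n. \<Sum>j<?M. \<Sum>i<N. \<Sum>i'<N. ?s a j i i')"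
        unfolding of_real_sum complex_norm_square
        by (simp add: z_def sum_distrib_left sum_distrib_right mult_ac)
      also have "\<dots> = (\<Sum>a<?n. \<Sum>j<?M. \<Sum>i'<N. \<Sum>i<N. ?s a j i i')"
        by (rule sum.cong[OF refl], rule sum.cong[OF refl], rule sum.swap)
      also have "\<dots> = (\<Sum>a<?n. \<Sum>i'<N. \<Sum>j<?M. \<Sum>i<N. ?s a j i i')"
        by (rule sum.cong[OF refl], rule sum.swap)
      also have "\<dots> = (\<Sum>i'<N. \<Sum>a<?n. \<Sum>j<?M. \<Sum>i<N. ?s a j i i')" by (rule sum.swap)
      also have "\<dots> = (\<Sum>i'<N. \<Sum>a<?n. \<Sum>i<N. \<Sum>j<?M. ?s a j i i')"
        by (rule sum.cong[OF refl], rule sum.cong[OF refl], rule sum.swap)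
      also have "\<dots> = (\<Sum>i'<N. \<Sum>i<N. \<Sum>a<?n. \<Sum>j<?M. ?s a j i i')"
        by (rule sum.cong[OF refl], rule sum.swap)
      also have "\<dots> = (\<Sum>i'<N. \<Sum>i<N. (if i = i' then 1 else 0) * (cnj (y i) * y i'))"
        unfolding sum_distrib_right[symmetric] using tp' by (intro sum.cong refl) simp
      also have "\<dots> = (\<Sum>i'<N. cnj (y i') * y i')"
        by (intro sum.cong refl) (simp add: if_distrib[of "\<lambda>x. x * _"] cong: if_cong)
      also have "\<dots> = complex_of_real (\<Sum>i<N. (cmod (y i))\<^sup>2)"
        unfolding of_real_sum complex_norm_square by (simp only: mult.commute)
      finally show ?thesis by (simp only: of_real_eq_iff)
    qed
    finally show ?thesis by (simp add: field_simps)
  qed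
  define s where "s i = (if i \<in> S then 1 else 0 :: complex)" for i
  \<comment> \<open>\<open>g b\<close> is the expectation of the effect in the \<open>b\<close>-th
    eigenvector, \<open>q b\<close> and \<open>r b\<close> those in its parts on \<open>S\<close>
    and off \<open>S\<close>.\<close>
  define g where "g b = (\<Sum>a<?n. (cmod (\<Sum>k<N. c a k * u k b))\<^sup>2) / ?M" for b
  define q where "q b = (\<Sum>a<?n. (cmod (\<Sum>k<N. c a k * (s k * u k b)))\<^sup>2) / ?M" for b
  define r where "r b = (\<Sum>a<?n. (cmod (\<Sum>k<N. c a k * ((1 - s k) * u k b)))\<^sup>2) / ?M" for b
  define w where "w b = (\<Sum>k\<in>{..<N} - S. (cmod (u k b))\<^sup>2)" for b
  have nonneg: "g b \<ge> 0" "q b \<ge> 0" "r b \<ge> 0" for b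
    unfolding g_def q_def r_def by (intro divide_nonneg_nonneg sum_nonneg; simp)+
  have g1: "g b \<le> 1" if "b < N" for b
    using c2[of "\<lambda>k. u k b"] onb_col_norm[OF u that] by (simp add: g_def)
  have rw: "r b \<le> w b" for b
  proof -
    have "r b \<le> (\<Sum>k<N. (cmod ((1 - s k) * u k b))\<^sup>2)" unfolding r_def by (rule c2)
    also have "\<dots> = w b" unfolding w_def by (rule sum.mono_neutral_cong_right) (auto simp: s_def)
    finally show ?thesis .
  qed
  have gqr: "g b \<le> 2 * q b + 2 * r b" for b
  proof -
    have "(cmod (\<Sum>k<N. c a k * u k b))\<^sup>2 \<le> 2 * (cmod (\<Sum>k<N. c a k * (s k * u k b)))\<^sup>2 
        + 2 * (cmod (\<Sum>k<N. c a k * ((1 - s k) * u k b)))\<^sup>2" for a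
    proof -
      let ?x = "\<Sum>k<N. c a k * (s k * u k b)" and ?y = "\<Sum>k<N. c a k * ((1 - s k) * u k b)"
      have "(\<Sum>k<N. c a k * u k b) = ?x + ?y" 
        unfolding sum.distrib[symmetric] by (intro sum.cong refl) (simp add: algebra_simps)
      then have "(cmod (\<Sum>k<N. c a k * u k b))\<^sup>2 \<le> (cmod ?x + cmod ?y)\<^sup>2"
        by (simp only:) (intro power_mono norm_triangle_ineq norm_ge_zero)
      also have "\<dots> \<le> 2 * (cmod ?x)\<^sup>2 + 2 * (cmod ?y)\<^sup>2"
        using zero_le_power2[of "cmod ?x - cmod ?y"] unfolding power2_sum power2_diff by linarith
      finally show ?thesis .
    qed
    then have "(\<Sum>a<?n. (cmod (\<Sum>k<N. c a k * u k b))\<^sup>2) \<le> (\<Sum>a<?n. 2 * (cmod (\<Sum>k<N. c a k * (s k * u k b)))\<^sup>2 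
        + 2 * (cmod (\<Sum>k<N. c a k * ((1 - s k) * u k b)))\<^sup>2)" by (intro sum_mono)
    then show ?thesis
      unfolding g_def q_def r_def
      by (simp add: sum.distrib sum_distrib_left[symmetric] field_simps)
  qed
  \<comment> \<open>Summed over the whole eigenbasis, \<open>q\<close> becomes the trace of the
    effect compressed to \<open>S\<close>, by Parseval.\<close>
  have sq: "(\<Sum>b<N. q b) = card S / ?M"
  proof -
    have "(\<Sum>b<N. \<Sum>a<?n. (cmod (\<Sum>k<N. (c a k * s k) * u k b))\<^sup>2) = (\<Sum>a<?n. \<Sum>k<N. (cmod (c a k * s k))\<^sup>2)"
      by (subst sum.swap) (simp only: parseval'[OF u])
    also have "\<dots> = (\<Sum>k<N. \<Sum>a<?n. (cmod (c a k * s k))\<^sup>2)" by (rule sum.swap)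
    also have "\<dots> = (\<Sum>k<N. if k \<in> S then 1 else 0)"
      using c1 by (intro sum.cong refl) (auto simp: s_def)
    also have "\<dots> = card S" using S by (simp add: sum.If_cases Int_absorb1)
    finally show ?thesis by (simp add: q_def mult.assoc sum_divide_distrib[symmetric])
  qed
  have sw: "(\<Sum>b<N. l b * w b) = (\<Sum>i\<in>{..<N} - S. Re (P $$ (i,i)))"
    unfolding w_def sum_distrib_left
    by (subst sum.swap) (use density_diag(2)[OF u Pu] in simp)
  have "fidelity (T P) (tpow m Phi2) = sqrt ((\<Sum>a<?n. \<Sum>b<N. l b * (cmod (\<Sum>k<N. c a k * u k b))\<^sup>2) / 2 ^ m)"
    using T P fidelity_kraus[OF Ks P Pu l] by (simp add: c_def)
  also have "(\<Sum>a<?n. \<Sum>b<N. l b * (cmod (\<Sum>k<N. c a k * u k b))\<^sup>2) / 2 ^ m = (\<Sum>b<N. l b * g b)"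
    by (subst sum.swap) (simp add: g_def sum_distrib_left sum_divide_distrib)
  finally have "(fidelity (T P) (tpow m Phi2))\<^sup>2 = (\<Sum>b<N. l b * g b)"
    using l nonneg by (auto intro!: sum_nonneg mult_nonneg_nonneg real_sqrt_pow2)
  \<comment> \<open>Eigenvalues above \<open>L\<close> are paid for in full through
    \<open>g b \<le> 1\<close>; for the others the split into \<open>q\<close> and \<open>r\<close>
    is used, with \<open>l b\<close> replaced by \<open>L\<close> only next to
    \<open>q b\<close>.\<close>
  also have "\<dots> \<le> (\<Sum>b<N. (if l b > L then l b else 0) + 2 * L * q b + 2 * (l b * w b))"
  proof (rule sum_mono)
    fix b assume "b \<in> {..<N}"
    then have b: "b < N" by simp
    show "l b * g b \<le> (if l b > L then l b else 0) + 2 * L * q b + 2 * (l b * w b)"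
    proof (cases "l b > L")
      case True
      have "l b * g b \<le> l b" using g1[OF b] l b by (simp add: mult_left_le)
      moreover have "0 \<le> L * q b" "0 \<le> l b * w b" using nonneg L l b by (auto simp: w_def sum_nonneg)
      ultimately show ?thesis using True by simp
    next
      case False
      have "l b * g b \<le> l b * (2 * q b + 2 * r b)" using gqr l b by (intro mult_left_mono) auto
      moreover have "l b * q b \<le> L * q b" using False nonneg by (intro mult_right_mono) auto
      moreover have "l b * r b \<le> l b * w b" using rw l b by (intro mult_left_mono) auto
      ultimately show ?thesis using False by (simp add: algebra_simps)
    qed
  qed
  also have "\<dots> = (\<Sum>b<N. if l b > L then l b else 0) + 2 * L * (card S / ?M) + 2 * (\<Sum>i\<in>{..<N} - S. Re (P $$ (i,i)))"
    unfolding sum.distrib sum_distrib_left[symmetric] sq sw ..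
  also have "(\<Sum>b<N. if l b > L then l b else 0) = (\<Sum>b\<in>{b. b < N \<and> l b > L}. l b)"
    by (rule sum.mono_neutral_cong_right) auto
  finally show ?thesis by simp
qed

subsection \<open>Achievability\<close>

text \<open>Derandomisation by conditional expectations: a uniformly random hash function identifies two
  distinct points with probability \<open>1 / M\<close>.\<close>
lemma exists_hash_below_average:
  fixes h :: "nat \<Rightarrow> nat \<Rightarrow> real" and M N :: nat
  assumes M: "M > 0"
  shows "\<exists>j. (\<forall>i. j i < M) \<and> 
    (\<Sum>i<N. \<Sum>i'<N. if i \<noteq> i' \<and> j i = j i' then h i i' else 0) \<le> (\<Sum>i<N. \<Sum>i'<N. if i \<noteq> i' then h i i' else 0) / M"
proof (induction N)
  case 0
  show ?case using M by (intro exI[of _ "\<lambda>_. 0"]) simp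
next
  case (Suc N)
  \<comment> \<open>Separates the pairs that involve the new point \<open>N\<close>.\<close>
  have split: "(\<Sum>i<Suc N. \<Sum>i'<Suc N. if i \<noteq> i' \<and> c i i' then h i i' else 0) =
      (\<Sum>i<N. \<Sum>i'<N. if i \<noteq> i' \<and> c i i' then h i i' else 0) + 
      (\<Sum>i<N. (if c i N then h i N else 0) + (if c N i then h N i else 0))" for c
  proof -
    have "(\<Sum>i'<N. if N \<noteq> i' \<and> c N i' then h N i' else 0) = (\<Sum>i'<N. if c N i' then h N i' else 0)"
      "(\<Sum>i<N. if i \<noteq> N \<and> c i N then h i N else 0) = (\<Sum>i<N. if c i N then h i N else 0)"
      by (intro sum.cong refl; simp)+
    then show ?thesis by (simp add: sum.distrib)
  qed
  obtain j where j: "\<And>i. j i < M" and IH: 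
    "(\<Sum>i<N. \<Sum>i'<N. if i \<noteq> i' \<and> j i = j i' then h i i' else 0) \<le> (\<Sum>i<N. \<Sum>i'<N. if i \<noteq> i' then h i i' else 0) / M"
    using Suc.IH by blast
  \<comment> \<open>\<open>f m\<close> is the extra cost of putting \<open>N\<close> into bin
    \<open>m\<close>. The costs of all \<open>M\<close> bins add up to the full cross sum, so some
    bin costs at most the average.\<close>
  define f where "f m = (\<Sum>i<N. if j i = m then h i N + h N i else 0)" for m
  have sf: "(\<Sum>m<M. f m) = (\<Sum>i<N. h i N + h N i)"
  proof -
    have "(\<Sum>m<M. f m) = (\<Sum>i<N. \<Sum>m<M. if j i = m then h i N + h N i else 0)"
      unfolding f_def by (rule sum.swap)
    also have "\<dots> = (\<Sum>i<N. h i N + h N i)" 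
      by (rule sum.cong[OF refl], subst sum.delta') (use j in auto)
    finally show ?thesis .
  qed
  have "\<exists>m<M. f m \<le> (\<Sum>i<N. h i N + h N i) / M"
  proof (rule ccontr)
    assume "\<not> ?thesis"
    then have "(\<Sum>m<M. (\<Sum>i<N. h i N + h N i) / M) < (\<Sum>m<M. f m)"
      using M by (intro sum_strict_mono) auto
    then show False using M sf by simp
  qed
  then obtain m where m: "m < M" "f m \<le> (\<Sum>i<N. h i N + h N i) / M" by blast
  let ?j = "j(N := m)"
  have "(\<Sum>i<Suc N. \<Sum>i'<Suc N. if i \<noteq> i' \<and> ?j i = ?j i' then h i i' else 0) =
     (\<Sum>i<N. \<Sum>i'<N. if i \<noteq> i' \<and> ?j i = ?j i' then h i i' else 0) + 
     (\<Sum>i<N. (if ?j i = ?j N then h i N else 0) + (if ?j N = ?j i then h N i else 0))"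
    by (rule split)
  also have "(\<Sum>i<N. \<Sum>i'<N. if i \<noteq> i' \<and> ?j i = ?j i' then h i i' else 0) =
      (\<Sum>i<N. \<Sum>i'<N. if i \<noteq> i' \<and> j i = j i' then h i i' else 0)"
    by (rule sum.cong[OF refl], rule sum.cong[OF refl]) auto
  also have "(\<Sum>i<N. (if ?j i = ?j N then h i N else 0) + (if ?j N = ?j i then h N i else 0)) = f m"
    unfolding f_def by (rule sum.cong[OF refl]) auto
  also have "(\<Sum>i<N. \<Sum>i'<N. if i \<noteq> i' \<and> j i = j i' then h i i' else 0) + f m \<le>
      (\<Sum>i<N. \<Sum>i'<N. if i \<noteq> i' then h i i' else 0) / M + (\<Sum>i<N. h i N + h N i) / M"
    using IH m(2) by linarith
  also have "\<dots> = (\<Sum>i<Suc N. \<Sum>i'<Suc N. if i \<noteq> i' then h i i' else 0) / M"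
    using split[of "\<lambda>_ _. True"] by (simp add: add_divide_distrib)
  finally show ?case using j m(1) by (intro exI[of _ ?j]) simp
qed

text \<open>The Kraus operator built from row \<open>a\<close> sends basis vector \<open>i\<close>
  to \<open>c a i\<close> times basis vector \<open>j i\<close>. Basis vectors in different bins get
  orthogonal outputs, so trace preservation is a condition within bins only, and the column sums are
  again \<open>c a i\<close>.\<close>

lemma incoherent_op_of_rows:
  fixes n :: nat
  assumes j: "\<And>i. j i < (2::nat) ^ m"
    and iso: "\<And>i i'. i < N \<Longrightarrow> i' < N \<Longrightarrow> j i = j i' \<Longrightarrow> (\<Sum>a<n. cnj (c a i) * c a i') = idm i i'"
    and P: "P \<in> carrier_mat N N" and Pu: "eqm N (\<lambda>i j. P $$ (i,j)) (fc N u l)" and l: "\<forall>k<N. l k \<ge> 0"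
  shows "\<exists>T. incoherent_op N (2 ^ m) T \<and> fidelity (T P) (tpow m Phi2) =
    sqrt ((\<Sum>a<n. \<Sum>b<N. l b * (cmod (\<Sum>k<N. c a k * u k b))\<^sup>2) / 2 ^ m)"
proof -
  let ?M = "2 ^ m :: nat"
  define K where "K a = mat ?M N (\<lambda>(k,i). if k = j i then c a i else 0)" for a
  define Ks where "Ks = map K [0..<n]"
  define T where "T \<rho> = foldr (\<lambda>K acc. K * \<rho> * adj K + acc) Ks (0\<^sub>m ?M ?M)" for \<rho>
  have Kc: "\<forall>K \<in> set Ks. K \<in> carrier_mat ?M N" by (auto simp: Ks_def K_def)
  have nth: "Ks ! a = K a" "length Ks = n" if "a < n" for a using that by (simp_all add: Ks_def)
  have len: "length Ks = n" by (simp add: Ks_def)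
  have "foldr (\<lambda>K acc. adj K * K + acc) Ks (0\<^sub>m N N) = 1\<^sub>m N"
  proof (rule eq_matI)
    fix i i' assume "i < dim_row (1\<^sub>m N :: complex mat)" "i' < dim_col (1\<^sub>m N :: complex mat)"
    then have i: "i < N" "i' < N" by auto
    have "foldr (\<lambda>K acc. adj K * K + acc) Ks (0\<^sub>m N N) $$ (i,i') = (\<Sum>a<n. \<Sum>k<?M. cnj (K a $$ (k,i)) * K a $$ (k,i'))"
      unfolding kraus_tp_index(2)[OF Kc i] len by (intro sum.cong refl) (simp add: nth)
    also have "\<dots> = (\<Sum>a<n. \<Sum>k<?M. if k = j i then (if j i = j i' then cnj (c a i) * c a i' else 0) else 0)"
      using i by (intro sum.cong refl) (auto simp: K_def)
    also have "\<dots> = (\<Sum>a<n. if j i = j i' then cnj (c a i) * c a i' else 0)"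
      using j by (intro sum.cong refl) (simp add: sum.delta)
    also have "\<dots> = (1\<^sub>m N :: complex mat) $$ (i,i')"
      using iso[OF i] i by (cases "j i = j i'") (auto simp: idm_def)
    finally show "foldr (\<lambda>K acc. adj K * K + acc) Ks (0\<^sub>m N N) $$ (i,i') = (1\<^sub>m N :: complex mat) $$ (i,i')" .
  qed (use kraus_tp_index(1)[OF Kc] in auto)
  then have "incoherent_op N ?M T"
    unfolding incoherent_op_def T_def by (intro exI[of _ Ks]) (auto simp: Ks_def K_def)
  moreover have "fidelity (T P) (tpow m Phi2) =
    sqrt ((\<Sum>a<n. \<Sum>b<N. l b * (cmod (\<Sum>k<N. c a k * u k b))\<^sup>2) / 2 ^ m)"
  proof -
    have "(\<Sum>k<?M. Ks ! a $$ (k,i)) = c a i" if "a < n" "i < N" for a i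
      using j that by (simp add: nth K_def sum.delta)
    then have "(\<Sum>a<length Ks. \<Sum>b<N. l b * (cmod (\<Sum>k<N. (\<Sum>j<?M. Ks ! a $$ (j,k)) * u k b))\<^sup>2) =
      (\<Sum>a<n. \<Sum>b<N. l b * (cmod (\<Sum>k<N. c a k * u k b))\<^sup>2)"
      unfolding len by simp
    then show ?thesis unfolding T_def fidelity_kraus[OF Kc P Pu l] by simp
  qed
  ultimately show ?thesis by blast
qed

text \<open>The rows of \<open>V = 2 sqrt M \<Pi> Q (1 + T)\<^sup>-\<^sup>1\<close> and \<open>R = (1 - T) (1 + T)\<^sup>-\<^sup>1\<close>, where
  \<open>T = M Q \<Pi> Q\<close> with the entries between different hash values removed, form the Kraus operators.\<close>
locale hashed_projection =
  fixes N :: nat and M :: real and j :: "nat \<Rightarrow> nat" and S A :: "nat set"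
    and u w :: "nat \<Rightarrow> nat \<Rightarrow> complex" and t :: "nat \<Rightarrow> real"
  assumes u: "onb N u" and w: "onb N w" and t: "\<And>k. k < N \<Longrightarrow> t k \<ge> 0" and M: "M > 0"
    and T: "\<And>i i'. i < N \<Longrightarrow> i' < N \<Longrightarrow> fc N w t i i' =
      (if j i = j i' \<and> i \<in> S \<and> i' \<in> S then M * fc N u (indicator A) i i' else 0)"
begin

definition "q i = (indicator S i :: complex)"
definition "G = fc N w (\<lambda>k. 1 / (1 + t k))"
definition "V a i = complex_of_real (2 * sqrt M * indicator A a) * (\<Sum>k<N. cnj (u k a) * q k * G k i)"
definition "R = fc N w (\<lambda>k. (1 - t k) / (1 + t k))"

text \<open>\<open>T\<close> commutes with the projections on the bins and with \<open>Q\<close>,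
  hence so does its resolvent \<open>G\<close>; the pair \<open>(j i, q i)\<close> labels the common
  blocks.\<close>

lemma G_block: "i < N \<Longrightarrow> i' < N \<Longrightarrow> j i \<noteq> j i' \<or> q i \<noteq> q i' \<Longrightarrow> G i i' = 0"
  unfolding G_def
  by (rule fc_block[OF w, where c = "\<lambda>i. (j i, q i)" and l = t and g = "\<lambda>x. 1 / (1 + x)"])
    (auto simp: T q_def indicator_def split: if_splits)

lemma cnj_fc: "cnj (fc N v g i k) = fc N v g k i"
  using ct_fc[of N v g] by (metis ct_def)

text \<open>Within one bin, \<open>V\<close> contributes \<open>4 T (1 + T)\<^sup>-\<^sup>2\<close>
  and \<open>R\<close> contributes \<open>(1 - T)\<^sup>2 (1 + T)\<^sup>-\<^sup>2\<close>, and
  \<open>4 t + (1 - t)\<^sup>2 = (1 + t)\<^sup>2\<close>. This is what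
  \<open>incoherent_op_of_rows\<close> asks of its rows.\<close>

lemma isometry:
  assumes i: "i < N" "i' < N" "j i = j i'"
  shows "(\<Sum>a<N. cnj (V a i) * V a i') + (\<Sum>a<N. cnj (R a i) * R a i') = idm i i'"
proof -
  let ?g = "\<lambda>k. 1 / (1 + t k)" and ?r = "\<lambda>k. (1 - t k) / (1 + t k)"
  have G': "cnj (G k i) = G i k" for i k unfolding G_def by (rule cnj_fc)
  have q': "cnj (q k) = q k" for k by (simp add: q_def indicator_def)
  have sM: "complex_of_real (sqrt M) * complex_of_real (sqrt M) = complex_of_real M"
    using M by (simp flip: of_real_mult)
  let ?s = "\<lambda>a k k'. complex_of_real (4 * M * indicator A a) * (u k a * cnj (u k' a)) * (G i k * q k * (q k' * G k' i'))"
  have "(\<Sum>a<N. cnj (V a i) * V a i') = (\<Sum>a<N. \<Sum>k<N. \<Sum>k'<N. ?s a k k')"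
  proof (rule sum.cong[OF refl])
    fix a assume "a \<in> {..<N}"
    have "cnj (V a i) * V a i' = complex_of_real (2 * sqrt M * indicator A a) * complex_of_real (2 * sqrt M * indicator A a) *
       ((\<Sum>k<N. u k a * q k * G i k) * (\<Sum>k'<N. cnj (u k' a) * q k' * G k' i'))"
      by (simp add: V_def G' q' mult_ac)
    also have "complex_of_real (2 * sqrt M * indicator A a) * complex_of_real (2 * sqrt M * indicator A a) = complex_of_real (4 * M * indicator A a)"
      using M by (simp add: indicator_def flip: of_real_mult)
    also have "complex_of_real (4 * M * indicator A a) * ((\<Sum>k<N. u k a * q k * G i k) * (\<Sum>k'<N. cnj (u k' a) * q k' * G k' i')) = (\<Sum>k<N. \<Sum>k'<N. ?s a k k')"
      by (subst sum_product) (simp add: sum_distrib_left mult_ac)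
    finally show "cnj (V a i) * V a i' = (\<Sum>k<N. \<Sum>k'<N. ?s a k k')" .
  qed
  also have "\<dots> = (\<Sum>k<N. \<Sum>a<N. \<Sum>k'<N. ?s a k k')" by (rule sum.swap)
  also have "\<dots> = (\<Sum>k<N. \<Sum>k'<N. \<Sum>a<N. ?s a k k')" by (rule sum.cong[OF refl], rule sum.swap)
  also have "\<dots> = (\<Sum>k<N. \<Sum>k'<N. 4 * (G i k * fc N w t k k' * G k' i'))"
  proof (rule sum.cong[OF refl], rule sum.cong[OF refl])
    fix k k' assume k: "k \<in> {..<N}" "k' \<in> {..<N}"
    have "(\<Sum>a<N. ?s a k k') = complex_of_real (4 * M) * fc N u (indicator A) k k' * (G i k * q k * (q k' * G k' i'))"
      unfolding fc_def sum_distrib_left sum_distrib_right by (intro sum.cong refl) (simp add: mult_ac)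
    also have "\<dots> = 4 * (G i k * fc N w t k k' * G k' i')"
    proof (cases "G i k = 0 \<or> G k' i' = 0")
      case False
      \<comment> \<open>\<open>G\<close> stays within bins, so \<open>k\<close> and
        \<open>k'\<close> share the bin of \<open>i\<close> and \<open>i'\<close>; there the
        compressed projection \<open>M Q \<Pi> Q\<close> and \<open>T\<close> agree.\<close>
      then have "j k = j k'" using G_block[of i k] G_block[of k' i'] i k by force
      then show ?thesis using T[of k k'] k by (simp add: q_def indicator_def)
    qed auto
    finally show "(\<Sum>a<N. ?s a k k') = 4 * (G i k * fc N w t k k' * G k' i')" .
  qed
  also have "\<dots> = 4 * mm N G (mm N (fc N w t) G) i i'"
    by (simp add: mm_def sum_distrib_left mult.assoc)
  also have "mm N G (mm N (fc N w t) G) i i' = fc N w (\<lambda>k. ?g k * (t k * ?g k)) i i'"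
  proof -
    have "eqm N (mm N G (mm N (fc N w t) G)) (mm N G (fc N w (\<lambda>k. t k * ?g k)))"
      unfolding G_def by (rule eqm_mm[OF eqm_refl fc_mult[OF w]])
    also have "eqm N \<dots> (fc N w (\<lambda>k. ?g k * (t k * ?g k)))" unfolding G_def by (rule fc_mult[OF w])
    finally show ?thesis using i by (simp add: eqm_def)
  qed
  finally have VV: "(\<Sum>a<N. cnj (V a i) * V a i') = fc N w (\<lambda>k. 4 * (?g k * (t k * ?g k))) i i'"
    unfolding fc_scale[symmetric] by simp
  have "(\<Sum>a<N. cnj (R a i) * R a i') = mm N (fc N w ?r) (fc N w ?r) i i'"
    unfolding R_def cnj_fc mm_def ..
  also have "\<dots> = fc N w (\<lambda>k. ?r k * ?r k) i i'" using fc_mult[OF w] i by (simp add: eqm_def)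
  finally have "(\<Sum>a<N. cnj (V a i) * V a i') + (\<Sum>a<N. cnj (R a i) * R a i') = 
     fc N w (\<lambda>k. 4 * (?g k * (t k * ?g k)) + ?r k * ?r k) i i'"
    unfolding VV by (simp add: fc_add)
  also have "\<dots> = fc N w (\<lambda>k. 1) i i'"
  proof -
    have "4 * (?g k * (t k * ?g k)) + ?r k * ?r k = 1" if "k < N" for k
    proof -
      have "1 + t k \<noteq> 0" using t[OF that] by simp
      then have "4 * (?g k * (t k * ?g k)) + ?r k * ?r k = (4 * t k + (1 - t k) * (1 - t k)) / ((1 + t k) * (1 + t k))"
        by (simp add: add_divide_distrib)
      also have "4 * t k + (1 - t k) * (1 - t k) = (1 + t k) * (1 + t k)" by (simp add: algebra_simps)
      finally show ?thesis using \<open>1 + t k \<noteq> 0\<close> by simp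
    qed
    then show ?thesis unfolding fc_def by (intro sum.cong refl) (simp only: lessThan_iff)
  qed
  also have "\<dots> = idm i i'" using fc_one[OF w] i by (simp add: eqm_def)
  finally show ?thesis .
qed

text \<open>The amplitude is \<open>2 sqrt M\<close> times the expectation of \<open>G\<close> in
  \<open>Q u\<^sub>a\<close>: \<open>G\<close> commutes with \<open>Q\<close>, so \<open>Q\<close>
  may be placed on both sides, and the form is then evaluated in the eigenbasis of
  \<open>T\<close>.\<close>

lemma diagonal_amplitude:
  assumes "a \<in> A"
  shows "(\<Sum>k<N. V a k * u k a) = complex_of_real (2 * sqrt M * (\<Sum>k<N. (cmod (\<Sum>i<N. cnj (w i k) * (q i * u i a)))\<^sup>2 / (1 + t k)))"
proof -
  have q': "cnj (q k) = q k" for k by (simp add: q_def indicator_def)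
  have "(\<Sum>k<N. V a k * u k a) = complex_of_real (2 * sqrt M) * (\<Sum>k<N. \<Sum>i<N. cnj (u i a) * q i * G i k * u k a)"
    using assms unfolding V_def by (simp add: sum_distrib_left sum_distrib_right mult.assoc)
  also have "(\<Sum>k<N. \<Sum>i<N. cnj (u i a) * q i * G i k * u k a) = (\<Sum>k<N. \<Sum>i<N. cnj (q i * u i a) * G i k * (q k * u k a))"
  proof (rule sum.cong[OF refl], rule sum.cong[OF refl])
    fix k i assume ki: "k \<in> {..<N}" "i \<in> {..<N}"
    show "cnj (u i a) * q i * G i k * u k a = cnj (q i * u i a) * G i k * (q k * u k a)"
    proof (cases "q i = q k")
      case True
      have "q k = 0 \<or> q k = 1" by (simp add: q_def indicator_def)
      then show ?thesis using True by auto
    next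
      case False
      then show ?thesis using G_block ki by simp
    qed
  qed
  also have "\<dots> = (\<Sum>i<N. \<Sum>k<N. cnj (q i * u i a) * G i k * (q k * u k a))" by (rule sum.swap)
  also have "\<dots> = complex_of_real (\<Sum>k<N. 1 / (1 + t k) * (cmod (\<Sum>i<N. cnj (w i k) * (q i * u i a)))\<^sup>2)"
    unfolding G_def by (rule fc_quadratic_form)
  finally show ?thesis by simp
qed

end

lemma sum_lessThan_add: "(\<Sum>a<n + k. f a) = (\<Sum>a<n. f a) + (\<Sum>a<k. f (n + a))"
  for f :: "nat \<Rightarrow> 'a::comm_monoid_add"
  by (induction k) (simp_all add: add.assoc)

text \<open>To be used with \<open>A\<close> the typical eigenvectors and \<open>S\<close> the
  typical basis vectors. The losses come from the eigenvalues outside \<open>A\<close>, from the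
  diagonal mass off \<open>S\<close>, and from the diagonal entries of \<open>T\<close>, which no
  hashing can dilute.\<close>

lemma achievability_one_shot:
  fixes p :: real and m N :: nat
  assumes P: "P \<in> carrier_mat N N" and u: "onb N u" and Pu: "eqm N (\<lambda>i j. P $$ (i,j)) (fc N u l)" 
    and l: "\<forall>k<N. l k \<ge> 0" and l1: "(\<Sum>k<N. l k) = 1"
    and A: "A \<subseteq> {..<N}" and S: "S \<subseteq> {..<N}" and p: "\<And>i. i \<in> S \<Longrightarrow> Re (P $$ (i,i)) \<le> p" "p \<ge> 0"
  shows "\<exists>T. incoherent_op N (2 ^ m) T \<and> fidelity (T P) (tpow m Phi2) \<ge>
    (\<Sum>a\<in>A. l a) - 3 / 2 * (\<Sum>i\<in>{..<N} - S. Re (P $$ (i,i))) - 2 ^ m * p * card A / 2"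
proof -
  define M :: nat where "M = 2 ^ m"
  have M: "M > 0" by (simp add: M_def)
  have fA: "finite A" using A finite_subset by blast
  define Pi where "Pi = fc N u (indicator A)"
  define x where "x a i = (indicator S i :: complex) * u i a" for a i
  \<comment> \<open>\<open>h i i'\<close> is what the pair contributes to the
    \<open>l\<close>-weighted expectation of \<open>T\<close> when both indices fall in the same
    bin.\<close>
  define h where "h i i' = real M * Re (Pi i i' * (\<Sum>a\<in>A. complex_of_real (l a) * (cnj (x a i) * x a i')))" for i i'
  obtain j where j: "\<And>i. j i < M" and jh: 
    "(\<Sum>i<N. \<Sum>i'<N. if i \<noteq> i' \<and> j i = j i' then h i i' else 0) \<le> (\<Sum>i<N. \<Sum>i'<N. if i \<noteq> i' then h i i' else 0) / M"
    using exists_hash_below_average[OF M, where h = h and N = N] by blast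
  define T where "T i i' = (if j i = j i' \<and> i \<in> S \<and> i' \<in> S then complex_of_real M * Pi i i' else 0)" for i i'
  have cPi: "cnj (Pi i k) = Pi k i" for i k
    using ct_fc[of N u "indicator A"] unfolding Pi_def by (metis ct_def)
  have "T k i = cnj (T i k)" for i k by (auto simp: T_def cPi)
  then obtain w t where w: "onb N w" and Tw: "eqm N T (fc N w t)"
    using spectral_theorem[of N T] by blast
  \<comment> \<open>\<open>T\<close> is \<open>M\<close> times the sum over the bins of compressions
    of a projection, hence positive; \<open>y k\<close> is the part of \<open>z\<close> on
    \<open>S\<close> lying in bin \<open>k\<close>.\<close>
  have quad: "\<exists>r\<ge>0. (\<Sum>i<N. \<Sum>i'<N. cnj (z i) * T i i' * z i') = complex_of_real r" for z
  proof -
    define y where "y k i = (if j i = k \<and> i \<in> S then z i else 0)" for k i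
    have "(\<Sum>i<N. \<Sum>i'<N. cnj (z i) * T i i' * z i') = 
       (\<Sum>i<N. \<Sum>i'<N. complex_of_real M * (\<Sum>k<M. cnj (y k i) * Pi i i' * y k i'))"
    proof (rule sum.cong[OF refl], rule sum.cong[OF refl])
      fix i i'
      have "(\<Sum>k<M. cnj (y k i) * Pi i i' * y k i') = 
         (\<Sum>k<M. if k = j i then (if j i = j i' \<and> i \<in> S \<and> i' \<in> S then cnj (z i) * Pi i i' * z i' else 0) else 0)"
        by (rule sum.cong[OF refl]) (auto simp: y_def)
      also have "\<dots> = (if j i = j i' \<and> i \<in> S \<and> i' \<in> S then cnj (z i) * Pi i i' * z i' else 0)"
        using j[of i] by (subst sum.delta) auto
      finally show "cnj (z i) * T i i' * z i' = complex_of_real M * (\<Sum>k<M. cnj (y k i) * Pi i i' * y k i')"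
        by (simp add: T_def mult_ac)
    qed
    also have "\<dots> = complex_of_real M * (\<Sum>i<N. \<Sum>i'<N. \<Sum>k<M. cnj (y k i) * Pi i i' * y k i')"
      by (simp add: sum_distrib_left)
    also have "(\<Sum>i<N. \<Sum>i'<N. \<Sum>k<M. cnj (y k i) * Pi i i' * y k i') = (\<Sum>i<N. \<Sum>k<M. \<Sum>i'<N. cnj (y k i) * Pi i i' * y k i')"
      by (rule sum.cong[OF refl], rule sum.swap)
    also have "\<dots> = (\<Sum>k<M. \<Sum>i<N. \<Sum>i'<N. cnj (y k i) * Pi i i' * y k i')" by (rule sum.swap)
    also have "\<dots> = complex_of_real (\<Sum>k<M. \<Sum>b<N. indicator A b * (cmod (\<Sum>i<N. cnj (u i b) * y k i))\<^sup>2)"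
      unfolding Pi_def fc_quadratic_form of_real_sum ..
    finally have "(\<Sum>i<N. \<Sum>i'<N. cnj (z i) * T i i' * z i') = 
      complex_of_real (real M * (\<Sum>k<M. \<Sum>b<N. indicator A b * (cmod (\<Sum>i<N. cnj (u i b) * y k i))\<^sup>2))"
      by simp
    moreover have "0 \<le> real M * (\<Sum>k<M. \<Sum>b<N. indicator A b * (cmod (\<Sum>i<N. cnj (u i b) * y k i))\<^sup>2)"
      by (intro mult_nonneg_nonneg sum_nonneg) simp_all
    ultimately show ?thesis by blast
  qed
  have t: "t k \<ge> 0" if k: "k < N" for k
  proof -
    obtain r where r: "r \<ge> 0" "(\<Sum>i<N. \<Sum>i'<N. cnj (w i k) * T i i' * w i' k) = complex_of_real r"
      using quad[of "\<lambda>i. w i k"] by blast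
    have "complex_of_real (t k) = (\<Sum>i<N. \<Sum>i'<N. cnj (w i k) * fc N w t i i' * w i' k)"
      by (rule fc_coeff[OF w k, symmetric])
    also have "\<dots> = complex_of_real r"
      unfolding r(2)[symmetric] using Tw by (intro sum.cong refl) (simp add: eqm_def)
    finally show ?thesis using r(1) by (simp only: of_real_eq_iff)
  qed
  have fcT: "fc N w t i i' = T i i'" if "i < N" "i' < N" for i i'
    using Tw that by (simp add: eqm_def)
  interpret hashed_projection N "real M" j S A u w t
    by unfold_locales (auto simp: u w t M fcT T_def Pi_def)
  \<comment> \<open>Rows below \<open>N\<close> come from \<open>V\<close>, the next
    \<open>N\<close> from \<open>R\<close>, which makes the map trace preserving.\<close>
  define c where "c a = (if a < N then V a else R (a - N))" for a
  have "(\<Sum>a<N + N. cnj (c a i) * c a i') = idm i i'" if "i < N" "i' < N" "j i = j i'" for i i'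
    using isometry[OF that] by (simp add: sum_lessThan_add c_def)
  then obtain Op where Op: "incoherent_op N (2 ^ m) Op"
    and F: "fidelity (Op P) (tpow m Phi2) = sqrt ((\<Sum>a<N + N. \<Sum>b<N. l b * (cmod (\<Sum>k<N. c a k * u k b))\<^sup>2) / 2 ^ m)"
    using incoherent_op_of_rows[where j = j and m = m and n = "N + N" and c = c, OF _ _ P Pu l] j unfolding M_def by blast
  define e where "e a k = (cmod (\<Sum>i<N. cnj (w i k) * x a i))\<^sup>2" for a k
  define y where "y a = (\<Sum>k<N. e a k / (1 + t k))" for a
  have x_q: "q i * u i a = x a i" for a i by (simp add: q_def x_def)
  have e0: "e a k \<ge> 0" for a k by (simp add: e_def)
  have lA: "l a \<ge> 0" if "a \<in> A" for a using l A that by auto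
  \<comment> \<open>The lower bound keeps only the rows \<open>a\<close> in \<open>A\<close>, each
    against its own eigenvector. Cauchy-Schwarz with weights \<open>l\<close>, of total at most 1,
    then passes from the squares to a linear average.\<close>
  have F_ge: "2 * (\<Sum>a\<in>A. l a * y a) \<le> fidelity (Op P) (tpow m Phi2)"
  proof -
    have "(\<Sum>a\<in>A. l a * (4 * real M * (y a)\<^sup>2)) = (\<Sum>a\<in>A. l a * (cmod (\<Sum>k<N. c a k * u k a))\<^sup>2)"
    proof (rule sum.cong[OF refl])
      fix a assume a: "a \<in> A"
      then have "(\<Sum>k<N. c a k * u k a) = complex_of_real (2 * sqrt (real M) * y a)"
        using diagonal_amplitude[OF a] A by (auto simp: c_def y_def e_def x_q)
      then show "l a * (4 * real M * (y a)\<^sup>2) = l a * (cmod (\<Sum>k<N. c a k * u k a))\<^sup>2"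
        by (simp only: norm_of_real) (simp add: power_mult_distrib)
    qed
    also have "\<dots> \<le> (\<Sum>a\<in>A. \<Sum>b<N. l b * (cmod (\<Sum>k<N. c a k * u k b))\<^sup>2)"
      using A l by (intro sum_mono member_le_sum) auto
    also have "\<dots> \<le> (\<Sum>a<N + N. \<Sum>b<N. l b * (cmod (\<Sum>k<N. c a k * u k b))\<^sup>2)"
      using A l by (intro sum_mono2) (auto intro!: sum_nonneg)
    finally have 1: "4 * (\<Sum>a\<in>A. l a * (y a)\<^sup>2) \<le> (\<Sum>a<N + N. \<Sum>b<N. l b * (cmod (\<Sum>k<N. c a k * u k b))\<^sup>2) / 2 ^ m"
      using M by (simp add: M_def sum_distrib_left field_simps)
    have "(\<Sum>a\<in>A. l a * y a)\<^sup>2 = (\<Sum>a\<in>A. sqrt (l a) * (sqrt (l a) * y a))\<^sup>2"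
      using lA by (simp flip: mult.assoc)
    also have "\<dots> \<le> (\<Sum>a\<in>A. (sqrt (l a))\<^sup>2) * (\<Sum>a\<in>A. (sqrt (l a) * y a)\<^sup>2)"
      by (rule Cauchy_Schwarz_ineq_sum)
    also have "\<dots> = (\<Sum>a\<in>A. l a) * (\<Sum>a\<in>A. l a * (y a)\<^sup>2)" using lA by (simp add: power_mult_distrib)
    also have "\<dots> \<le> 1 * (\<Sum>a\<in>A. l a * (y a)\<^sup>2)"
    proof (rule mult_right_mono)
      have "(\<Sum>a\<in>A. l a) \<le> (\<Sum>k<N. l k)" using A l by (intro sum_mono2) auto
      then show "(\<Sum>a\<in>A. l a) \<le> 1" using l1 by simp
    qed (use lA in \<open>auto intro!: sum_nonneg\<close>)
    finally have "(2 * (\<Sum>a\<in>A. l a * y a))\<^sup>2 \<le> 4 * (\<Sum>a\<in>A. l a * (y a)\<^sup>2)"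
      unfolding power_mult_distrib by simp
    with 1 show ?thesis unfolding F by (intro real_le_rsqrt) linarith
  qed
  define \<tau> where "\<tau> a = (\<Sum>k<N. t k * e a k)" for a
  define n2 where "n2 a = (\<Sum>i<N. (cmod (x a i))\<^sup>2)" for a
  \<comment> \<open>\<open>3 - t\<close> is the tangent of the convex function
    \<open>4 / (1 + t)\<close> at \<open>t = 1\<close>, so the resolvent is bounded below by an
    expression linear in \<open>T\<close>.\<close>
  have y_ge: "3 * n2 a - \<tau> a \<le> 4 * y a" for a
  proof -
    have "n2 a = (\<Sum>k<N. e a k)" unfolding n2_def e_def by (rule parseval[OF w, symmetric])
    then have "3 * n2 a - \<tau> a = (\<Sum>k<N. e a k * (3 - t k))"
      unfolding \<tau>_def
      by (simp add: sum_distrib_left sum_subtractf right_diff_distrib mult.commute)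
    also have "\<dots> \<le> (\<Sum>k<N. 4 * (e a k / (1 + t k)))"
    proof (rule sum_mono)
      fix k assume "k \<in> {..<N}"
      then have tk: "1 + t k > 0" using t[of k] by simp
      have "(3 - t k) * (1 + t k) \<le> 4"
        using zero_le_power2[of "1 - t k"] by (simp add: power2_eq_square algebra_simps)
      then have "3 - t k \<le> 4 / (1 + t k)" using tk by (simp add: pos_le_divide_eq)
      then have "e a k * (3 - t k) \<le> e a k * (4 / (1 + t k))" by (rule mult_left_mono[OF _ e0])
      then show "e a k * (3 - t k) \<le> 4 * (e a k / (1 + t k))" by (simp add: mult.commute)
    qed
    finally show ?thesis by (simp add: y_def sum_distrib_left)
  qed
  \<comment> \<open>Stated for a general relation \<open>C\<close> since it is needed both for pairs
    in a common bin and for all pairs.\<close>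
  have H: "(\<Sum>i<N. \<Sum>i'<N. if C i i' then h i i' else 0) = 
      Re (\<Sum>a\<in>A. complex_of_real (l a) * (\<Sum>i<N. \<Sum>i'<N. cnj (x a i) * (if C i i' then M * Pi i i' else 0) * x a i'))" for C
  proof -
    let ?s = "\<lambda>a i i'. complex_of_real (l a) * (cnj (x a i) * (if C i i' then M * Pi i i' else 0) * x a i')"
    have "(\<Sum>a\<in>A. complex_of_real (l a) * (\<Sum>i<N. \<Sum>i'<N. cnj (x a i) * (if C i i' then M * Pi i i' else 0) * x a i')) =
      (\<Sum>a\<in>A. \<Sum>i<N. \<Sum>i'<N. ?s a i i')" by (simp add: sum_distrib_left)
    also have "\<dots> = (\<Sum>i<N. \<Sum>a\<in>A. \<Sum>i'<N. ?s a i i')" by (rule sum.swap)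
    also have "\<dots> = (\<Sum>i<N. \<Sum>i'<N. \<Sum>a\<in>A. ?s a i i')" by (rule sum.cong[OF refl], rule sum.swap)
    finally have "Re (\<Sum>a\<in>A. complex_of_real (l a) * (\<Sum>i<N. \<Sum>i'<N. cnj (x a i) * (if C i i' then M * Pi i i' else 0) * x a i')) =
      (\<Sum>i<N. \<Sum>i'<N. Re (\<Sum>a\<in>A. ?s a i i'))" by simp
    also have "\<dots> = (\<Sum>i<N. \<Sum>i'<N. if C i i' then h i i' else 0)"
    proof (rule sum.cong[OF refl], rule sum.cong[OF refl])
      fix i i'
      have "(\<Sum>a\<in>A. ?s a i i') = (if C i i' then complex_of_real (real M) * (Pi i i' * (\<Sum>a\<in>A. complex_of_real (l a) * (cnj (x a i) * x a i'))) else 0)"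
        by (simp add: sum_distrib_left mult_ac)
      then show "Re (\<Sum>a\<in>A. ?s a i i') = (if C i i' then h i i' else 0)"
        by (simp only: h_def) simp
    qed
    finally show ?thesis ..
  qed
  have \<tau>_sum: "(\<Sum>a\<in>A. l a * \<tau> a) = (\<Sum>i<N. \<Sum>i'<N. if j i = j i' then h i i' else 0)"
  proof -
    have "(\<Sum>i<N. \<Sum>i'<N. cnj (x a i) * (if j i = j i' then M * Pi i i' else 0) * x a i') = complex_of_real (\<tau> a)" for a
    proof -
      have "(\<Sum>i<N. \<Sum>i'<N. cnj (x a i) * (if j i = j i' then M * Pi i i' else 0) * x a i') = 
         (\<Sum>i<N. \<Sum>i'<N. cnj (x a i) * fc N w t i i' * x a i')"
        by (intro sum.cong refl) (auto simp: fcT T_def x_def indicator_def)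
      then show ?thesis unfolding fc_quadratic_form \<tau>_def e_def .
    qed
    then show ?thesis unfolding H by simp
  qed
  \<comment> \<open>Over all pairs the bins disappear, and the sum is \<open>M\<close> times a
    weighted expectation of a projection in vectors of norm at most 1.\<close>
  have h_total: "(\<Sum>i<N. \<Sum>i'<N. h i i') \<le> M * (\<Sum>a\<in>A. l a)"
  proof -
    have q1: "(\<Sum>i<N. \<Sum>i'<N. cnj (x a i) * (M * Pi i i') * x a i') = 
      complex_of_real (M * (\<Sum>k<N. indicator A k * (cmod (\<Sum>i<N. cnj (u i k) * x a i))\<^sup>2))" for a
    proof -
      have "(\<Sum>i<N. \<Sum>i'<N. cnj (x a i) * (M * Pi i i') * x a i') = M * (\<Sum>i<N. \<Sum>i'<N. cnj (x a i) * Pi i i' * x a i')"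
        by (simp add: sum_distrib_left mult_ac)
      then show ?thesis unfolding Pi_def fc_quadratic_form by simp
    qed
    have le1: "(\<Sum>k<N. indicator A k * (cmod (\<Sum>i<N. cnj (u i k) * x a i))\<^sup>2) \<le> 1" if "a \<in> A" for a
    proof -
      have "(\<Sum>k<N. indicator A k * (cmod (\<Sum>i<N. cnj (u i k) * x a i))\<^sup>2) \<le> (\<Sum>k<N. (cmod (\<Sum>i<N. cnj (u i k) * x a i))\<^sup>2)"
        by (intro sum_mono) (simp add: indicator_def)
      also have "\<dots> = (\<Sum>i<N. (cmod (x a i))\<^sup>2)" by (rule parseval[OF u])
      also have "\<dots> \<le> (\<Sum>i<N. (cmod (u i a))\<^sup>2)" by (intro sum_mono) (simp add: x_def indicator_def)
      also have "\<dots> = 1" using A that by (intro onb_col_norm[OF u]) auto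
      finally show ?thesis .
    qed
    have "(\<Sum>i<N. \<Sum>i'<N. h i i') = (\<Sum>a\<in>A. l a * (M * (\<Sum>k<N. indicator A k * (cmod (\<Sum>i<N. cnj (u i k) * x a i))\<^sup>2)))"
      using H[of "\<lambda>_ _. True"] by (simp only: if_True q1) simp
    also have "\<dots> \<le> (\<Sum>a\<in>A. l a * (real M * 1))"
      by (intro sum_mono mult_left_mono le1 lA of_nat_0_le_iff)
    finally show ?thesis by (simp add: sum_distrib_left mult.commute)
  qed
  define d where "d i = (\<Sum>k<N. indicator A k * (cmod (u i k))\<^sup>2)" for i
  have d0: "d i \<ge> 0" for i by (auto simp: d_def intro!: sum_nonneg)
  \<comment> \<open>The factor \<open>d i\<close> is a diagonal entry of the projection; the factor
    \<open>v\<close> is dominated by the diagonal entry of \<open>P\<close>, hence by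
    \<open>p\<close>, on \<open>S\<close> and is 0 elsewhere.\<close>
  have h_diag: "0 \<le> h i i" "h i i \<le> M * (d i * p)" if i: "i < N" for i
  proof -
    define v where "v = (\<Sum>a\<in>A. l a * (cmod (x a i))\<^sup>2)"
    have "(\<Sum>a\<in>A. complex_of_real (l a) * (cnj (x a i) * x a i)) = complex_of_real v"
      unfolding v_def of_real_sum of_real_mult complex_norm_square by (simp only: mult.commute)
    then have hv: "h i i = M * (d i * v)"
      unfolding h_def Pi_def fc_diag d_def[symmetric] by (simp flip: of_real_mult)
    have v0: "v \<ge> 0" using lA by (auto simp: v_def intro!: sum_nonneg)
    have "v \<le> p"
    proof (cases "i \<in> S")
      case True
      have "v \<le> (\<Sum>k<N. l k * (cmod (u i k))\<^sup>2)"
        unfolding v_def x_def using True A l by (auto intro!: sum_mono2)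
      also have "\<dots> = Re (P $$ (i,i))" using density_diag(2)[OF u Pu i] ..
      finally show ?thesis using p True by force
    qed (use p in \<open>simp add: v_def x_def\<close>)
    then show "0 \<le> h i i" "h i i \<le> M * (d i * p)"
      unfolding hv using v0 d0 by (auto intro!: mult_left_mono)
  qed
  have h_diag_sum: "(\<Sum>i<N. h i i) \<le> M * p * card A"
  proof -
    have "(\<Sum>i<N. h i i) \<le> (\<Sum>i<N. M * (d i * p))" using h_diag by (intro sum_mono) simp
    also have "\<dots> = M * p * (\<Sum>i<N. d i)" by (simp add: sum_distrib_left mult_ac)
    also have "(\<Sum>i<N. d i) = card A"
    proof -
      have "complex_of_real (\<Sum>i<N. d i) = (\<Sum>i<N. Pi i i)" by (simp add: Pi_def fc_diag d_def)
      also have "\<dots> = complex_of_real (\<Sum>k<N. indicator A k)" unfolding Pi_def by (rule fc_trace[OF u])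
      also have "(\<Sum>k<N. indicator A k :: real) = card A"
        using A by (simp add: indicator_def of_bool_def sum.If_cases Int_absorb1)
      finally show ?thesis by (simp only: of_real_eq_iff)
    qed
    finally show ?thesis .
  qed
  \<comment> \<open>Pairs with \<open>i = i'\<close> always collide; the total over the others is
    reduced by the factor \<open>1 / M\<close> through the choice of \<open>j\<close>.\<close>
  have \<tau>_le: "(\<Sum>a\<in>A. l a * \<tau> a) \<le> M * p * card A + (\<Sum>a\<in>A. l a)"
  proof -
    have split: "(\<Sum>i<N. \<Sum>i'<N. if C i i' then h i i' else 0) = (\<Sum>i<N. h i i) + (\<Sum>i<N. \<Sum>i'<N. if i \<noteq> i' \<and> C i i' then h i i' else 0)"
      if "\<And>i. C i i" for C
    proof -
      have "(\<Sum>i<N. \<Sum>i'<N. if C i i' then h i i' else 0) = 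
        (\<Sum>i<N. \<Sum>i'<N. (if i = i' then h i i' else 0) + (if i \<noteq> i' \<and> C i i' then h i i' else 0))"
        by (rule sum.cong[OF refl], rule sum.cong[OF refl]) (use that in auto)
      then show ?thesis by (simp add: sum.distrib)
    qed
    have "(\<Sum>a\<in>A. l a * \<tau> a) = (\<Sum>i<N. h i i) + (\<Sum>i<N. \<Sum>i'<N. if i \<noteq> i' \<and> j i = j i' then h i i' else 0)"
      unfolding \<tau>_sum by (rule split) simp
    also have "\<dots> \<le> (\<Sum>i<N. h i i) + (\<Sum>i<N. \<Sum>i'<N. if i \<noteq> i' then h i i' else 0) / M" using jh by simp
    also have "(\<Sum>i<N. \<Sum>i'<N. if i \<noteq> i' then h i i' else 0) = (\<Sum>i<N. \<Sum>i'<N. h i i') - (\<Sum>i<N. h i i)"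
      using split[of "\<lambda>_ _. True"] by simp
    also have "((\<Sum>i<N. \<Sum>i'<N. h i i') - (\<Sum>i<N. h i i)) / M \<le> (M * (\<Sum>a\<in>A. l a)) / M"
    proof (rule divide_right_mono)
      have "0 \<le> (\<Sum>i<N. h i i)" using h_diag(1) by (intro sum_nonneg) simp
      with h_total show "(\<Sum>i<N. \<Sum>i'<N. h i i') - (\<Sum>i<N. h i i) \<le> M * (\<Sum>a\<in>A. l a)" by linarith
    qed simp
    finally show ?thesis using h_diag_sum M by simp
  qed
  \<comment> \<open>\<open>1 - n2 a\<close> is the mass of the \<open>a\<close>-th eigenvector off
    \<open>S\<close>; its \<open>l\<close>-average is at most the mass of the diagonal of
    \<open>P\<close> there.\<close>
  have n2_ge: "(\<Sum>a\<in>A. l a * n2 a) \<ge> (\<Sum>a\<in>A. l a) - (\<Sum>i\<in>{..<N} - S. Re (P $$ (i,i)))"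
  proof -
    define b where "b a = (\<Sum>i\<in>{..<N} - S. (cmod (u i a))\<^sup>2)" for a
    have n2b: "n2 a = 1 - b a" if "a \<in> A" for a
    proof -
      have "(\<Sum>i<N. (cmod (u i a))\<^sup>2) = 1" using A that by (intro onb_col_norm[OF u]) auto
      moreover have "n2 a = (\<Sum>i\<in>S. (cmod (u i a))\<^sup>2)"
        unfolding n2_def x_def by (rule sum.mono_neutral_cong_right) (use S in \<open>auto simp: indicator_def\<close>)
      ultimately show ?thesis unfolding b_def
        using sum.subset_diff[OF S, of "\<lambda>i. (cmod (u i a))\<^sup>2"] by simp
    qed
    have "(\<Sum>a\<in>A. l a * b a) \<le> (\<Sum>a<N. l a * b a)"
      using A l by (intro sum_mono2) (auto simp: b_def intro!: mult_nonneg_nonneg sum_nonneg)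
    also have "\<dots> = (\<Sum>i\<in>{..<N} - S. Re (P $$ (i,i)))"
      unfolding b_def sum_distrib_left by (subst sum.swap) (use density_diag(2)[OF u Pu] in simp)
    finally show ?thesis by (simp add: n2b right_diff_distrib sum_subtractf)
  qed
  have "(\<Sum>a\<in>A. l a * (3 * n2 a - \<tau> a)) \<le> (\<Sum>a\<in>A. l a * (4 * y a))"
    using y_ge lA by (intro sum_mono mult_left_mono) auto
  then have "3 * (\<Sum>a\<in>A. l a * n2 a) - (\<Sum>a\<in>A. l a * \<tau> a) \<le> 4 * (\<Sum>a\<in>A. l a * y a)"
    by (simp add: sum_distrib_left right_diff_distrib sum_subtractf mult_ac)
  with F_ge \<tau>_le n2_ge have "fidelity (Op P) (tpow m Phi2) \<ge>
    (\<Sum>a\<in>A. l a) - 3 / 2 * (\<Sum>i\<in>{..<N} - S. Re (P $$ (i,i))) - real M * p * card A / 2"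
    by linarith
  then show ?thesis using Op by (auto simp: M_def)
qed

subsection \<open>Tensor powers and typicality\<close>

text \<open>An index below \<open>d ^ n\<close> is read as \<open>n\<close> digits in base
  \<open>d\<close>, the last tensor factor being the least significant digit, in agreement with
  \<open>kron\<close> and \<open>tpow\<close>.\<close>

fun prod_dist :: "nat \<Rightarrow> nat \<Rightarrow> (nat \<Rightarrow> real) \<Rightarrow> nat \<Rightarrow> real" where
  "prod_dist d 0 p i = 1"
| "prod_dist d (Suc n) p i = prod_dist d n p (i div d) * p (i mod d)"

fun digit_sum :: "nat \<Rightarrow> nat \<Rightarrow> (nat \<Rightarrow> real) \<Rightarrow> nat \<Rightarrow> real" where
  "digit_sum d 0 f i = 0"
| "digit_sum d (Suc n) f i = digit_sum d n f (i div d) + f (i mod d)"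

fun tensor_basis :: "nat \<Rightarrow> nat \<Rightarrow> (nat \<Rightarrow> nat \<Rightarrow> complex) \<Rightarrow> nat \<Rightarrow> nat \<Rightarrow> complex" where
  "tensor_basis d 0 u i k = 1"
| "tensor_basis d (Suc n) u i k = tensor_basis d n u (i div d) (k div d) * u (i mod d) (k mod d)"

section \<open>Kronecker products of bases and of matrix functions\<close>

lemma sum_div_mod:
  "(\<Sum>i<N * d. F (i div d) (i mod d)) = (\<Sum>a<N. \<Sum>b<d. F a b)"
  for N d :: nat and F :: "nat \<Rightarrow> nat \<Rightarrow> 'a::comm_monoid_add"
proof (induction N)
  case (Suc N)
  have "(\<Sum>i<Suc N * d. F (i div d) (i mod d)) = (\<Sum>i<N * d + d. F (i div d) (i mod d))"
    by (simp add: add.commute)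
  also have "\<dots> = (\<Sum>i<N * d. F (i div d) (i mod d)) + (\<Sum>b<d. F ((N * d + b) div d) ((N * d + b) mod d))"
    by (rule sum_lessThan_add)
  also have "(\<Sum>b<d. F ((N * d + b) div d) ((N * d + b) mod d)) = (\<Sum>b<d. F N b)"
    by (rule sum.cong) auto
  finally show ?case using Suc by simp
qed simp

lemma onb_kron:
  assumes d: "d > 0" and u: "onb N u" and v: "onb d v"
  shows "onb (N * d) (\<lambda>i k. u (i div d) (k div d) * v (i mod d) (k mod d))" (is "onb _ ?w")
proof -
  have lt: "i div d < N" "i mod d < d" if "i < N * d" for i
    using that d by (simp_all add: less_mult_imp_div_less)
  have id: "idm (i div d) (j div d) * idm (i mod d) (j mod d) = idm i j" for i j
  proof -
    have "i = j \<longleftrightarrow> i div d = j div d \<and> i mod d = j mod d" by (metis div_mult_mod_eq)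
    then show ?thesis by (auto simp: idm_def)
  qed
  have "mm (N * d) (ct ?w) ?w i j = mm N (ct u) u (i div d) (j div d) * mm d (ct v) v (i mod d) (j mod d)" for i j
  proof -
    let ?F = "\<lambda>a b. cnj (u a (i div d) * v b (i mod d)) * (u a (j div d) * v b (j mod d))"
    have "mm (N * d) (ct ?w) ?w i j = (\<Sum>k<N * d. ?F (k div d) (k mod d))" by (simp add: mm_def ct_def)
    also have "\<dots> = (\<Sum>a<N. \<Sum>b<d. ?F a b)" by (rule sum_div_mod)
    finally show ?thesis unfolding mm_def ct_def by (simp add: sum_product mult_ac)
  qed
  moreover have "mm (N * d) ?w (ct ?w) i j = mm N u (ct u) (i div d) (j div d) * mm d v (ct v) (i mod d) (j mod d)" for i j
  proof -
    let ?F = "\<lambda>a b. (u (i div d) a * v (i mod d) b) * cnj (u (j div d) a * v (j mod d) b)"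
    have "mm (N * d) ?w (ct ?w) i j = (\<Sum>k<N * d. ?F (k div d) (k mod d))" by (simp add: mm_def ct_def)
    also have "\<dots> = (\<Sum>a<N. \<Sum>b<d. ?F a b)" by (rule sum_div_mod)
    finally show ?thesis unfolding mm_def ct_def by (simp add: sum_product mult_ac)
  qed
  ultimately show ?thesis using u v lt id unfolding onb_def eqm_def by simp
qed

lemma fc_kron:
  "fc (N * d) (\<lambda>i k. u (i div d) (k div d) * v (i mod d) (k mod d)) (\<lambda>k. f (k div d) * g (k mod d)) i j =
   fc N u f (i div d) (j div d) * fc d v g (i mod d) (j mod d)"
proof -
  let ?F = "\<lambda>a b. (u (i div d) a * v (i mod d) b) * complex_of_real (f a * g b) * cnj (u (j div d) a * v (j mod d) b)"
  have "fc (N * d) (\<lambda>i k. u (i div d) (k div d) * v (i mod d) (k mod d)) (\<lambda>k. f (k div d) * g (k mod d)) i j =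
    (\<Sum>k<N * d. ?F (k div d) (k mod d))" by (simp add: fc_def)
  also have "\<dots> = (\<Sum>a<N. \<Sum>b<d. ?F a b)" by (rule sum_div_mod)
  finally show ?thesis unfolding fc_def by (simp add: sum_product mult_ac)
qed

lemma tpow_carrier:
  assumes "A \<in> carrier_mat d d" shows "tpow n A \<in> carrier_mat (d ^ n) (d ^ n)"
  by (induction n) (use assms in \<open>auto simp: kron_def mult.commute\<close>)

lemma tpow_Suc_index:
  assumes A: "A \<in> carrier_mat d d" and ij: "i < d ^ Suc n" "j < d ^ Suc n"
  shows "tpow (Suc n) A $$ (i,j) = tpow n A $$ (i div d, j div d) * A $$ (i mod d, j mod d)"
  using ij tpow_carrier[OF A, of n] A by (auto simp: kron_def mult.commute)

lemma onb_tensor_basis: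
  assumes "d > 0" "onb d u" shows "onb (d ^ n) (tensor_basis d n u)"
proof (induction n)
  case 0
  show ?case by (simp add: onb_def eqm_def mm_def ct_def idm_def)
next
  case (Suc n)
  then show ?case using onb_kron[OF assms(1) Suc assms(2)]
    by (simp add: fun_eq_iff mult.commute[of d] tensor_basis.simps[abs_def])
qed

lemma tpow_spectral:
  assumes d: "d > 0" and A: "A \<in> carrier_mat d d" and Au: "eqm d (\<lambda>i j. A $$ (i,j)) (fc d u l)"
  shows "eqm (d ^ n) (\<lambda>i j. tpow n A $$ (i,j)) (fc (d ^ n) (tensor_basis d n u) (prod_dist d n l))"
proof (induction n)
  case 0
  show ?case by (simp add: eqm_def fc_def)
next
  case (Suc n)
  show ?case unfolding eqm_def
  proof (intro allI impI)
    fix i j assume ij: "i < d ^ Suc n" "j < d ^ Suc n"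
    then have lt: "i div d < d ^ n" "j div d < d ^ n" "i mod d < d" "j mod d < d"
      using d by (simp_all add: less_mult_imp_div_less mult.commute)
    have "fc (d ^ Suc n) (tensor_basis d (Suc n) u) (prod_dist d (Suc n) l) i j =
      fc (d ^ n * d) (\<lambda>i k. tensor_basis d n u (i div d) (k div d) * u (i mod d) (k mod d)) 
        (\<lambda>k. prod_dist d n l (k div d) * l (k mod d)) i j"
      by (simp add: fc_def mult.commute[of d])
    also have "\<dots> = tpow n A $$ (i div d, j div d) * A $$ (i mod d, j mod d)"
      unfolding fc_kron using Suc Au lt by (simp add: eqm_def)
    finally show "tpow (Suc n) A $$ (i,j) = fc (d ^ Suc n) (tensor_basis d (Suc n) u) (prod_dist d (Suc n) l) i j"
      by (simp only: tpow_Suc_index[OF A ij])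
  qed
qed

lemma tpow_diag:
  assumes d: "d > 0" and A: "A \<in> carrier_mat d d" and r: "\<And>i. i < d \<Longrightarrow> A $$ (i,i) = complex_of_real (Re (A $$ (i,i)))"
  shows "i < d ^ n \<Longrightarrow> tpow n A $$ (i,i) = complex_of_real (prod_dist d n (\<lambda>i. Re (A $$ (i,i))) i)"
proof (induction n arbitrary: i)
  case (Suc n)
  have lt: "i div d < d ^ n" "i mod d < d"
    using Suc.prems d by (simp_all add: less_mult_imp_div_less mult.commute)
  show ?case unfolding tpow_Suc_index[OF A Suc.prems Suc.prems] using Suc.IH[OF lt(1)] r[OF lt(2)] by simp
qed simp

section \<open>Moments of product distributions and typicality\<close>

lemma prod_dist_nonneg:
  assumes "d > 0" "\<And>k. k < d \<Longrightarrow> p k \<ge> 0" shows "prod_dist d n p i \<ge> 0"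
  using assms by (induction n arbitrary: i) auto

lemma sum_power_Suc: "(\<Sum>i<d ^ Suc n. F (i div d) (i mod d)) = (\<Sum>a<d ^ n. \<Sum>b<d. F a b)"
  for F :: "nat \<Rightarrow> nat \<Rightarrow> real"
  using sum_div_mod[where N = "d ^ n" and d = d and F = F] by (simp add: mult.commute)

text \<open>For independent digits the variance is additive: on expanding the square, the cross term
  carries the factor \<open>\<Sum>k<d. p k * f k\<close>, which is zero.\<close>

lemma prod_dist_moments:
  assumes p1: "(\<Sum>k<d. p k) = 1" and f0: "(\<Sum>k<d. p k * f k) = 0"
  shows "(\<Sum>i<d ^ n. prod_dist d n p i) = 1"
    and "(\<Sum>i<d ^ n. prod_dist d n p i * digit_sum d n f i) = 0"
    and "(\<Sum>i<d ^ n. prod_dist d n p i * (digit_sum d n f i)\<^sup>2) = n * (\<Sum>k<d. p k * (f k)\<^sup>2)"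
proof (induction n)
  case 0
  case 1 show ?case by simp
  case 2 show ?case by simp
  case 3 show ?case by simp
next
  case (Suc n)
  let ?P = "prod_dist d n p" and ?D = "digit_sum d n f"
  case 1
  have "(\<Sum>i<d ^ Suc n. prod_dist d (Suc n) p i) = (\<Sum>a<d ^ n. \<Sum>b<d. ?P a * p b)"
    by (simp only: prod_dist.simps sum_power_Suc[where F = "\<lambda>a b. ?P a * p b"])
  then show ?case using Suc(1) p1 by (simp add: sum_distrib_left[symmetric])
  case 2
  have "(\<Sum>i<d ^ Suc n. prod_dist d (Suc n) p i * digit_sum d (Suc n) f i) = (\<Sum>a<d ^ n. \<Sum>b<d. ?P a * p b * (?D a + f b))"
    by (simp only: prod_dist.simps digit_sum.simps sum_power_Suc[where F = "\<lambda>a b. ?P a * p b * (?D a + f b)"])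
  also have "\<dots> = (\<Sum>a<d ^ n. (?P a * ?D a) * (\<Sum>b<d. p b) + ?P a * (\<Sum>b<d. p b * f b))"
    by (rule sum.cong[OF refl], unfold sum_distrib_left sum.distrib[symmetric], rule sum.cong[OF refl])
      (simp add: algebra_simps)
  finally show ?case using Suc(2) p1 f0 by simp
  case 3
  have "(\<Sum>i<d ^ Suc n. prod_dist d (Suc n) p i * (digit_sum d (Suc n) f i)\<^sup>2) = (\<Sum>a<d ^ n. \<Sum>b<d. ?P a * p b * (?D a + f b)\<^sup>2)"
    by (simp only: prod_dist.simps digit_sum.simps sum_power_Suc[where F = "\<lambda>a b. ?P a * p b * (?D a + f b)\<^sup>2"])
  also have "\<dots> = (\<Sum>a<d ^ n. (?P a * (?D a)\<^sup>2) * (\<Sum>b<d. p b) + 2 * (?P a * ?D a) * (\<Sum>b<d. p b * f b) + ?P a * (\<Sum>b<d. p b * (f b)\<^sup>2))"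
    by (rule sum.cong[OF refl], unfold sum_distrib_left sum.distrib[symmetric], rule sum.cong[OF refl])
      (simp add: power2_sum algebra_simps)
  also have "\<dots> = n * (\<Sum>k<d. p k * (f k)\<^sup>2) + (\<Sum>k<d. p k * (f k)\<^sup>2)"
    unfolding p1 f0 using Suc(1,3) by (simp add: sum.distrib sum_distrib_right[symmetric])
  finally show ?case by (simp add: algebra_simps)
qed

text \<open>On indices of positive weight the logarithm turns the product into a digit sum. The free
  shift \<open>h\<close> allows centring; \<open>typicality_tail\<close> takes the entropy for
  it.\<close>

lemma log_prod_dist:
  assumes d: "d > 0" and p: "\<And>k. k < d \<Longrightarrow> p k \<ge> 0"
  shows "prod_dist d n p i > 0 \<Longrightarrow> log 2 (prod_dist d n p i) = digit_sum d n (\<lambda>k. lg (p k) + h) i - n * h"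
proof (induction n arbitrary: i)
  case (Suc n)
  have "prod_dist d n p (i div d) \<ge> 0" by (rule prod_dist_nonneg[OF assms])
  moreover have "p (i mod d) \<ge> 0" using p d by simp
  ultimately have pos: "prod_dist d n p (i div d) > 0" "p (i mod d) > 0"
    using Suc.prems by (auto simp: zero_less_mult_iff)
  then have "log 2 (prod_dist d (Suc n) p i) = log 2 (prod_dist d n p (i div d)) + log 2 (p (i mod d))"
    by (simp add: log_mult)
  then show ?case using Suc.IH[OF pos(1)] pos(2) by (simp add: lg_def algebra_simps)
qed simp

text \<open>Chebyshev's inequality: the centred log-probability has second moment
  \<open>n * v\<close>, so the weight where it deviates by at least \<open>n * \<delta>\<close> is
  at most \<open>v / (n * \<delta>\<^sup>2)\<close>. Indices of weight 0, where the logarithm says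
  nothing, contribute nothing.\<close>

lemma typicality_tail:
  assumes d: "d > 0" and p: "\<And>k. k < d \<Longrightarrow> p k \<ge> 0" and p1: "(\<Sum>k<d. p k) = 1" and \<delta>: "\<delta> > 0"
    and B: "\<And>n. B n \<subseteq> {..<d ^ n}"
    and dev: "\<And>n i. i \<in> B n \<Longrightarrow> prod_dist d n p i > 0 \<Longrightarrow> \<bar>log 2 (prod_dist d n p i) + n * ent d p\<bar> \<ge> n * \<delta>"
  shows "(\<lambda>n. \<Sum>i\<in>B n. prod_dist d n p i) \<longlonglongrightarrow> 0"
proof -
  define f where "f k = lg (p k) + ent d p" for k
  define v where "v = (\<Sum>k<d. p k * (f k)\<^sup>2)"
  have f0: "(\<Sum>k<d. p k * f k) = 0"
  proof -
    have "(\<Sum>k<d. p k * f k) = (\<Sum>k<d. p k * lg (p k)) + (\<Sum>k<d. p k) * ent d p"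
      by (simp add: f_def distrib_left sum.distrib sum_distrib_right)
    then show ?thesis using p1 by (simp add: ent_def)
  qed
  have nn: "prod_dist d n p i \<ge> 0" for n i by (rule prod_dist_nonneg[OF d p])
  have bound: "(\<Sum>i\<in>B n. prod_dist d n p i) \<le> v / \<delta>\<^sup>2 * inverse (real n)" if n: "n > 0" for n
  proof -
    have "(\<Sum>i\<in>B n. prod_dist d n p i) * (n * \<delta>)\<^sup>2 = (\<Sum>i\<in>B n. prod_dist d n p i * (n * \<delta>)\<^sup>2)"
      by (rule sum_distrib_right)
    also have "\<dots> \<le> (\<Sum>i\<in>B n. prod_dist d n p i * (digit_sum d n f i)\<^sup>2)"
    proof (rule sum_mono)
      fix i assume i: "i \<in> B n"
      show "prod_dist d n p i * (n * \<delta>)\<^sup>2 \<le> prod_dist d n p i * (digit_sum d n f i)\<^sup>2"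
      proof (cases "prod_dist d n p i > 0")
        case True
        have "n * \<delta> \<le> \<bar>digit_sum d n f i\<bar>"
          using dev[OF i True] log_prod_dist[OF d p True, of "ent d p"] by (simp add: f_def[abs_def])
        then have "(n * \<delta>)\<^sup>2 \<le> (digit_sum d n f i)\<^sup>2"
          using \<delta> by (intro iffD1[OF abs_le_square_iff]) simp
        then show ?thesis using True by (intro mult_left_mono) auto
      next
        case False
        then have "prod_dist d n p i = 0" using nn[of n i] by linarith
        then show ?thesis by simp
      qed
    qed
    also have "\<dots> \<le> (\<Sum>i<d ^ n. prod_dist d n p i * (digit_sum d n f i)\<^sup>2)"
      using B nn by (intro sum_mono2) auto
    also have "\<dots> = n * v" unfolding v_def by (rule prod_dist_moments(3)[OF p1 f0])
    finally show ?thesis using n \<delta> by (simp add: field_simps power2_eq_square)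
  qed
  show ?thesis
  proof (rule tendsto_sandwich)
    show "\<forall>\<^sub>F n in sequentially. 0 \<le> (\<Sum>i\<in>B n. prod_dist d n p i)"
      using nn by (intro always_eventually allI sum_nonneg)
    show "\<forall>\<^sub>F n in sequentially. (\<Sum>i\<in>B n. prod_dist d n p i) \<le> v / \<delta>\<^sup>2 * inverse (real n)"
      by (rule eventually_mono[OF eventually_gt_at_top[of 0] bound])
    show "(\<lambda>n. v / \<delta>\<^sup>2 * inverse (real n)) \<longlonglongrightarrow> 0"
      using tendsto_mult_right[OF LIMSEQ_inverse_real_of_nat] tendsto_mult_left[OF tendsto_inverse_0_at_top[OF filterlim_real_sequentially], of "v / \<delta>\<^sup>2"] by simp
  qed simp
qed

lemma typicality:
  assumes d: "d > 0" and p: "\<And>k. k < d \<Longrightarrow> p k \<ge> 0" and p1: "(\<Sum>k<d. p k) = 1" and \<delta>: "\<delta> > 0"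
  shows "(\<lambda>n. \<Sum>i\<in>{i. i < d ^ n \<and> prod_dist d n p i > 2 powr (- (n * (ent d p - \<delta>)))}. prod_dist d n p i) \<longlonglongrightarrow> 0"
    and "(\<lambda>n. \<Sum>i\<in>{i. i < d ^ n \<and> prod_dist d n p i < 2 powr (- (n * (ent d p + \<delta>)))}. prod_dist d n p i) \<longlonglongrightarrow> 0"
proof -
  note tail = typicality_tail[OF d p p1 \<delta>]
  show "(\<lambda>n. \<Sum>i\<in>{i. i < d ^ n \<and> prod_dist d n p i > 2 powr (- (n * (ent d p - \<delta>)))}. prod_dist d n p i) \<longlonglongrightarrow> 0"
  proof (rule tail)
    fix n i assume "i \<in> {i. i < d ^ n \<and> prod_dist d n p i > 2 powr (- (n * (ent d p - \<delta>)))}" "prod_dist d n p i > 0"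
    then have "log 2 (prod_dist d n p i) > - (n * (ent d p - \<delta>))" by (simp add: less_log_iff)
    then show "n * \<delta> \<le> \<bar>log 2 (prod_dist d n p i) + n * ent d p\<bar>" by (simp add: algebra_simps)
  qed auto
  show "(\<lambda>n. \<Sum>i\<in>{i. i < d ^ n \<and> prod_dist d n p i < 2 powr (- (n * (ent d p + \<delta>)))}. prod_dist d n p i) \<longlonglongrightarrow> 0"
  proof (rule tail)
    fix n i assume "i \<in> {i. i < d ^ n \<and> prod_dist d n p i < 2 powr (- (n * (ent d p + \<delta>)))}" "prod_dist d n p i > 0"
    then have "log 2 (prod_dist d n p i) < - (n * (ent d p + \<delta>))" by (simp add: log_less_iff)
    then show "n * \<delta> \<le> \<bar>log 2 (prod_dist d n p i) + n * ent d p\<bar>" by (simp add: algebra_simps)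
  qed auto
qed

subsection \<open>Asymptotic rates\<close>

lemma card_le_of_sum_le_1:
  fixes f :: "nat \<Rightarrow> real"
  assumes "finite B" "\<And>i. i \<in> B \<Longrightarrow> 2 powr (- x) \<le> f i" "(\<Sum>i\<in>B. f i) \<le> 1"
  shows "card B \<le> 2 powr x"
proof -
  have "card B * 2 powr (- x) \<le> (\<Sum>i\<in>B. f i)" using sum_mono[OF assms(2)] by simp
  then have "card B * 2 powr (- x) \<le> 1" using assms(3) by simp
  then show ?thesis by (simp add: powr_minus field_simps)
qed

lemma powr_linear_tendsto_0:
  fixes \<delta> :: real
  assumes "\<delta> > 0" shows "(\<lambda>n. 2 powr (- (real n * \<delta>))) \<longlonglongrightarrow> 0"
proof -
  have "(\<lambda>n. (2 powr (- \<delta>)) ^ n) \<longlonglongrightarrow> 0"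
    using assms by (intro LIMSEQ_power_zero) (simp add: powr_less_one)
  then show ?thesis by (simp add: powr_power mult.commute[of _ \<delta>])
qed

lemma powr_floor_bounds:
  fixes x :: real
  assumes "x \<ge> 0"
  shows "2 ^ nat \<lfloor>x\<rfloor> \<le> 2 powr x" "2 powr (x - 1) \<le> 2 ^ nat \<lfloor>x\<rfloor>"
proof -
  have "real (nat \<lfloor>x\<rfloor>) \<le> x" "x - 1 \<le> real (nat \<lfloor>x\<rfloor>)" using assms by linarith+
  then show "2 ^ nat \<lfloor>x\<rfloor> \<le> 2 powr x" "2 powr (x - 1) \<le> 2 ^ nat \<lfloor>x\<rfloor>"
    by (simp_all flip: powr_realpow)
qed

text \<open>Repeats the condition inside \<open>distillable_coherence\<close> literally, so that the
  supremum unfolds to one over achievable rates.\<close>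

definition achievable_rate :: "nat \<Rightarrow> complex mat \<Rightarrow> real \<Rightarrow> bool" where
  "achievable_rate d \<rho> R \<longleftrightarrow> R \<ge> 0 \<and>
     (\<exists>(T :: nat \<Rightarrow> complex mat \<Rightarrow> complex mat) (\<epsilon> :: nat \<Rightarrow> real).
        (\<forall>n. incoherent_op (d ^ n) (2 ^ nat \<lfloor>real n * R\<rfloor>) (T n)) \<and>
        \<epsilon> \<longlonglongrightarrow> 0 \<and>
        (\<forall>n. fidelity (T n (tpow n \<rho>)) (tpow (nat \<lfloor>real n * R\<rfloor>) Phi2) \<ge> 1 - \<epsilon> n))"

lemma achievable_rateI:
  assumes "R \<ge> 0" "\<epsilon> \<longlonglongrightarrow> 0"
    and "\<And>n. \<exists>T. incoherent_op (d ^ n) (2 ^ nat \<lfloor>real n * R\<rfloor>) T \<and> 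
      fidelity (T (tpow n \<rho>)) (tpow (nat \<lfloor>real n * R\<rfloor>) Phi2) \<ge> 1 - \<epsilon> n"
  shows "achievable_rate d \<rho> R"
proof -
  obtain T where "\<And>n. incoherent_op (d ^ n) (2 ^ nat \<lfloor>real n * R\<rfloor>) (T n) \<and> 
      fidelity (T n (tpow n \<rho>)) (tpow (nat \<lfloor>real n * R\<rfloor>) Phi2) \<ge> 1 - \<epsilon> n"
    using assms(3) by metis
  then show ?thesis unfolding achievable_rate_def using assms(1,2) by blast
qed

section \<open>Rates for a fixed spectral decomposition\<close>

locale spectral_state =
  fixes d :: nat and \<rho> :: "complex mat" and u :: "nat \<Rightarrow> nat \<Rightarrow> complex" and l :: "nat \<Rightarrow> real"
  assumes \<rho>: "density d \<rho>" and u: "onb d u" and \<rho>u: "eqm d (\<lambda>i j. \<rho> $$ (i,j)) (fc d u l)"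
    and l: "\<forall>k<d. l k \<ge> 0" and l1: "(\<Sum>k<d. l k) = 1"
begin

definition "p i = Re (\<rho> $$ (i,i))"
definition "C = ent d p - ent d l"
abbreviation "L n \<equiv> prod_dist d n l"
abbreviation "D n \<equiv> prod_dist d n p"

lemma \<rho>c: "\<rho> \<in> carrier_mat d d" using \<rho> by (simp add: density_def)

lemma d: "d > 0" using l1 by (cases d) auto

lemma p: "k < d \<Longrightarrow> p k \<ge> 0"
  unfolding p_def by (subst density_diag(2)[OF u \<rho>u]) (use l in \<open>auto intro!: sum_nonneg\<close>)

lemma p1: "(\<Sum>k<d. p k) = 1"
  using \<rho> \<rho>c unfolding p_def density_def mtrace_def by (metis Re_sum carrier_matD(1) one_complex.sel(1))

lemma P_carrier: "tpow n \<rho> \<in> carrier_mat (d ^ n) (d ^ n)" by (rule tpow_carrier[OF \<rho>c])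
lemma U: "onb (d ^ n) (tensor_basis d n u)" by (rule onb_tensor_basis[OF d u])
lemma PU: "eqm (d ^ n) (\<lambda>i j. tpow n \<rho> $$ (i,j)) (fc (d ^ n) (tensor_basis d n u) (L n))"
  by (rule tpow_spectral[OF d \<rho>c \<rho>u])
lemma L: "L n i \<ge> 0" by (rule prod_dist_nonneg[OF d]) (use l in simp)
lemma D: "D n i \<ge> 0" by (rule prod_dist_nonneg[OF d p])
lemma L1: "(\<Sum>i<d ^ n. L n i) = 1" by (rule prod_dist_moments(1)[OF l1, of "\<lambda>_. 0"]) simp
lemma D1: "(\<Sum>i<d ^ n. D n i) = 1" by (rule prod_dist_moments(1)[OF p1, of "\<lambda>_. 0"]) simp

lemma diag: "i < d ^ n \<Longrightarrow> Re (tpow n \<rho> $$ (i,i)) = D n i"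
  using tpow_diag[OF d \<rho>c, of i n] density_diag(1)[OF u \<rho>u] by (simp add: p_def[abs_def])

text \<open>At rate 0 the output is one-dimensional, so the trace, with the rows of the identity as
  Kraus operators, has fidelity 1. This makes the supremum nonnegative, which
  \<open>below_C_achievable\<close> cannot supply when \<open>C\<close> is 0.\<close>

lemma zero_achievable: "achievable_rate d \<rho> 0"
proof (rule achievable_rateI[where \<epsilon> = "\<lambda>_. 0"])
  fix n
  let ?U = "tensor_basis d n u"
  have "(\<Sum>a<d ^ n. cnj (idm a i) * idm a i') = idm i i'" if "i < d ^ n" for i i'
    using that by (simp add: idm_def if_distrib[of "\<lambda>x. x * _"] if_distrib[of cnj] cong: if_cong)
  then obtain T where T: "incoherent_op (d ^ n) (2 ^ 0) T" "fidelity (T (tpow n \<rho>)) (tpow 0 Phi2) =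
    sqrt ((\<Sum>a<d ^ n. \<Sum>b<d ^ n. L n b * (cmod (\<Sum>k<d ^ n. idm a k * ?U k b))\<^sup>2) / 2 ^ 0)"
    using incoherent_op_of_rows[where j = "\<lambda>_. 0" and m = 0 and n = "d ^ n" and c = idm, OF _ _ P_carrier[of n] PU[of n]] L by auto
  have "(\<Sum>a<d ^ n. \<Sum>b<d ^ n. L n b * (cmod (\<Sum>k<d ^ n. idm a k * ?U k b))\<^sup>2) =
    (\<Sum>a<d ^ n. \<Sum>b<d ^ n. L n b * (cmod (?U a b))\<^sup>2)"
    by (rule sum.cong[OF refl], rule sum.cong[OF refl])
      (simp add: idm_def if_distrib[of "\<lambda>x. x * _"] cong: if_cong)
  also have "\<dots> = (\<Sum>b<d ^ n. \<Sum>a<d ^ n. L n b * (cmod (?U a b))\<^sup>2)" by (rule sum.swap)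
  also have "\<dots> = (\<Sum>b<d ^ n. L n b)"
    using onb_col_norm[OF U] by (simp add: sum_distrib_left[symmetric])
  finally have "fidelity (T (tpow n \<rho>)) (tpow 0 Phi2) = 1" using T(2) L1 by simp
  then show "\<exists>T. incoherent_op (d ^ n) (2 ^ nat \<lfloor>real n * 0\<rfloor>) T \<and> 
      fidelity (T (tpow n \<rho>)) (tpow (nat \<lfloor>real n * 0\<rfloor>) Phi2) \<ge> 1 - 0"
    using T(1) by (intro exI[of _ T]) simp
qed simp_all

lemma below_C_achievable:
  assumes R: "R \<ge> 0" "R < C"
  shows "achievable_rate d \<rho> R"
proof -
  \<comment> \<open>The gap is \<open>3 * \<delta>\<close>: one \<open>\<delta>\<close> goes to each
    of the two typicality estimates, and the third makes the remaining term decay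
    exponentially.\<close>
  define \<delta> where "\<delta> = (C - R) / 3"
  have \<delta>: "\<delta> > 0" using R by (simp add: \<delta>_def)
  have Rd: "R = ent d p - ent d l - 3 * \<delta>" by (simp add: \<delta>_def C_def diff_divide_distrib)
  define lo where "lo n = (\<Sum>i\<in>{i. i < d ^ n \<and> L n i < 2 powr (- (n * (ent d l + \<delta>)))}. L n i)" for n
  define hi where "hi n = (\<Sum>i\<in>{i. i < d ^ n \<and> D n i > 2 powr (- (n * (ent d p - \<delta>)))}. D n i)" for n
  define \<epsilon> where "\<epsilon> n = lo n + 3 / 2 * hi n + 2 powr (- (real n * \<delta>)) / 2" for n
  have lo0: "lo \<longlonglongrightarrow> 0"
    using typicality(2)[OF d _ l1 \<delta>] l unfolding lo_def[abs_def] by blast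
  have hi0: "hi \<longlonglongrightarrow> 0"
    using typicality(1)[OF d p p1 \<delta>] unfolding hi_def[abs_def] by blast
  have "\<epsilon> \<longlonglongrightarrow> 0 + 3 / 2 * 0 + 0 / 2"
    unfolding \<epsilon>_def[abs_def] by (intro tendsto_intros lo0 hi0 powr_linear_tendsto_0 \<delta>) simp
  then have \<epsilon>0: "\<epsilon> \<longlonglongrightarrow> 0" by simp
  show ?thesis
  proof (rule achievable_rateI[OF R(1) \<epsilon>0])
    fix n
    define m where "m = nat \<lfloor>real n * R\<rfloor>"
    let ?a = "2 powr (- (n * (ent d l + \<delta>)))" and ?s = "2 powr (- (n * (ent d p - \<delta>)))"
    define A where "A = {i. i < d ^ n \<and> ?a \<le> L n i}"
    define S where "S = {i. i < d ^ n \<and> D n i \<le> ?s}"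
    have A: "A \<subseteq> {..<d ^ n}" and S: "S \<subseteq> {..<d ^ n}" by (auto simp: A_def S_def)
    have sA: "(\<Sum>a\<in>A. L n a) = 1 - lo n"
    proof -
      have "{..<d ^ n} - A = {i. i < d ^ n \<and> L n i < ?a}" by (auto simp: A_def)
      then show ?thesis using sum.subset_diff[OF A, of "L n"] L1[of n] by (simp add: lo_def)
    qed
    have sS: "(\<Sum>i\<in>{..<d ^ n} - S. Re (tpow n \<rho> $$ (i,i))) = hi n"
    proof -
      have "{..<d ^ n} - S = {i. i < d ^ n \<and> D n i > ?s}" by (auto simp: S_def)
      then show ?thesis by (simp add: hi_def diag)
    qed
    have lo_nn: "lo n \<ge> 0" using L by (auto simp: lo_def intro!: sum_nonneg)
    have "card A \<le> 2 powr (n * (ent d l + \<delta>))"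
      by (rule card_le_of_sum_le_1[of _ _ "L n"]) (use finite_subset[OF A] sA lo_nn in \<open>auto simp: A_def\<close>)
    moreover have "2 ^ m \<le> 2 powr (n * R)" unfolding m_def using R by (intro powr_floor_bounds) simp
    ultimately have "2 ^ m * ?s * card A \<le> 2 powr (n * R) * ?s * 2 powr (n * (ent d l + \<delta>))"
      by (intro mult_mono) auto
    also have "\<dots> = 2 powr (- (real n * \<delta>))"
      unfolding powr_add[symmetric] Rd by (simp add: algebra_simps)
    finally have le: "2 ^ m * ?s * card A \<le> 2 powr (- (real n * \<delta>))" .
    have "\<exists>T. incoherent_op (d ^ n) (2 ^ m) T \<and> fidelity (T (tpow n \<rho>)) (tpow m Phi2) \<ge>
      (\<Sum>a\<in>A. L n a) - 3 / 2 * (\<Sum>i\<in>{..<d ^ n} - S. Re (tpow n \<rho> $$ (i,i))) - 2 ^ m * ?s * card A / 2"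
      by (rule achievability_one_shot[OF P_carrier U PU _ L1 A S]) (auto simp: L S_def diag)
    then obtain T where T: "incoherent_op (d ^ n) (2 ^ m) T" 
      "(1 - lo n) - 3 / 2 * hi n - 2 ^ m * ?s * card A / 2 \<le> fidelity (T (tpow n \<rho>)) (tpow m Phi2)"
      unfolding sA sS by blast
    have "1 - \<epsilon> n \<le> fidelity (T (tpow n \<rho>)) (tpow m Phi2)"
      using T(2) le unfolding \<epsilon>_def by linarith
    then show "\<exists>T. incoherent_op (d ^ n) (2 ^ nat \<lfloor>real n * R\<rfloor>) T \<and> 
      fidelity (T (tpow n \<rho>)) (tpow (nat \<lfloor>real n * R\<rfloor>) Phi2) \<ge> 1 - \<epsilon> n"
      using T(1) unfolding m_def by blast
  qed
qed

lemma achievable_le_C: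
  assumes "achievable_rate d \<rho> R"
  shows "R \<le> C"
proof (rule ccontr)
  assume "\<not> R \<le> C"
  then have RC: "C < R" by simp
  obtain T \<epsilon> where R: "R \<ge> 0" and T: "\<And>n. incoherent_op (d ^ n) (2 ^ nat \<lfloor>real n * R\<rfloor>) (T n)"
    and \<epsilon>: "\<epsilon> \<longlonglongrightarrow> 0" and F: "\<And>n. fidelity (T n (tpow n \<rho>)) (tpow (nat \<lfloor>real n * R\<rfloor>) Phi2) \<ge> 1 - \<epsilon> n"
    using assms unfolding achievable_rate_def by blast
  \<comment> \<open>Again two parts of the gap go to typicality and one to exponential
    decay.\<close>
  define \<delta> where "\<delta> = (R - C) / 3"
  have \<delta>: "\<delta> > 0" using RC by (simp add: \<delta>_def)
  have Rd: "R = ent d p - ent d l + 3 * \<delta>" by (simp add: \<delta>_def C_def diff_divide_distrib)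
  define hi where "hi n = (\<Sum>i\<in>{i. i < d ^ n \<and> L n i > 2 powr (- (n * (ent d l - \<delta>)))}. L n i)" for n
  define lo where "lo n = (\<Sum>i\<in>{i. i < d ^ n \<and> D n i < 2 powr (- (n * (ent d p + \<delta>)))}. D n i)" for n
  define b where "b n = hi n + 4 * 2 powr (- (real n * \<delta>)) + 2 * lo n" for n
  have hi0: "hi \<longlonglongrightarrow> 0"
    using typicality(1)[OF d _ l1 \<delta>] l unfolding hi_def[abs_def] by blast
  have lo0: "lo \<longlonglongrightarrow> 0"
    using typicality(2)[OF d p p1 \<delta>] unfolding lo_def[abs_def] by blast
  have "b \<longlonglongrightarrow> 0 + 4 * 0 + 2 * 0"
    unfolding b_def[abs_def] by (intro tendsto_intros lo0 hi0 powr_linear_tendsto_0 \<delta>)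
  then have b0: "b \<longlonglongrightarrow> 0" by simp
  have Fb: "(fidelity (T n (tpow n \<rho>)) (tpow (nat \<lfloor>real n * R\<rfloor>) Phi2))\<^sup>2 \<le> b n" for n
  proof -
    define m where "m = nat \<lfloor>real n * R\<rfloor>"
    let ?a = "2 powr (- (n * (ent d l - \<delta>)))" and ?s = "2 powr (- (n * (ent d p + \<delta>)))"
    define S where "S = {i. i < d ^ n \<and> ?s \<le> D n i}"
    have S: "S \<subseteq> {..<d ^ n}" by (auto simp: S_def)
    have fS: "finite S" using S finite_subset by blast
    have sS: "(\<Sum>i\<in>{..<d ^ n} - S. Re (tpow n \<rho> $$ (i,i))) = lo n"
    proof -
      have "{..<d ^ n} - S = {i. i < d ^ n \<and> D n i < ?s}" by (auto simp: S_def)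
      then show ?thesis by (simp add: lo_def diag)
    qed
    have "(\<Sum>i\<in>S. D n i) \<le> (\<Sum>i<d ^ n. D n i)" using S D by (intro sum_mono2) auto
    then have "card S \<le> 2 powr (n * (ent d p + \<delta>))"
      by (intro card_le_of_sum_le_1[of _ _ "D n"]) (use fS D1 in \<open>auto simp: S_def\<close>)
    moreover have m: "2 powr (n * R - 1) \<le> 2 ^ m" unfolding m_def using R by (intro powr_floor_bounds) simp
    ultimately have "2 * ?a * card S / 2 ^ m \<le> 2 * ?a * 2 powr (n * (ent d p + \<delta>)) / 2 powr (n * R - 1)"
      by (intro frac_le mult_left_mono) auto
    \<comment> \<open>One factor 2 comes from the one-shot bound, the other from rounding
      \<open>n * R\<close> down.\<close>
    also have "\<dots> = 4 * 2 powr (- (real n * \<delta>))"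
    proof -
      have "?a * 2 powr (n * (ent d p + \<delta>)) / 2 powr (n * R - 1) = 2 powr (1 + - (real n * \<delta>))"
        unfolding powr_add[symmetric] powr_diff[symmetric] Rd by (simp add: algebra_simps)
      also have "\<dots> = 2 * 2 powr (- (real n * \<delta>))" by (subst powr_add) simp
      finally have "2 * (?a * 2 powr (n * (ent d p + \<delta>)) / 2 powr (n * R - 1)) = 4 * 2 powr (- (real n * \<delta>))"
        by (simp only:)
      then show ?thesis by (simp only: mult.assoc times_divide_eq_right)
    qed
    finally have le: "2 * ?a * card S / 2 ^ m \<le> 4 * 2 powr (- (real n * \<delta>))" .
    have "(fidelity (T n (tpow n \<rho>)) (tpow m Phi2))\<^sup>2 \<le> (\<Sum>b\<in>{b. b < d ^ n \<and> L n b > ?a}. L n b)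
       + 2 * ?a * card S / 2 ^ m + 2 * (\<Sum>i\<in>{..<d ^ n} - S. Re (tpow n \<rho> $$ (i,i)))"
      by (rule converse_one_shot[OF _ P_carrier U PU _ _ S]) (use T[of n] L in \<open>auto simp: m_def\<close>)
    also have "\<dots> \<le> b n" using le unfolding sS b_def hi_def by linarith
    finally show ?thesis unfolding m_def .
  qed
  \<comment> \<open>A single large \<open>n\<close> gives the contradiction: the fidelity is at
    least 1/2 there while its square is below 1/4.\<close>
  have "\<forall>\<^sub>F n in sequentially. \<epsilon> n < 1 / 2 \<and> b n < 1 / 4"
    by (intro eventually_conj order_tendstoD(2)[OF \<epsilon>] order_tendstoD(2)[OF b0]) simp_all
  then obtain n where n: "\<epsilon> n < 1 / 2" "b n < 1 / 4" using eventually_happens'[OF sequentially_bot] by blast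
  have "1 / 2 \<le> fidelity (T n (tpow n \<rho>)) (tpow (nat \<lfloor>real n * R\<rfloor>) Phi2)" using F[of n] n(1) by linarith
  then have "(1 / 2)\<^sup>2 \<le> (fidelity (T n (tpow n \<rho>)) (tpow (nat \<lfloor>real n * R\<rfloor>) Phi2))\<^sup>2" by (intro power_mono) simp_all
  also note Fb
  finally show False using n(2) by (simp add: power2_eq_square)
qed

lemma distillable_coherence_eq: "distillable_coherence d \<rho> = ereal C"
proof -
  have Sup: "distillable_coherence d \<rho> = Sup {ereal R | R. achievable_rate d \<rho> R}"
    unfolding distillable_coherence_def achievable_rate_def ..
  show ?thesis
  proof (rule antisym)
    show "distillable_coherence d \<rho> \<le> ereal C"
      unfolding Sup using achievable_le_C by (intro Sup_least) auto
    show "ereal C \<le> distillable_coherence d \<rho>"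
    proof (rule ccontr)
      assume "\<not> ?thesis"
      \<comment> \<open>A real rate strictly between the two values is positive, since rate 0 is
        achievable, and lies below \<open>C\<close>; so it is achievable and yet exceeds the
        supremum.\<close>
      then obtain R where R: "distillable_coherence d \<rho> < ereal R" "ereal R < ereal C"
        using ereal_dense2 by (metis linorder_not_le)
      have "ereal 0 \<le> distillable_coherence d \<rho>"
        unfolding Sup using zero_achievable by (intro Sup_upper) blast
      from this R(1) have "ereal 0 < ereal R" by (rule order_le_less_trans)
      then have "achievable_rate d \<rho> R" using R(2) by (intro below_C_achievable) simp_all
      then have "ereal R \<le> distillable_coherence d \<rho>" unfolding Sup by (intro Sup_upper) blast
      then show False using R(1) by simp
    qed
  qed
qed

end

theorem theorem3:
  fixes d :: nat and \<rho> :: "complex mat"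
  assumes "density d \<rho>"
  shows "distillable_coherence d \<rho> = rel_entropy_coherence d \<rho> \<and>
         (\<exists>\<sigma>. incoherent_state d \<sigma> \<and> rel_entropy_coherence d \<rho> = rel_entropy \<rho> \<sigma>)"
proof -
  obtain u l where ul: "onb d u" "eqm d (\<lambda>i j. \<rho> $$ (i,j)) (fc d u l)" "\<forall>k<d. l k \<ge> 0" "(\<Sum>k<d. l k) = 1"
    using density_spectral[OF assms] by blast
  interpret spectral_state d \<rho> u l using assms ul by unfold_locales
  have "ent d (\<lambda>i. Re (\<rho> $$ (i,i))) - ent d l = C" by (simp add: C_def p_def[abs_def])
  then show ?thesis
    using rel_entropy_coherence_eq[OF assms ul(1,2)] distillable_coherence_eq by auto
qed

end
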